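(* Let $H$ be a computable Hilbert space. A sequence $(f_i)\subseteq H$ is a computable frame for $H$ if and only if the synthesis operator $T:\ell^2(\mathbb{N})\to H$ given by $(c_k)\mapsto \sum_{k=1}^{\infty} c_k f_k$ is a (well-defined) computable operator from $\ell^2(\mathbb{N})$ onto $H$.
   Context: Computability conventions (representation-based computable analysis). $\Sigma$ is a finite alphabet containing $0,1$. A partial function $F:\subseteq\Sigma^\omega\to\Sigma^\omega$ is computable if a Turing machine, running forever with a one-way output tape, transforms each $p\in\mathrm{dom}(F)$ on its input tape into $F(p)$. A representation of a set $X$ is a surjective partial map $\delta:\subseteq\Sigma^\omega\to X$; $p$ with $\delta(p)=x$ is a $\delta$-name of $x$. A partial function $f:\subseteq X\to Y$ between represented spaces $(X,\delta),(Y,\delta')$ is computable (or $(\delta,\delta')$-computable) if there is a computable $F$ with $\delta'F(p)=f\delta(p)$ for all $p\in\mathrm{dom}(f\delta)$. $\mathbb{N}$ is represented by $\delta_{\mathbb N}(1^n0^\omega)=n$; a computable sequence in $X$ is a computable function $\mathbb{N}\to X$. A computable metric space $(X,d,\alpha)$ is a metric space with a dense sequence $\alpha:\mathbb{N}\to X$ such that $d\circ(\alpha\times\alpha)$ is a computable double sequence of reals; it is represented by its Cauchy representation $\delta_X(01^{n_0+1}01^{n_1+1}\dots)=\lim_i\alpha(n_i)$, defined when $(\alpha(n_i))$ converges and $d(\alpha(n_i),\alpha(n_j))<2^{-i}$ for all $j>i$. $\mathbb{R}$ carries the Cauchy representation for the standard numbering of $\mathbb{Q}$ (similarly $\mathbb{C}$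 with $\mathbb{Q}[i]$). With $\mathbb{F}\in\{\mathbb{R},\mathbb{C}\}$, a computable Hilbert space over $\mathbb{F}$ is a separable Hilbert space $H$ with a sequence $e:\mathbb{N}\to H$ with dense linear span such that $H$ with the norm metric and the dense sequence $\alpha_e$, $\alpha_e\langle k,\langle n_0,\dots,n_k\rangle\rangle=\sum_{i=0}^k\alpha_{\mathbb F}(n_i)e_i$ ($\alpha_{\mathbb F}$ a standard numbering of $\mathbb{Q}$, resp. $\mathbb{Q}[i]$, and $\langle\cdot\rangle$ Cantor tupling), is a computable metric space; its Cauchy representation is $\delta_H$. The space $\ell^2=\ell^2(\mathbb{N})$ is a computable Hilbert space with its standard orthonormal basis. "Operator" means linear operator; a computable operator is one computable with respect to Cauchy representations. A computable frame for $H$ is a computable sequence $(f_i)$ in $H$ that is a frame, i.e. there are constants $A,B>0$ with $A\|f\|^2\le\sum_i|\langle f,f_i\rangle|^2\le B\|f\|^2$ for all $f\in H$. *)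

theory Defs
  imports "HOL-Analysis.Analysis" "HOL-Library.Stream" "HOL-Library.Nat_Bijection"
begin

section \<open>Type-2 Turing machines\<close>

text \<open>
  The finite alphabet \<open>\<Sigma>\<close> is an arbitrary type \<open>'s\<close> of class \<open>{finite, zero_neq_one}\<close>, and
  \<open>\<Sigma>\<^sup>\<omega>\<close> is \<open>'s stream\<close>.

  A machine has a one-way read-only input tape, a one-way write-only output tape and finitely many
  two-way infinite work tapes.  States and work-tape symbols are initial segments of the naturals;
  state \<open>0\<close> is the initial state and symbol \<open>0\<close> the blank.  Depending on the state, the scanned
  input symbol and the list of scanned work symbols, one step yields the new state, whether the
  input head advances, a symbol to be written and a head move for each work tape, and possibly one
  symbol to be appended to the output.  There is no halting state: machines run forever.
\<close>

datatype move = MoveLeft | Stay | MoveRight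

fun shift_head :: "move \<Rightarrow> int \<Rightarrow> int" where
  "shift_head MoveLeft h = h - 1"
| "shift_head Stay h = h"
| "shift_head MoveRight h = h + 1"

record 's machine =
  num_states :: nat
  num_tapes :: nat
  num_symbols :: nat
  trans :: "nat \<Rightarrow> 's \<Rightarrow> nat list \<Rightarrow> nat \<times> bool \<times> (nat \<times> move) list \<times> 's option"

definition wf_machine :: "'s machine \<Rightarrow> bool" where
  "wf_machine M \<longleftrightarrow> 0 < num_states M \<and> 0 < num_symbols M \<and>
     (\<forall>q a ws. q < num_states M \<and> length ws = num_tapes M \<and> set ws \<subseteq> {..<num_symbols M} \<longrightarrow>
        (case trans M q a ws of (q', adv, acts, out) \<Rightarrow>
           q' < num_states M \<and> length acts = num_tapes M \<and> fst ` set acts \<subseteq> {..<num_symbols M}))"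

text \<open>
  Configurations consist of the state, the position of the input head, the contents and head
  positions of the work tapes, and the (finite) contents of the output tape.
\<close>

type_synonym 's configuration = "nat \<times> nat \<times> ((int \<Rightarrow> nat) \<times> int) list \<times> 's list"

definition initial :: "'s machine \<Rightarrow> 's configuration" where
  "initial M = (0, 0, replicate (num_tapes M) (\<lambda>_. 0, 0), [])"

definition step :: "'s machine \<Rightarrow> 's stream \<Rightarrow> 's configuration \<Rightarrow> 's configuration" where
  "step M p = (\<lambda>(q, i, ts, w).
     case trans M q (p !! i) (map (\<lambda>(t, h). t h) ts) of (q', adv, acts, out) \<Rightarrow>
       (q', if adv then Suc i else i,
        map2 (\<lambda>(b, m) (t, h). (t(h := b), shift_head m h)) acts ts,
        case out of None \<Rightarrow> w | Some b \<Rightarrow> w @ [b]))"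

definition output_after :: "'s machine \<Rightarrow> 's stream \<Rightarrow> nat \<Rightarrow> 's list" where
  "output_after M p t = (case (step M p ^^ t) (initial M) of (q, i, ts, w) \<Rightarrow> w)"

text \<open>
  As the output tape starts empty and grows by at most one symbol per step, the next condition says
  that exactly \<open>r\<close> is written on it in the infinite run on input \<open>p\<close>.
\<close>

definition transforms :: "'s machine \<Rightarrow> 's stream \<Rightarrow> 's stream \<Rightarrow> bool" where
  "transforms M p r \<longleftrightarrow> (\<forall>n. \<exists>t. output_after M p t = stake n r)"

definition tm_computable :: "('s::finite stream \<rightharpoonup> 's stream) \<Rightarrow> bool" where
  "tm_computable F \<longleftrightarrow> (\<exists>M. wf_machine M \<and> (\<forall>p r. F p = Some r \<longrightarrow> transforms M p r))"


section \<open>Represented spaces\<close>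

definition computable ::
  "('s::finite stream \<rightharpoonup> 'x) \<Rightarrow> ('s stream \<rightharpoonup> 'y) \<Rightarrow> ('x \<rightharpoonup> 'y) \<Rightarrow> bool" where
  "computable \<delta> \<delta>' f \<longleftrightarrow>
     (\<exists>F. tm_computable F \<and> (\<forall>p \<in> dom (f \<circ>\<^sub>m \<delta>). (\<delta>' \<circ>\<^sub>m F) p = (f \<circ>\<^sub>m \<delta>) p))"

definition nat_name :: "'s::zero_neq_one stream \<Rightarrow> nat \<Rightarrow> bool" where
  "nat_name p n \<longleftrightarrow> p = replicate n 1 @- sconst 0"

definition nat_rep :: "'s::zero_neq_one stream \<rightharpoonup> nat" where
  "nat_rep p = (if \<exists>n. nat_name p n then Some (THE n. nat_name p n) else None)"

text \<open>The stream \<open>0 1\<^bsup>n\<^sub>0+1\<^esup> 0 1\<^bsup>n\<^sub>1+1\<^esup> \<dots>\<close>\<close>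

definition encode_seq :: "nat stream \<Rightarrow> 's::zero_neq_one stream" where
  "encode_seq ns = flat (smap (\<lambda>n. 0 # replicate (Suc n) 1) ns)"

definition cauchy_name ::
  "(nat \<Rightarrow> 'x::metric_space) \<Rightarrow> 's::zero_neq_one stream \<Rightarrow> 'x \<Rightarrow> bool" where
  "cauchy_name \<alpha> p x \<longleftrightarrow> (\<exists>ns. p = encode_seq ns \<and>
     (\<forall>i j. i < j \<longrightarrow> dist (\<alpha> (ns !! i)) (\<alpha> (ns !! j)) < (1/2) ^ i) \<and>
     (\<lambda>i. \<alpha> (ns !! i)) \<longlonglongrightarrow> x)"

definition cauchy_rep ::
  "(nat \<Rightarrow> 'x::metric_space) \<Rightarrow> 's::zero_neq_one stream \<rightharpoonup> 'x" where
  "cauchy_rep \<alpha> p = (if \<exists>x. cauchy_name \<alpha> p x then Some (THE x. cauchy_name \<alpha> p x) else None)"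

lemma nat_name_unique:
  assumes "nat_name p m" "nat_name p n"
  shows "m = n"
proof -
  have *: False if "nat_name q a" "nat_name q b" "a < b" for q :: "'a stream" and a b
  proof -
    have "q !! a = 0" using that(1) by (simp add: nat_name_def shift_snth_ge)
    moreover have "q !! a = 1" using that(2,3) by (simp add: nat_name_def shift_snth_less)
    ultimately show False by simp
  qed
  show ?thesis using *[of p m n] *[of p n m] assms by (meson linorder_neqE_nat)
qed

lemma nat_rep_eq_Some: "nat_rep p = Some n \<longleftrightarrow> nat_name p n"
  unfolding nat_rep_def using nat_name_unique by (auto intro!: the_equality intro: theI)

lemma encode_seq_unfold:
  "encode_seq ns = 0 ## replicate (Suc (shd ns)) 1 @- encode_seq (stl ns)"
  unfolding encode_seq_def by (subst flat_unfold) auto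

lemma replicate_shift_eq:
  assumes "replicate m 1 @- (0 ## p) = replicate n 1 @- (0 ## (q :: 's::zero_neq_one stream))"
  shows "m = n \<and> p = q"
  using assms
proof (induction m arbitrary: n)
  case 0 then show ?case by (cases n) auto
next
  case (Suc m) then show ?case by (cases n) auto
qed

lemma encode_seq_inject: "(encode_seq ms :: 's::zero_neq_one stream) = encode_seq ns \<longleftrightarrow> ms = ns"
proof
  assume "(encode_seq ms :: 's stream) = encode_seq ns"
  then show "ms = ns"
  proof (coinduction arbitrary: ms ns)
    case Eq_stream
    then have "replicate (Suc (shd ms)) (1::'s) @- encode_seq (stl ms)
             = replicate (Suc (shd ns)) 1 @- encode_seq (stl ns)"
      by (metis encode_seq_unfold stream.inject)
    moreover obtain p q :: "'s stream" where
      "encode_seq (stl ms) = 0 ## p" "encode_seq (stl ns) = 0 ## q"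
      using encode_seq_unfold by metis
    ultimately show ?case
      using replicate_shift_eq[of "Suc (shd ms)" p "Suc (shd ns)" q] by auto
  qed
qed simp

lemma cauchy_name_unique: "cauchy_name \<alpha> p x \<Longrightarrow> cauchy_name \<alpha> p y \<Longrightarrow> x = y"
  unfolding cauchy_name_def by (metis encode_seq_inject LIMSEQ_unique)

lemma cauchy_rep_eq_Some: "cauchy_rep \<alpha> p = Some x \<longleftrightarrow> cauchy_name \<alpha> p x"
  unfolding cauchy_rep_def using cauchy_name_unique by (auto intro!: the_equality intro: theI)


section \<open>Computable metric spaces\<close>

definition rat_numbering :: "nat \<Rightarrow> real" where
  "rat_numbering n = (case prod_decode n of (m, k) \<Rightarrow>
     case prod_decode m of (i, j) \<Rightarrow> (real i - real j) / real (Suc k))"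

lemma range_rat_numbering: "range rat_numbering = \<rat>"
proof
  show "range rat_numbering \<subseteq> \<rat>"
    by (auto simp: rat_numbering_def split: prod.split)
  show "\<rat> \<subseteq> range rat_numbering"
  proof
    fix x :: real assume "x \<in> \<rat>"
    then obtain a :: int and b :: nat where ab: "b \<noteq> 0" "x = of_int a / real b"
      unfolding Rats_eq_int_div_nat by auto
    then have "x = (real (nat a) - real (nat (- a))) / real (Suc (b - 1))"
      by (cases "a \<ge> 0") auto
    then have "x = rat_numbering (prod_encode (prod_encode (nat a, nat (- a)), b - 1))"
      by (simp add: rat_numbering_def)
    then show "x \<in> range rat_numbering" by blast
  qed
qed

text \<open>The double sequence of distances is indexed through the Cantor pairing function.\<close>

definition computable_metric_space ::
  "'s::{finite,zero_neq_one} itself \<Rightarrow> (nat \<Rightarrow> 'x::metric_space) \<Rightarrow> bool" where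
  "computable_metric_space _ \<alpha> \<longleftrightarrow> closure (range \<alpha>) = UNIV \<and>
     computable (nat_rep :: 's stream \<rightharpoonup> nat) (cauchy_rep rat_numbering)
       (\<lambda>n. case prod_decode n of (i, j) \<Rightarrow> Some (dist (\<alpha> i) (\<alpha> j)))"


section \<open>Hilbert spaces over the real or complex numbers\<close>

text \<open>The members of this class are, up to isometric isomorphism, exactly \<open>\<real>\<close> and \<open>\<complex>\<close>.\<close>

class real_or_complex = real_normed_field +
  fixes to_complex :: "'a \<Rightarrow> complex"
  assumes to_complex_add: "to_complex (x + y) = to_complex x + to_complex y"
    and to_complex_mult: "to_complex (x * y) = to_complex x * to_complex y"
    and to_complex_one: "to_complex 1 = 1"
    and to_complex_scaleR: "to_complex (r *\<^sub>R x) = r *\<^sub>R to_complex x"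
    and norm_to_complex: "norm (to_complex x) = norm x"
    and range_to_complex: "range to_complex = \<real> \<or> range to_complex = UNIV"

lemma to_complex_of_real: "to_complex (of_real r) = of_real r"
  by (simp add: of_real_def to_complex_scaleR to_complex_one)

instantiation real :: real_or_complex
begin
definition to_complex_real :: "real \<Rightarrow> complex" where "to_complex_real = complex_of_real"
instance by standard (auto simp: to_complex_real_def Reals_def scaleR_conv_of_real)
end

instantiation complex :: real_or_complex
begin
definition to_complex_complex :: "complex \<Rightarrow> complex" where "to_complex_complex z = z"
instance by standard (auto simp: to_complex_complex_def)
end

text \<open>The numbering of \<open>\<rat>\<close> or \<open>\<rat>[\<i>]\<close>, depending on the field.\<close>

definition scalar_numbering :: "nat \<Rightarrow> 'k::real_or_complex" where
  "scalar_numbering n =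
     (if range (to_complex :: 'k \<Rightarrow> complex) = UNIV
      then case prod_decode n of (a, b) \<Rightarrow>
             inv to_complex (Complex (rat_numbering a) (rat_numbering b))
      else of_real (rat_numbering n))"

lemma scalar_numbering_real: "(scalar_numbering :: nat \<Rightarrow> real) = rat_numbering"
proof -
  have "\<i> \<notin> range complex_of_real"
    by (metis Im_complex_of_real imaginary_unit.sel(2) rangeE zero_neq_one)
  then show ?thesis by (auto simp: scalar_numbering_def to_complex_real_def fun_eq_iff)
qed

lemma scalar_numbering_complex:
  "scalar_numbering (prod_encode (a, b)) = Complex (rat_numbering a) (rat_numbering b)"
proof -
  have "(to_complex :: complex \<Rightarrow> complex) = id"
    by (auto simp: to_complex_complex_def)
  then show ?thesis by (simp add: scalar_numbering_def)
qed

text \<open>A Hilbert space is a Banach space whose norm is induced by an inner product.\<close>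

locale hilbert_space = vector_space smul
  for smul :: "'k::real_or_complex \<Rightarrow> 'h::banach \<Rightarrow> 'h" +
  fixes ip :: "'h \<Rightarrow> 'h \<Rightarrow> 'k"
  assumes scale_of_real: "smul (of_real r) x = r *\<^sub>R x"
    and ip_add_left: "ip (x + y) z = ip x z + ip y z"
    and ip_scale_left: "ip (smul a x) y = a * ip x y"
    and ip_commute: "to_complex (ip y x) = cnj (to_complex (ip x y))"
    and ip_self: "ip x x = of_real ((norm x)\<^sup>2)"

lemma hilbert_space_real:
  "hilbert_space ((*\<^sub>R) :: real \<Rightarrow> 'h::{real_inner,banach} \<Rightarrow> 'h) (\<bullet>)"
  by unfold_locales
     (auto simp: inner_add_left inner_commute to_complex_real_def power2_norm_eq_inner algebra_simps)


section \<open>Computable Hilbert spaces\<close>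

text \<open>Cantor tupling of nonempty lists, and its inverse for tuples of length \<open>k + 1\<close>\<close>

fun tuple_encode :: "nat list \<Rightarrow> nat" where
  "tuple_encode [] = 0"
| "tuple_encode [n] = n"
| "tuple_encode (n # m # ns) = prod_encode (n, tuple_encode (m # ns))"

fun tuple_decode :: "nat \<Rightarrow> nat \<Rightarrow> nat list" where
  "tuple_decode 0 t = [t]"
| "tuple_decode (Suc k) t = (case prod_decode t of (n, t') \<Rightarrow> n # tuple_decode k t')"

lemma tuple_decode_encode: "length ns = Suc k \<Longrightarrow> tuple_decode k (tuple_encode ns) = ns"
proof (induction ns arbitrary: k rule: tuple_encode.induct)
  case (3 n m ns)
  then show ?case by (cases k) auto
qed auto

definition span_numbering ::
  "('k::real_or_complex \<Rightarrow> 'h::ab_group_add \<Rightarrow> 'h) \<Rightarrow> (nat \<Rightarrow> 'h) \<Rightarrow> nat \<Rightarrow> 'h" where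
  "span_numbering smul e n = (case prod_decode n of (k, t) \<Rightarrow>
     \<Sum>i\<le>k. smul (scalar_numbering (tuple_decode k t ! i)) (e i))"

lemma span_numbering_encode:
  "length ns = Suc k \<Longrightarrow> span_numbering smul e (prod_encode (k, tuple_encode ns)) =
     (\<Sum>i\<le>k. smul (scalar_numbering (ns ! i)) (e i))"
  by (simp add: span_numbering_def tuple_decode_encode)

definition computable_hilbert_space ::
  "'s::{finite,zero_neq_one} itself \<Rightarrow> ('k::real_or_complex \<Rightarrow> 'h::banach \<Rightarrow> 'h) \<Rightarrow>
   ('h \<Rightarrow> 'h \<Rightarrow> 'k) \<Rightarrow> (nat \<Rightarrow> 'h) \<Rightarrow> bool" where
  "computable_hilbert_space \<Sigma> smul ip e \<longleftrightarrow>
     hilbert_space smul ip \<and>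
     separable_space (euclidean :: 'h topology) \<and>
     closure (module.span smul (range e)) = UNIV \<and>
     computable_metric_space \<Sigma> (span_numbering smul e)"

definition computable_operator ::
  "'s::{finite,zero_neq_one} itself \<Rightarrow>
   ('k::real_or_complex \<Rightarrow> 'g::real_normed_vector \<Rightarrow> 'g) \<Rightarrow> (nat \<Rightarrow> 'g) \<Rightarrow>
   ('k \<Rightarrow> 'h::real_normed_vector \<Rightarrow> 'h) \<Rightarrow> (nat \<Rightarrow> 'h) \<Rightarrow> ('g \<Rightarrow> 'h) \<Rightarrow> bool" where
  "computable_operator _ smul1 e1 smul2 e2 T \<longleftrightarrow>
     Vector_Spaces.linear smul1 smul2 T \<and>
     computable (cauchy_rep (span_numbering smul1 e1) :: 's stream \<rightharpoonup> 'g)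
       (cauchy_rep (span_numbering smul2 e2)) (Some \<circ> T)"


section \<open>The space of square-summable sequences\<close>

typedef (overloaded) 'k ell2 = "{c :: nat \<Rightarrow> 'k::real_or_complex. summable (\<lambda>i. (norm (c i))\<^sup>2)}"
  morphisms coord Abs_ell2
  by (rule exI[of _ "\<lambda>_. 0"]) simp

setup_lifting type_definition_ell2

lemma square_sum_le:
  fixes a b :: "nat \<Rightarrow> 'k::real_normed_vector"
  assumes "summable (\<lambda>i. (norm (a i))\<^sup>2)" "summable (\<lambda>i. (norm (b i))\<^sup>2)"
  shows "(\<Sum>i<n. (norm (a i + b i))\<^sup>2)
       \<le> (sqrt (\<Sum>i. (norm (a i))\<^sup>2) + sqrt (\<Sum>i. (norm (b i))\<^sup>2))\<^sup>2"
proof -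
  have "L2_set (\<lambda>i. norm (a i + b i)) {..<n} \<le> L2_set (\<lambda>i. norm (a i) + norm (b i)) {..<n}"
    by (intro L2_set_mono) (auto simp: norm_triangle_ineq)
  also have "\<dots> \<le> L2_set (\<lambda>i. norm (a i)) {..<n} + L2_set (\<lambda>i. norm (b i)) {..<n}"
    by (rule L2_set_triangle_ineq)
  also have "\<dots> \<le> sqrt (\<Sum>i. (norm (a i))\<^sup>2) + sqrt (\<Sum>i. (norm (b i))\<^sup>2)"
    unfolding L2_set_def
    by (intro add_mono real_sqrt_le_mono sum_le_suminf assms) auto
  finally show ?thesis
    unfolding L2_set_def by (rule sqrt_le_D)
qed

lemma square_summable_add:
  fixes a b :: "nat \<Rightarrow> 'k::real_normed_vector"
  assumes "summable (\<lambda>i. (norm (a i))\<^sup>2)" "summable (\<lambda>i. (norm (b i))\<^sup>2)"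
  shows "summable (\<lambda>i. (norm (a i + b i))\<^sup>2)"
  by (rule bounded_imp_summable[OF _ square_sum_le[OF assms, of "Suc _", unfolded lessThan_Suc_atMost]])
     auto

instantiation ell2 :: (real_or_complex) real_normed_vector
begin

lift_definition zero_ell2 :: "'a ell2" is "\<lambda>_. 0" by simp
lift_definition plus_ell2 :: "'a ell2 \<Rightarrow> 'a ell2 \<Rightarrow> 'a ell2" is "\<lambda>a b i. a i + b i"
  by (rule square_summable_add)
lift_definition uminus_ell2 :: "'a ell2 \<Rightarrow> 'a ell2" is "\<lambda>a i. - a i" by simp
lift_definition minus_ell2 :: "'a ell2 \<Rightarrow> 'a ell2 \<Rightarrow> 'a ell2" is "\<lambda>a b i. a i - b i"
  subgoal for a b using square_summable_add[of a "\<lambda>i. - b i"] by simp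
  done
lift_definition scaleR_ell2 :: "real \<Rightarrow> 'a ell2 \<Rightarrow> 'a ell2" is "\<lambda>r a i. r *\<^sub>R a i"
  by (simp add: power_mult_distrib summable_mult)
lift_definition norm_ell2 :: "'a ell2 \<Rightarrow> real" is "\<lambda>a. sqrt (\<Sum>i. (norm (a i))\<^sup>2)" .

definition dist_ell2 :: "'a ell2 \<Rightarrow> 'a ell2 \<Rightarrow> real" where "dist_ell2 x y = norm (x - y)"
definition sgn_ell2 :: "'a ell2 \<Rightarrow> 'a ell2" where "sgn_ell2 x = inverse (norm x) *\<^sub>R x"
definition uniformity_ell2 :: "('a ell2 \<times> 'a ell2) filter" where
  "uniformity_ell2 = (INF e\<in>{0<..}. principal {(x, y). dist x y < e})"
definition open_ell2 :: "'a ell2 set \<Rightarrow> bool" where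
  "open_ell2 U \<longleftrightarrow> (\<forall>x\<in>U. eventually (\<lambda>(x', y). x' = x \<longrightarrow> y \<in> U) uniformity)"

instance
proof
  fix x y z :: "'a ell2" and r s :: real
  show "x + y + z = x + (y + z)" by transfer (simp add: add.assoc)
  show "x + y = y + x" by transfer (simp add: add.commute)
  show "0 + x = x" by transfer simp
  show "- x + x = 0" by transfer simp
  show "x - y = x + - y" by transfer simp
  show "r *\<^sub>R (x + y) = r *\<^sub>R x + r *\<^sub>R y" by transfer (simp add: scaleR_add_right)
  show "(r + s) *\<^sub>R x = r *\<^sub>R x + s *\<^sub>R x" by transfer (simp add: scaleR_add_left)
  show "r *\<^sub>R s *\<^sub>R x = (r * s) *\<^sub>R x" by transfer simp
  show "1 *\<^sub>R x = x" by transfer simp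
  show "dist x y = norm (x - y)" by (rule dist_ell2_def)
  show "sgn x = inverse (norm x) *\<^sub>R x" by (rule sgn_ell2_def)
  show "uniformity = (INF e\<in>{0<..}. principal {(x, y :: 'a ell2). dist x y < e})"
    by (rule uniformity_ell2_def)
  show "open U \<longleftrightarrow> (\<forall>x\<in>U. \<forall>\<^sub>F (x', y) in uniformity. x' = x \<longrightarrow> y \<in> U)" for U :: "'a ell2 set"
    by (rule open_ell2_def)
  show "norm x = 0 \<longleftrightarrow> x = 0"
    by transfer (auto simp: suminf_eq_zero_iff fun_eq_iff)
  show "norm (r *\<^sub>R x) = \<bar>r\<bar> * norm x"
    by transfer (simp add: power_mult_distrib suminf_mult real_sqrt_mult)
  show "norm (x + y) \<le> norm x + norm y"
  proof transfer
    fix a b :: "nat \<Rightarrow> 'a"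
    assume "summable (\<lambda>i. (norm (a i))\<^sup>2)" "summable (\<lambda>i. (norm (b i))\<^sup>2)"
    then have "(\<Sum>i. (norm (a i + b i))\<^sup>2)
             \<le> (sqrt (\<Sum>i. (norm (a i))\<^sup>2) + sqrt (\<Sum>i. (norm (b i))\<^sup>2))\<^sup>2"
      by (intro suminf_le_const square_summable_add square_sum_le)
    then show "sqrt (\<Sum>i. (norm (a i + b i))\<^sup>2)
             \<le> sqrt (\<Sum>i. (norm (a i))\<^sup>2) + sqrt (\<Sum>i. (norm (b i))\<^sup>2)"
      by (intro real_le_lsqrt add_nonneg_nonneg)
         (auto intro!: suminf_nonneg square_summable_add
            \<open>summable (\<lambda>i. (norm (a i))\<^sup>2)\<close> \<open>summable (\<lambda>i. (norm (b i))\<^sup>2)\<close>)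
  qed
qed

end

lift_definition ell2_scale :: "'k::real_or_complex \<Rightarrow> 'k ell2 \<Rightarrow> 'k ell2" is "\<lambda>s c i. s * c i"
  by (simp add: norm_mult power_mult_distrib summable_mult)

lift_definition ell2_unit :: "nat \<Rightarrow> 'k::real_or_complex ell2" is "\<lambda>i j. if j = i then 1 else 0"
  subgoal for i by (rule summable_finite[of "{i}"]) auto
  done


section \<open>Frames\<close>

definition frame :: "('h::real_normed_vector \<Rightarrow> 'h \<Rightarrow> 'k::real_or_complex) \<Rightarrow> (nat \<Rightarrow> 'h) \<Rightarrow> bool" where
  "frame ip f \<longleftrightarrow> (\<exists>A>0. \<exists>B>0. \<forall>x.
     summable (\<lambda>i. (norm (ip x (f i)))\<^sup>2) \<and>
     A * (norm x)\<^sup>2 \<le> (\<Sum>i. (norm (ip x (f i)))\<^sup>2) \<and>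
     (\<Sum>i. (norm (ip x (f i)))\<^sup>2) \<le> B * (norm x)\<^sup>2)"

definition computable_frame ::
  "'s::{finite,zero_neq_one} itself \<Rightarrow> ('k::real_or_complex \<Rightarrow> 'h::banach \<Rightarrow> 'h) \<Rightarrow>
   ('h \<Rightarrow> 'h \<Rightarrow> 'k) \<Rightarrow> (nat \<Rightarrow> 'h) \<Rightarrow> (nat \<Rightarrow> 'h) \<Rightarrow> bool" where
  "computable_frame _ smul ip e f \<longleftrightarrow>
     computable (nat_rep :: 's stream \<rightharpoonup> nat) (cauchy_rep (span_numbering smul e)) (Some \<circ> f) \<and>
     frame ip f"

definition synthesis ::
  "('k::real_or_complex \<Rightarrow> 'h::banach \<Rightarrow> 'h) \<Rightarrow> (nat \<Rightarrow> 'h) \<Rightarrow> 'k ell2 \<Rightarrow> 'h" where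
  "synthesis smul f c = (\<Sum>k. smul (coord c k) (f k))"

end

theory Submission
  imports Defs
begin

text \<open>
  \<^bold>\<open>Analysis.\<close> Synthesis and the analysis map \<open>x \<mapsto> (\<langle>x, f\<^sub>k\<rangle>)\<^sub>k\<close> are adjoint to each other, and this duality
  translates the two frame inequalities into properties of synthesis.  If \<open>f\<close> is a frame with
  bounds \<open>A\<close> and \<open>B\<close>, the upper inequality makes synthesis converge and bounds it by \<open>\<surd>B\<close>, while
  the lower one says that the frame operator \<open>S\<close> (analysis followed by synthesis) satisfies
  \<open>\<langle>S x, x\<rangle> \<ge> A \<parallel>x\<parallel>\<^sup>2\<close>; then \<open>x \<mapsto> x - t (S x - y)\<close> is a contraction for small \<open>t > 0\<close>, so that \<open>S\<close>
  and with it synthesis is onto (\<open>frame_surj\<close>).  Conversely, if all series \<open>\<Sum> c\<^sub>k f\<^sub>k\<close> converge, the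
  coefficients \<open>\<langle>x, f\<^sub>k\<rangle>\<close> are square summable by a theorem of Landau, and the uniform boundedness
  principle, applied to the finite parts of analysis, yields the upper inequality.  If moreover
  synthesis is onto, the same principle, applied to the functionals \<open>\<langle>\<cdot>, v\<rangle>\<close> with
  \<open>\<Sum> |\<langle>v, f\<^sub>k\<rangle>|\<^sup>2 \<le> 1\<close>, yields the lower one (\<open>surj_synthesis_frame\<close>).

  \<^bold>\<open>Computability.\<close> Since synthesis maps the \<open>n\<close>-th unit vector to \<open>f\<^sub>n\<close>, a machine for synthesis
  produces a name of \<open>f\<^sub>n\<close> from a name of that unit vector, and a constant name of it can be
  computed from \<open>n\<close> (\<open>computable_synthesis_sequence\<close>).  Conversely, a bounded operator is
  determined with known precision by its values at finite rational combinations of unit vectors,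
  that is, by rational combinations of the \<open>f\<^sub>j\<close>.  In these the \<open>f\<^sub>j\<close> may be replaced by coded
  approximations, taken from the names that the machine for the sequence produces
  (\<open>computable_bounded_operator\<close>).

  \<^bold>\<open>Machines.\<close> Both constructions build a machine that needs the output of another one on inputs
  of its own choice.  They are carried out with register programs, in which a register is a work
  tape with a single mark and its value is the distance of the head from the mark
  (\<open>compile_program\<close>).  Such programs compute all functions in a class \<open>recursive\<close> of number
  functions that is closed under composition, pairing, primitive recursion and unbounded search.
  If a machine writes names of sequences of numbers, and its inputs are recursive in a parameter,
  then the numbers in its output are again recursive in that parameter
  (\<open>recursive_machine_output\<close>).  Conversely, a recursive function gives rise to machines that
  compute the terms of a name one after another, either from a number
  (\<open>recursive_sequence_computable\<close>) or from the terms of the name on the input tape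
  (\<open>recursive_transducer_computable\<close>).  Between these results only recursive functions have to be
  written down: the arithmetic of codes of scalars and vectors.
\<close>

section \<open>Output of a Turing machine\<close>

lemma output_after_0: "output_after M p 0 = []"
  by (simp add: output_after_def initial_def)

lemma output_after_Suc: "\<exists>u. output_after M p (Suc t) = output_after M p t @ u \<and> length u \<le> 1"
proof -
  obtain q i ts w where "(step M p ^^ t) (initial M) = (q, i, ts, w)" by (metis prod_cases4)
  then show ?thesis
    by (auto simp: output_after_def step_def split: prod.split option.split)
qed

lemma output_after_mono: "t \<le> t' \<Longrightarrow> \<exists>u. output_after M p t' = output_after M p t @ u"
proof (induction t' rule: dec_induct)
  case (step n)
  then show ?case using output_after_Suc[of M p n] by (metis append.assoc)
qed simp

text \<open>The length of the output grows by at most one per step, so on the way to a long prefix of \<open>r\<close>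
  every shorter one occurs.\<close>

lemma transformsI:
  assumes "\<And>n. \<exists>t m. n \<le> m \<and> output_after M p t = stake m r"
  shows "transforms M p r"
  unfolding transforms_def
proof
  fix n
  obtain t m where t: "n \<le> m" "output_after M p t = stake m r" using assms by blast
  have "\<exists>i\<le>t. length (output_after M p i) = n"
  proof -
    have "\<bar>int (length (output_after M p (i + 1))) - int (length (output_after M p i))\<bar> \<le> 1" for i
      using output_after_Suc[of M p i] by auto
    then have "\<exists>i\<le>t. int (length (output_after M p i)) = int n"
      by (intro nat0_intermed_int_val) (auto simp: t output_after_0)
    then show ?thesis by simp
  qed
  then obtain i where i: "i \<le> t" "length (output_after M p i) = n" by blast
  then obtain u where "stake m r = output_after M p i @ u" using output_after_mono t(2) by metis
  then have "output_after M p i = take n (stake m r)" using i by simp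
  then show "\<exists>t. output_after M p t = stake n r" using t(1) by (auto simp: take_stake min_def)
qed

text \<open>Some later output is a longer prefix of \<open>r\<close>, and the output at time \<open>t\<close> is a prefix of it.\<close>

lemma transforms_prefix:
  assumes "transforms M p r"
  shows "\<exists>n. output_after M p t = stake n r"
proof -
  obtain t' where t': "output_after M p t' = stake (Suc (length (output_after M p t))) r"
    using assms unfolding transforms_def by blast
  have "t \<le> t'"
  proof (rule ccontr)
    assume "\<not> t \<le> t'"
    then obtain u where "output_after M p t = output_after M p t' @ u"
      using output_after_mono[of t' t] by auto
    then have "length (output_after M p t) = length (output_after M p t') + length u" by simp
    moreover have "length (output_after M p t') = Suc (length (output_after M p t))"
      unfolding t' by simp
    ultimately show False by simp
  qed
  then obtain u where "output_after M p t' = output_after M p t @ u" using output_after_mono by blast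
  then have "output_after M p t = take (length (output_after M p t)) (output_after M p t')" by simp
  then show ?thesis unfolding t' take_stake by blast
qed

section \<open>Register programs\<close>

text \<open>Programs act on registers holding natural numbers.  \<open>Read r\<close> consumes one input symbol and
  increments register \<open>r\<close> unless the symbol is \<open>0\<close>; \<open>Out b\<close> writes the symbol \<open>1\<close> or \<open>0\<close>.  The
  remaining control is a stack of commands still to be executed, because in this form each step
  of a program is one step of a machine, with the stack as its state.\<close>

datatype cmd = Inc nat | Dec nat | Read nat | Out bool | Seq cmd cmd | Loop nat cmd

text \<open>The part of a step that a finite control can determine: from the command stack, the zero tests
  of the registers and the test whether the scanned symbol differs from \<open>0\<close>, it finds the new stack,
  whether to advance on the input, how each register moves, and the output.\<close>

fun control :: "cmd list \<Rightarrow> (nat \<Rightarrow> bool) \<Rightarrow> bool \<Rightarrow> cmd list \<times> bool \<times> (nat \<Rightarrow> move) \<times> bool option" where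
  "control [] z a = ([], False, \<lambda>_. Stay, None)"
| "control (Inc r # K) z a = (K, False, (\<lambda>_. Stay)(r := MoveRight), None)"
| "control (Dec r # K) z a = (K, False, (\<lambda>_. Stay)(r := if z r then Stay else MoveLeft), None)"
| "control (Read r # K) z a = (K, True, (\<lambda>_. Stay)(r := if a then MoveRight else Stay), None)"
| "control (Out b # K) z a = (K, False, \<lambda>_. Stay, Some b)"
| "control (Seq c d # K) z a = (c # d # K, False, \<lambda>_. Stay, None)"
| "control (Loop r c # K) z a = (if z r then K else c # Loop r c # K, False, \<lambda>_. Stay, None)"

fun move_reg :: "move \<Rightarrow> nat \<Rightarrow> nat" where
  "move_reg MoveLeft n = n - 1"
| "move_reg Stay n = n"
| "move_reg MoveRight n = Suc n"

type_synonym 's state = "(nat \<Rightarrow> nat) \<times> nat \<times> 's list"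

definition program_step :: "'s::zero_neq_one stream \<Rightarrow> cmd list \<times> 's state \<Rightarrow> cmd list \<times> 's state" where
  "program_step p = (\<lambda>(K, s, i, w). case control K (\<lambda>r. s r = 0) (p !! i \<noteq> 0) of (K', adv, mv, out) \<Rightarrow>
     (K', \<lambda>r. move_reg (mv r) (s r), if adv then Suc i else i,
      case out of None \<Rightarrow> w | Some b \<Rightarrow> w @ [of_bool b]))"

definition reaches :: "'s::zero_neq_one stream \<Rightarrow> cmd list \<times> 's state \<Rightarrow> cmd list \<times> 's state \<Rightarrow> bool" where
  "reaches p x y \<longleftrightarrow> (\<exists>n. (program_step p ^^ n) x = y)"

lemma reaches_refl: "reaches p x x"
  unfolding reaches_def by (rule exI[of _ 0]) simp

lemma reaches_trans: "reaches p x y \<Longrightarrow> reaches p y z \<Longrightarrow> reaches p x z"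
  unfolding reaches_def by (metis funpow_add comp_apply)

lemma reaches_step: "reaches p (program_step p x) y \<Longrightarrow> reaches p x y"
  unfolding reaches_def by (metis funpow_Suc_right comp_apply)

text \<open>Quantifying over the stack below \<open>c\<close> makes executions compose.\<close>

definition exec :: "'s::zero_neq_one stream \<Rightarrow> cmd \<Rightarrow> 's state \<Rightarrow> 's state \<Rightarrow> bool" where
  "exec p c \<sigma> \<tau> \<longleftrightarrow> (\<forall>K. reaches p (c # K, \<sigma>) (K, \<tau>))"

lemma execD: "exec p c \<sigma> \<tau> \<Longrightarrow> reaches p (c # K, \<sigma>) (K, \<tau>)"
  by (simp add: exec_def)

lemma exec_step1: "(\<And>K. program_step p (c # K, \<sigma>) = (K, \<tau>)) \<Longrightarrow> exec p c \<sigma> \<tau>"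
  unfolding exec_def by (metis reaches_refl reaches_step)

lemma exec_Inc: "exec p (Inc r) (s, i, w) (s(r := Suc (s r)), i, w)"
  by (rule exec_step1) (auto simp: program_step_def)
lemma exec_Dec: "exec p (Dec r) (s, i, w) (s(r := s r - 1), i, w)"
  by (rule exec_step1) (auto simp: program_step_def)
lemma exec_Read:
  "exec p (Read r) (s, i, w) (s(r := s r + (if p !! i = 0 then 0 else 1)), Suc i, w)"
  by (rule exec_step1) (auto simp: program_step_def)
lemma exec_Out: "exec p (Out b) (s, i, w) (s, i, w @ [of_bool b])"
  by (rule exec_step1) (auto simp: program_step_def)

lemma exec_Seq: "exec p c \<sigma> \<tau> \<Longrightarrow> exec p d \<tau> \<upsilon> \<Longrightarrow> exec p (Seq c d) \<sigma> \<upsilon>"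
  unfolding exec_def
proof
  fix K assume a: "\<forall>K. reaches p (c # K, \<sigma>) (K, \<tau>)" "\<forall>K. reaches p (d # K, \<tau>) (K, \<upsilon>)"
  have "program_step p (Seq c d # K, \<sigma>) = (c # d # K, \<sigma>)" by (cases \<sigma>) (auto simp: program_step_def)
  then show "reaches p (Seq c d # K, \<sigma>) (K, \<upsilon>)"
    using a by (metis reaches_step reaches_trans)
qed

lemma reaches_Loop:
  assumes "s r \<noteq> 0" "exec p c (s, i, w) \<tau>"
  shows "reaches p (Loop r c # K, s, i, w) (Loop r c # K, \<tau>)"
proof -
  have "program_step p (Loop r c # K, s, i, w) = (c # Loop r c # K, s, i, w)"
    using assms(1) by (auto simp: program_step_def)
  then show ?thesis using assms(2) by (metis execD reaches_step)
qed

lemma exec_Loop_done: "s r = 0 \<Longrightarrow> exec p (Loop r c) (s, i, w) (s, i, w)"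
  by (rule exec_step1) (auto simp: program_step_def)

lemma exec_Loop_step:
  "s r \<noteq> 0 \<Longrightarrow> exec p c (s, i, w) \<tau> \<Longrightarrow> exec p (Loop r c) \<tau> \<upsilon> \<Longrightarrow> exec p (Loop r c) (s, i, w) \<upsilon>"
  unfolding exec_def[of p "Loop r c"] by (blast intro: reaches_Loop reaches_trans)

section \<open>From register programs to Turing machines\<close>

text \<open>All stacks that can occur while \<open>c\<close> is executed on top of the stack \<open>K\<close>.  There are finitely many,
  and they become the states of the machine.\<close>

fun continuations :: "cmd \<Rightarrow> cmd list \<Rightarrow> cmd list set" where
  "continuations (Seq c d) K = insert (Seq c d # K) (continuations c (d # K) \<union> continuations d K)"
| "continuations (Loop r c) K = insert K (continuations c (Loop r c # K))"
| "continuations c K = {c # K, K}"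

fun regs :: "cmd \<Rightarrow> nat set" where
  "regs (Inc r) = {r}"
| "regs (Dec r) = {r}"
| "regs (Read r) = {r}"
| "regs (Out b) = {}"
| "regs (Seq c d) = regs c \<union> regs d"
| "regs (Loop r c) = insert r (regs c)"

lemma finite_continuations: "finite (continuations c K)"
  by (induction c arbitrary: K) auto

lemma finite_regs: "finite (regs c)"
  by (induction c) auto

lemma continuations_self: "K \<in> continuations c K" "c # K \<in> continuations c K"
  by (induction c arbitrary: K) auto

lemma continuations_closed:
  "X \<in> continuations c K \<Longrightarrow> X = K \<or> fst (control X z a) \<in> continuations c K"
proof (induction c arbitrary: K X)
  case (Seq c d)
  have "fst (control (Seq c d # K) z a) \<in> continuations c (d # K)" by (simp add: continuations_self)
  moreover have "fst (control (d # K) z a) \<in> continuations d K"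
    using Seq.IH(2)[OF continuations_self(2)] by simp
  ultimately show ?case using Seq.IH Seq.prems by auto
next
  case (Loop r c)
  have "fst (control (Loop r c # K) z a) \<in> continuations (Loop r c) K" by (simp add: continuations_self)
  then show ?case using Loop.IH[of X "Loop r c # K"] Loop.prems by auto
qed auto

lemma continuations_regs: "X \<in> continuations c K \<Longrightarrow> (\<Union>(regs ` set X)) \<subseteq> regs c \<union> (\<Union>(regs ` set K))"
proof (induction c arbitrary: K)
  case (Seq c d)
  have "(\<Union>(regs ` set X)) \<subseteq> regs c \<union> (\<Union>(regs ` set (d # K)))" if "X \<in> continuations c (d # K)"
    using Seq.IH(1) that .
  moreover have "(\<Union>(regs ` set X)) \<subseteq> regs d \<union> (\<Union>(regs ` set K))" if "X \<in> continuations d K"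
    using Seq.IH(2) that .
  ultimately show ?case using Seq.prems by auto
next
  case (Loop r c)
  have "(\<Union>(regs ` set X)) \<subseteq> regs c \<union> (\<Union>(regs ` set (Loop r c # K)))" if "X \<in> continuations c (Loop r c # K)"
    using Loop.IH(1) that .
  then show ?case using Loop.prems by auto
qed auto

lemma control_cong:
  "(\<And>r. r \<in> \<Union>(regs ` set X) \<Longrightarrow> z r = z' r) \<Longrightarrow> control X z a = control X z' a"
  by (induction X z a rule: control.induct) auto

text \<open>Each register becomes a work tape that bears a mark in cell \<open>0\<close> and is blank elsewhere; the value of
  the register is the position of the head.  Then a zero test looks at the scanned symbol, and
  counting is moving the head.  The initial state is used once, to write the marks; this is the
  extra step in the number of steps.\<close>

theorem compile_program:
  "\<exists>M :: 's::{finite,zero_neq_one} machine. wf_machine M \<and>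
     (\<forall>p t. output_after M p (Suc t) = snd (snd (snd ((program_step p ^^ t) ([c], \<lambda>_. 0, 0, [])))))"
proof -
  define S where "S = continuations c []"
  have S: "finite S" "[c] \<in> S" unfolding S_def by (auto simp: finite_continuations continuations_self)
  have S_closed: "fst (control X z a) \<in> S" if "X \<in> S" for X z a
    using continuations_closed[of X c "[]" z a] that continuations_self(1)[of "[]" c] unfolding S_def by auto
  obtain k where k: "regs c \<subseteq> {..<k}" using finite_regs[of c] by (metis finite_nat_iff_bounded)
  have S_regs: "\<Union>(regs ` set X) \<subseteq> {..<k}" if "X \<in> S" for X
    using continuations_regs[of X c "[]"] that k unfolding S_def by auto
  obtain h where h: "bij_betw h S {0..<card S}" using ex_bij_betw_finite_nat[OF S(1)] by blast
  define dec where "dec = inv_into S h"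
  have dec: "dec (h X) = X" if "X \<in> S" for X
    using that h by (auto simp: dec_def bij_betw_def)
  have dec_S: "dec n \<in> S" if "n < card S" for n
    using that h by (auto simp: dec_def bij_betw_def inv_into_into)
  have h_less: "h X < card S" if "X \<in> S" for X using h that by (auto simp: bij_betw_def)
  \<comment> \<open>State \<open>0\<close> writes the marks; state \<open>h X + 1\<close> stands for the stack \<open>X\<close>.  Every later step writes
    back the symbols that it has scanned.\<close>
  define tr :: "nat \<Rightarrow> 's \<Rightarrow> nat list \<Rightarrow> nat \<times> bool \<times> (nat \<times> move) list \<times> 's option" where
    "tr q a ws = (if q = 0 then (Suc (h [c]), False, replicate k (1, Stay), None)
       else case control (dec (q - 1)) (\<lambda>r. ws ! r = 1) (a \<noteq> 0) of (X, adv, mv, out) \<Rightarrow>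
         (Suc (h X), adv, map (\<lambda>r. (ws ! r, mv r)) [0..<k], map_option of_bool out))" for q a ws
  define M :: "'s machine" where
    "M = \<lparr>num_states = Suc (card S), num_tapes = k, num_symbols = 2, trans = tr\<rparr>"
  have "wf_machine M"
    unfolding wf_machine_def
  proof (intro conjI allI impI)
    fix q and a :: 's and ws :: "nat list"
    assume *: "q < num_states M \<and> length ws = num_tapes M \<and> set ws \<subseteq> {..<num_symbols M}"
    show "case trans M q a ws of (q', adv, acts, out) \<Rightarrow>
           q' < num_states M \<and> length acts = num_tapes M \<and> fst ` set acts \<subseteq> {..<num_symbols M}"
    proof (cases "q = 0")
      case True
      then show ?thesis using h_less[OF S(2)] by (auto simp: M_def tr_def)
    next
      case False
      then have "q - 1 < card S" using * by (auto simp: M_def)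
      moreover obtain X adv mv out where
        "control (dec (q - 1)) (\<lambda>r. ws ! r = 1) (a \<noteq> 0) = (X, adv, mv, out)" by (metis prod_cases4)
      ultimately show ?thesis
        using False * S_closed[OF dec_S[of "q - 1"], of "\<lambda>r. ws ! r = 1" "a \<noteq> 0"]
        by (auto simp: M_def tr_def h_less subset_iff)
    qed
  qed (auto simp: M_def)
  moreover have "output_after M p (Suc t) = snd (snd (snd ((program_step p ^^ t) ([c], \<lambda>_. 0, 0, []))))"
    for p t
  proof -
    define mark :: "int \<Rightarrow> nat" where "mark = (\<lambda>x. if x = 0 then 1 else 0)"
    define conf :: "cmd list \<times> 's state \<Rightarrow> 's configuration" where
      "conf = (\<lambda>(X, s, i, w). (Suc (h X), i, map (\<lambda>r. (mark, int (s r))) [0..<k], w))"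
    have first: "step M p (initial M) = conf ([c], \<lambda>_. 0, 0, [])"
      by (auto simp: step_def initial_def M_def tr_def conf_def mark_def fun_eq_iff
          intro!: nth_equalityI)
    have next_conf: "step M p (conf y) = conf (program_step p y)" if "fst y \<in> S" for y
    proof -
      obtain X s i w where y: "y = (X, s, i, w)" by (metis prod_cases4)
      obtain X' adv mv out where
        c: "control X (\<lambda>r. s r = 0) (p !! i \<noteq> 0) = (X', adv, mv, out)" by (metis prod_cases4)
      have zero: "(map (\<lambda>(t, h). t h) (map (\<lambda>r. (mark, int (s r))) [0..<k]) ! r = 1) = (s r = 0)"
        if "r < k" for r using that by (auto simp: mark_def)
      have c': "control (dec (Suc (h X) - 1))
          (\<lambda>r. map (\<lambda>(t, h). t h) (map (\<lambda>r. (mark, int (s r))) [0..<k]) ! r = 1) (p !! i \<noteq> 0)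
          = (X', adv, mv, out)"
        unfolding c[symmetric] using that S_regs[of X] y
        by (simp add: dec) (rule control_cong, use zero in force)
      \<comment> \<open>Truncated subtraction and the movement of the head agree because the head never moves
        left from the mark.\<close>
      have mv: "mv r = MoveLeft \<Longrightarrow> s r > 0" for r
        using c by (cases "(X, \<lambda>r. s r = 0, p !! i \<noteq> 0)" rule: control.cases) (auto split: if_splits)
      have "shift_head (mv r) (int (s r)) = int (move_reg (mv r) (s r))" for r
        using mv[of r] by (cases "mv r") auto
      moreover have "mark(int n := mark (int n)) = mark" for n by auto
      ultimately show ?thesis
        using that c' 
        by (auto simp: y step_def M_def tr_def conf_def program_step_def c split: option.split
            intro!: nth_equalityI)
    qed
    have inS: "fst ((program_step p ^^ t) ([c], \<lambda>_. 0, 0, [])) \<in> S" for t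
    proof (induction t)
      case (Suc t)
      obtain X s i w where y: "(program_step p ^^ t) ([c], \<lambda>_. 0, 0, []) = (X, s, i, w)"
        by (metis prod_cases4)
      then show ?case using Suc S_closed[of X "\<lambda>r. s r = 0" "p !! i \<noteq> 0"]
        by (auto simp: program_step_def split: prod.split)
    qed (use S in auto)
    have "(step M p ^^ Suc t) (initial M) = conf ((program_step p ^^ t) ([c], \<lambda>_. 0, 0, []))"
    proof (induction t)
      case 0 then show ?case using first by simp
    next
      case (Suc t)
      then show ?case using next_conf[OF inS[of t]] by simp
    qed
    then show ?thesis unfolding output_after_def by (auto simp: conf_def split: prod.split)
  qed
  ultimately show ?thesis by blast
qed

text \<open>It suffices to reach arbitrarily long prefixes of the intended output.\<close>

corollary program_computable:
  assumes "\<And>p n r. F p = Some r \<Longrightarrow>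
    \<exists>K \<sigma> m. n \<le> m \<and> reaches p ([c], \<lambda>_. 0, 0, []) (K, \<sigma>) \<and> snd (snd \<sigma>) = stake m r"
  shows "tm_computable (F :: 's::{finite,zero_neq_one} stream \<rightharpoonup> 's stream)"
proof -
  obtain M :: "'s machine" where M: "wf_machine M"
    "\<And>p t. output_after M p (Suc t) = snd (snd (snd ((program_step p ^^ t) ([c], \<lambda>_. 0, 0, []))))"
    using compile_program by blast
  have "transforms M p r" if "F p = Some r" for p r
  proof (rule transformsI)
    fix n
    show "\<exists>t m. n \<le> m \<and> output_after M p t = stake m r"
      using assms[OF that, of n] M(2) unfolding reaches_def by (metis snd_conv)
  qed
  then show ?thesis using M(1) unfolding tm_computable_def by blast
qed

section \<open>Programs without input and output\<close>

text \<open>The number functions realised by programs should not depend on an alphabet.  Therefore programs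
  without input and output have a semantics of their own, which mentions no symbols.\<close>

inductive run :: "cmd \<Rightarrow> (nat \<Rightarrow> nat) \<Rightarrow> (nat \<Rightarrow> nat) \<Rightarrow> bool" where
  run_Inc: "run (Inc r) s (s(r := Suc (s r)))"
| run_Dec: "run (Dec r) s (s(r := s r - 1))"
| run_Seq: "run c s t \<Longrightarrow> run d t u \<Longrightarrow> run (Seq c d) s u"
| run_Loop_done: "s r = 0 \<Longrightarrow> run (Loop r c) s s"
| run_Loop_step: "s r \<noteq> 0 \<Longrightarrow> run c s t \<Longrightarrow> run (Loop r c) t u \<Longrightarrow> run (Loop r c) s u"

lemma run_exec: "run c s t \<Longrightarrow> exec p c (s, i, w) (t, i, w)"
proof (induction rule: run.induct)
  case (run_Inc r s) show ?case by (rule exec_Inc)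
next
  case (run_Dec r s) show ?case by (rule exec_Dec)
qed (blast intro: exec_Seq exec_Loop_done exec_Loop_step)+

lemma run_Loop_done': "s r = 0 \<Longrightarrow> t = s \<Longrightarrow> run (Loop r c) s t"
  using run_Loop_done by simp

lemma run_eq: "run c s t \<Longrightarrow> t = t' \<Longrightarrow> run c s t'"
  by simp

abbreviation clear :: "nat \<Rightarrow> cmd" where "clear a \<equiv> Loop a (Dec a)"

abbreviation transfer :: "nat \<Rightarrow> nat \<Rightarrow> cmd" where
  "transfer a b \<equiv> Loop a (Seq (Dec a) (Inc b))"

abbreviation transfer2 :: "nat \<Rightarrow> nat \<Rightarrow> nat \<Rightarrow> cmd" where
  "transfer2 a b c \<equiv> Loop a (Seq (Dec a) (Seq (Inc b) (Inc c)))"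

text \<open>The register \<open>t\<close> is a buffer that is zero before and after.\<close>

abbreviation copy :: "nat \<Rightarrow> nat \<Rightarrow> nat \<Rightarrow> cmd" where
  "copy a b t \<equiv> Seq (transfer2 a b t) (transfer t a)"

lemma run_clear: "run (clear a) s (s(a := 0))"
proof (induction "s a" arbitrary: s)
  case 0 then show ?case by (intro run_Loop_done') auto
next
  case (Suc n)
  have "run (clear a) (s(a := s a - 1)) (s(a := 0))"
    using Suc(1)[of "s(a := s a - 1)"] Suc(2) by simp
  then show ?case by (rule run_Loop_step[OF _ run_Dec, rotated]) (use Suc(2) in auto)
qed

lemma run_transfer: "a \<noteq> b \<Longrightarrow> run (transfer a b) s (s(a := 0, b := s b + s a))"
proof (induction "s a" arbitrary: s)
  case 0 then show ?case by (intro run_Loop_done') (auto simp: fun_eq_iff)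
next
  case (Suc n)
  let ?s = "s(a := n, b := Suc (s b))"
  have "run (Seq (Dec a) (Inc b)) s ?s"
    by (rule run_eq, rule run_Seq[OF run_Dec run_Inc]) (use Suc(2,3) in \<open>auto simp flip: Suc(2)\<close>)
  moreover have "run (transfer a b) ?s (s(a := 0, b := s b + s a))"
    by (rule run_eq, rule Suc(1)) (use Suc(2,3) in \<open>auto simp flip: Suc(2)\<close>)
  ultimately show ?case by (rule run_Loop_step[rotated]) (use Suc(2) in auto)
qed

lemma run_transfer2:
  "distinct [a, b, c] \<Longrightarrow> run (transfer2 a b c) s (s(a := 0, b := s b + s a, c := s c + s a))"
proof (induction "s a" arbitrary: s)
  case 0
  then show ?case by (intro run_Loop_done') (auto simp: fun_eq_iff)
next
  case (Suc n)
  let ?s = "s(a := n, b := Suc (s b), c := Suc (s c))"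
  have "run (Seq (Dec a) (Seq (Inc b) (Inc c))) s ?s"
    by (rule run_eq, rule run_Seq[OF run_Dec run_Seq[OF run_Inc run_Inc]])
      (use Suc(2,3) in \<open>auto simp flip: Suc(2)\<close>)
  moreover have "run (transfer2 a b c) ?s (s(a := 0, b := s b + s a, c := s c + s a))"
    by (rule run_eq, rule Suc(1)) (use Suc(2,3) in \<open>auto simp flip: Suc(2)\<close>)
  ultimately show ?case by (rule run_Loop_step[rotated]) (use Suc(2) in auto)
qed

lemma run_copy:
  assumes "distinct [a, b, t]" "s t = 0"
  shows "run (copy a b t) s (s(b := s b + s a))"
  by (rule run_eq, rule run_Seq[OF run_transfer2 run_transfer]) (use assms in auto)

section \<open>Recursive functions\<close>

text \<open>The calling convention: at base \<open>b\<close> the argument is expected in register \<open>b\<close> and replaced by the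
  value, all registers above \<open>b\<close> are zero before and after, and those below are not touched.  As the
  base is arbitrary, a program can protect intermediate results by calling others at a higher base.\<close>

definition realises :: "(nat \<Rightarrow> cmd) \<Rightarrow> (nat \<Rightarrow> nat) \<Rightarrow> bool" where
  "realises P f \<longleftrightarrow> (\<forall>b s. (\<forall>y>b. s y = 0) \<longrightarrow> run (P b) s (s(b := f (s b))))"

definition recursive :: "(nat \<Rightarrow> nat) \<Rightarrow> bool" where
  "recursive f \<longleftrightarrow> (\<exists>P. realises P f)"

lemma realisesD:
  "realises P f \<Longrightarrow> (\<And>y. y > b \<Longrightarrow> s y = 0) \<Longrightarrow> t = s(b := f (s b)) \<Longrightarrow> run (P b) s t"
  by (simp add: realises_def)

lemma recursiveI: 
  "(\<And>b s. (\<And>y. y > b \<Longrightarrow> s y = 0) \<Longrightarrow> run (P b) s (s(b := f (s b)))) \<Longrightarrow> recursive f"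
  unfolding recursive_def realises_def by blast

abbreviation pair :: "nat \<Rightarrow> nat \<Rightarrow> nat" where "pair m n \<equiv> prod_encode (m, n)"
abbreviation pfst :: "nat \<Rightarrow> nat" where "pfst x \<equiv> fst (prod_decode x)"
abbreviation psnd :: "nat \<Rightarrow> nat" where "psnd x \<equiv> snd (prod_decode x)"

lemma recursive_Suc0: "recursive Suc"
  by (rule recursiveI[of Inc]) (rule run_Inc)

lemma recursive_pred0: "recursive (\<lambda>x. x - 1)"
  by (rule recursiveI[of Dec]) (rule run_Dec)

lemma recursive_zero: "recursive (\<lambda>x. 0)"
  by (rule recursiveI[of clear]) (rule run_clear)

lemma recursive_comp:
  assumes "recursive f" "recursive g"
  shows "recursive (\<lambda>x. f (g x))"
proof -
  obtain F G where F: "realises F f" and G: "realises G g" using assms by (auto simp: recursive_def)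
  show ?thesis
  proof (rule recursiveI[of "\<lambda>b. Seq (G b) (F b)"])
    fix b and s :: "nat \<Rightarrow> nat" assume "\<And>y. y > b \<Longrightarrow> s y = 0"
    then show "run (Seq (G b) (F b)) s (s(b := f (g (s b))))"
      by (intro run_eq[OF run_Seq[OF realisesD[OF G _ refl] realisesD[OF F _ refl]]]) auto
  qed
qed

subsection \<open>Pairs\<close>

text \<open>The pair of \<open>m\<close> and \<open>n\<close> has the code \<open>triangle (m + n) + m\<close>.  The loop adds the
  numbers \<open>n, n - 1, \<dots>, 1\<close> to register \<open>a\<close>.\<close>

lemma run_triangle:
  "distinct [n, a, t] \<Longrightarrow> s t = 0 \<Longrightarrow>
    run (Loop n (Seq (copy n a t) (Dec n))) s (s(n := 0, a := s a + triangle (s n)))"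
proof (induction "s n" arbitrary: s)
  case 0
  then show ?case by (intro run_Loop_done') (auto simp: fun_eq_iff)
next
  case (Suc k)
  let ?s = "s(n := k, a := s a + Suc k)"
  have "run (Seq (copy n a t) (Dec n)) s ?s"
    by (rule run_eq, rule run_Seq[OF run_copy run_Dec])
      (use Suc(2-) in \<open>auto simp flip: Suc(2)\<close>)
  moreover have "run (Loop n (Seq (copy n a t) (Dec n))) ?s (s(n := 0, a := s a + triangle (s n)))"
    by (rule run_eq, rule Suc(1)) (use Suc(2-) in \<open>auto simp flip: Suc(2)\<close>)
  ultimately show ?case by (rule run_Loop_step[rotated]) (use Suc(2) in auto)
qed

lemma run_pair:
  assumes "distinct [m, n, a, t]" "s t = 0" "s a = 0"
  shows "run (Seq (transfer2 m n a) (Loop n (Seq (copy n a t) (Dec n)))) s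
    (s(m := 0, n := 0, a := pair (s m) (s n)))"
  by (rule run_eq, rule run_Seq[OF run_transfer2 run_triangle])
    (use assms in \<open>auto simp: prod_encode_def add.commute\<close>)

lemma recursive_pair:
  assumes "recursive f" "recursive g"
  shows "recursive (\<lambda>x. pair (f x) (g x))"
proof -
  obtain F G where F: "realises F f" and G: "realises G g" using assms by (auto simp: recursive_def)
  show ?thesis
  proof (rule recursiveI[of "\<lambda>b. Seq (Seq (Seq (Seq (Seq (copy b (b+1) (b+2)) (F (b+1)))
     (copy b (b+2) (b+3))) (G (b+2))) (clear b))
     (Seq (transfer2 (b+1) (b+2) b) (Loop (b+2) (Seq (copy (b+2) b (b+3)) (Dec (b+2)))))"])
    fix b and s :: "nat \<Rightarrow> nat" assume s: "\<And>y. y > b \<Longrightarrow> s y = 0"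
    let ?x = "s b"
    have 1: "run (copy b (b+1) (b+2)) s (s(b+1 := ?x))"
      by (rule run_eq, rule run_copy) (use s in auto)
    have 2: "run (F (b+1)) (s(b+1 := ?x)) (s(b+1 := f ?x))"
      by (rule realisesD[OF F]) (use s in auto)
    have 3: "run (copy b (b+2) (b+3)) (s(b+1 := f ?x)) (s(b+1 := f ?x, b+2 := ?x))"
      by (rule run_eq, rule run_copy) (use s in auto)
    have 4: "run (G (b+2)) (s(b+1 := f ?x, b+2 := ?x)) (s(b+1 := f ?x, b+2 := g ?x))"
      by (rule realisesD[OF G]) (use s in auto)
    have 5: "run (clear b) (s(b+1 := f ?x, b+2 := g ?x)) (s(b := 0, b+1 := f ?x, b+2 := g ?x))"
      by (rule run_eq, rule run_clear) auto
    show "run (Seq (Seq (Seq (Seq (Seq (copy b (b+1) (b+2)) (F (b+1)))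
     (copy b (b+2) (b+3))) (G (b+2))) (clear b))
     (Seq (transfer2 (b+1) (b+2) b) (Loop (b+2) (Seq (copy (b+2) b (b+3)) (Dec (b+2))))))
       s (s(b := pair (f ?x) (g ?x)))"
      by (rule run_eq, rule run_Seq[OF run_Seq[OF run_Seq[OF run_Seq[OF run_Seq[OF 1 2] 3] 4] 5]
          run_pair]) (use s in \<open>auto simp: fun_eq_iff\<close>)
  qed
qed

text \<open>The successor of a pair in the enumeration \<open>prod_decode\<close>.  Decoding \<open>x\<close> is taking \<open>x\<close> successors of
  the pair \<open>(0, 0)\<close>.\<close>

definition next_pair :: "nat \<times> nat \<Rightarrow> nat \<times> nat" where
  "next_pair = (\<lambda>(m, n). if n = 0 then (0, Suc m) else (Suc m, n - 1))"

lemma prod_decode_Suc: "prod_decode (Suc x) = next_pair (prod_decode x)"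
proof -
  have "prod_encode (next_pair z) = Suc (prod_encode z)" for z
    by (cases z; cases "snd z") (auto simp: next_pair_def prod_encode_def)
  then show ?thesis by (metis prod_decode_inverse prod_encode_inverse)
qed

text \<open>The flag \<open>t\<close> selects the branch.  The branch for \<open>n \<noteq> 0\<close> parks \<open>n - 1\<close> in register \<open>u\<close>, so that its loop is
  left after one round, and clears the flag.\<close>

definition next_prog :: "nat \<Rightarrow> nat \<Rightarrow> nat \<Rightarrow> nat \<Rightarrow> cmd" where
  "next_prog m n t u = Seq (Seq (Seq (Inc t)
     (Loop n (Seq (Seq (Seq (Dec n) (Inc m)) (Dec t)) (transfer n u))))
     (Loop t (Seq (Seq (Dec t) (transfer m n)) (Inc n)))) (transfer u n)"

lemma run_next_prog:
  assumes d: "distinct [m, n, t, u]" and "s t = 0" "s u = 0"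
  shows "run (next_prog m n t u) s
    (s(m := fst (next_pair (s m, s n)), n := snd (next_pair (s m, s n))))"
proof (cases "s n = 0")
  case True
  let ?s = "s(m := 0, n := Suc (s m))"
  have 1: "run (Inc t) s (s(t := 1))" by (rule run_eq, rule run_Inc) (use assms in auto)
  have 2: "run (Loop n (Seq (Seq (Seq (Dec n) (Inc m)) (Dec t)) (transfer n u))) (s(t := 1)) (s(t := 1))"
    by (rule run_Loop_done) (use assms True in auto)
  have "run (Seq (Seq (Dec t) (transfer m n)) (Inc n)) (s(t := 1)) ?s"
    by (rule run_eq, rule run_Seq[OF run_Seq[OF run_Dec run_transfer] run_Inc])
      (use assms True in \<open>auto simp: fun_eq_iff\<close>)
  then have 3: "run (Loop t (Seq (Seq (Dec t) (transfer m n)) (Inc n))) (s(t := 1)) ?s"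
    by (rule run_Loop_step[rotated]) (use assms in \<open>auto intro!: run_Loop_done\<close>)
  have 4: "run (transfer u n) ?s ?s" by (rule run_Loop_done) (use assms in auto)
  show ?thesis unfolding next_prog_def
    by (rule run_eq, (rule run_Seq)+, rule 1, rule 2, rule 3, rule 4)
      (use assms True in \<open>auto simp: next_pair_def\<close>)
next
  case False
  let ?t = "s(m := Suc (s m), n := 0, u := s n - 1)"
  have 1: "run (Inc t) s (s(t := 1))" by (rule run_eq, rule run_Inc) (use assms in auto)
  have "run (Seq (Seq (Seq (Dec n) (Inc m)) (Dec t)) (transfer n u)) (s(t := 1)) ?t"
    by (rule run_eq, rule run_Seq[OF run_Seq[OF run_Seq[OF run_Dec run_Inc] run_Dec] run_transfer])
      (use assms False in \<open>auto simp: fun_eq_iff\<close>)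
  then have 2: "run (Loop n (Seq (Seq (Seq (Dec n) (Inc m)) (Dec t)) (transfer n u))) (s(t := 1)) ?t"
    by (rule run_Loop_step[rotated]) (use assms False in \<open>auto intro!: run_Loop_done\<close>)
  have 3: "run (Loop t (Seq (Seq (Dec t) (transfer m n)) (Inc n))) ?t ?t"
    by (rule run_Loop_done) (use assms in auto)
  have 4: "run (transfer u n) ?t (s(m := Suc (s m), n := s n - 1))"
    by (rule run_eq, rule run_transfer) (use assms in \<open>auto simp: fun_eq_iff\<close>)
  show ?thesis unfolding next_prog_def
    by (rule run_eq, (rule run_Seq)+, rule 1, rule 2, rule 3, rule 4)
      (use assms False in \<open>auto simp: next_pair_def\<close>)
qed

lemma run_unpair:
  assumes d: "distinct [b, m, n, t, u]"
  shows "(s m, s n) = prod_decode y \<Longrightarrow> s t = 0 \<Longrightarrow> s u = 0 \<Longrightarrow>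
    run (Loop b (Seq (Dec b) (next_prog m n t u))) s
      (s(b := 0, m := pfst (y + s b), n := psnd (y + s b)))"
proof (induction "s b" arbitrary: s y)
  case 0
  then show ?case using d by (intro run_Loop_done') (auto simp: fun_eq_iff simp flip: 0(2))
next
  case (Suc k)
  let ?s = "s(b := k, m := pfst (Suc y), n := psnd (Suc y))"
  have "run (Seq (Dec b) (next_prog m n t u)) s ?s"
    by (rule run_eq, rule run_Seq[OF run_Dec run_next_prog])
      (use Suc(2-) d in \<open>auto simp: prod_decode_Suc fun_eq_iff simp flip: Suc(2)\<close>)
  moreover have "run (Loop b (Seq (Dec b) (next_prog m n t u))) ?s
      (s(b := 0, m := pfst (y + s b), n := psnd (y + s b)))"
    by (rule run_eq, rule Suc(1)[of _ "Suc y"])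
      (use Suc(2-) d in \<open>auto simp: fun_eq_iff simp flip: Suc(2)\<close>)
  ultimately show ?case by (rule run_Loop_step[rotated]) (use Suc(2) in auto)
qed

lemma run_unpair':
  assumes "\<And>y. y > b \<Longrightarrow> s y = 0"
  shows "run (Loop b (Seq (Dec b) (next_prog (b+1) (b+2) (b+3) (b+4)))) s
      (s(b := 0, b+1 := pfst (s b), b+2 := psnd (s b)))"
  by (rule run_eq, rule run_unpair[where y = 0])
    (use assms in \<open>auto simp: prod_decode_def prod_decode_aux.simps\<close>)

lemma recursive_pfst0: "recursive pfst"
proof (rule recursiveI[of "\<lambda>b. Seq (Seq (Loop b (Seq (Dec b) (next_prog (b+1) (b+2) (b+3) (b+4))))
      (clear (b+2))) (transfer (b+1) b)"])
  fix b and s :: "nat \<Rightarrow> nat" assume s: "\<And>y. y > b \<Longrightarrow> s y = 0"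
  show "run (Seq (Seq (Loop b (Seq (Dec b) (next_prog (b+1) (b+2) (b+3) (b+4))))
      (clear (b+2))) (transfer (b+1) b)) s (s(b := pfst (s b)))"
    by (rule run_eq, rule run_Seq[OF run_Seq[OF run_unpair' run_clear] run_transfer])
      (use s in \<open>auto simp: fun_eq_iff\<close>)
qed

lemma recursive_psnd0: "recursive psnd"
proof (rule recursiveI[of "\<lambda>b. Seq (Seq (Loop b (Seq (Dec b) (next_prog (b+1) (b+2) (b+3) (b+4))))
      (clear (b+1))) (transfer (b+2) b)"])
  fix b and s :: "nat \<Rightarrow> nat" assume s: "\<And>y. y > b \<Longrightarrow> s y = 0"
  show "run (Seq (Seq (Loop b (Seq (Dec b) (next_prog (b+1) (b+2) (b+3) (b+4))))
      (clear (b+1))) (transfer (b+2) b)) s (s(b := psnd (s b)))"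
    by (rule run_eq, rule run_Seq[OF run_Seq[OF run_unpair' run_clear] run_transfer])
      (use s in \<open>auto simp: fun_eq_iff\<close>)
qed

subsection \<open>Unbounded iteration\<close>

definition iterate_until :: "(nat \<Rightarrow> nat) \<Rightarrow> (nat \<Rightarrow> nat) \<Rightarrow> nat \<Rightarrow> nat" where
  "iterate_until tst f x = (f ^^ (LEAST n. tst ((f ^^ n) x) = 0)) x"

lemma iterate_until_unfold:
  assumes "tst x \<noteq> 0" "\<exists>n. tst ((f ^^ n) x) = 0"
  shows "iterate_until tst f x = iterate_until tst f (f x)"
proof -
  obtain n where "tst ((f ^^ n) x) = 0" using assms by blast
  then have "(LEAST n. tst ((f ^^ n) x) = 0) = Suc (LEAST n. tst ((f ^^ Suc n) x) = 0)"
    using assms(1) by (intro Least_Suc) auto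
  then show ?thesis unfolding iterate_until_def by (simp add: funpow_Suc_right del: funpow.simps)
qed

lemma iterate_until_stop: "tst x = 0 \<Longrightarrow> iterate_until tst f x = x"
  unfolding iterate_until_def by (subst Least_eq_0) auto

text \<open>Start values come from a function \<open>g\<close>, since the search need not end for other ones: codes of
  impossible configurations of a machine, for instance.\<close>

lemma recursive_iterate_until:
  assumes "recursive tst" "recursive f" "recursive g" and ex: "\<And>x. \<exists>n. tst ((f ^^ n) (g x)) = 0"
  shows "recursive (\<lambda>x. iterate_until tst f (g x))"
proof -
  obtain F T G where F: "realises F f" and T: "realises T tst" and G: "realises G g"
    using assms by (auto simp: recursive_def)
  define test where "test b = Seq (copy b (b+1) (b+2)) (T (b+1))" for b
  define loop where "loop b = Loop (b+1) (Seq (Seq (clear (b+1)) (F b)) (test b))" for b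
  have test: "run (test b) s (s(b+1 := tst (s b)))" if "\<And>y. y > b \<Longrightarrow> s y = (0::nat)" for b s
    unfolding test_def
    by (rule run_Seq[OF run_copy realisesD[OF T]]) (use that in auto)
  have loop: "run (loop b) (s(b+1 := tst (s b))) (s(b := iterate_until tst f (s b)))"
    if "\<And>y. y > b \<Longrightarrow> s y = (0::nat)" "tst ((f ^^ n) (s b)) = 0" for b s n
    using that
  proof (induction n arbitrary: s)
    case 0
    then have "s(b+1 := tst (s b)) = s" "s(b := iterate_until tst f (s b)) = s"
      by (auto simp: iterate_until_stop)
    then show ?case using 0 unfolding loop_def by (auto intro: run_Loop_done)
  next
    case (Suc n)
    show ?case
    proof (cases "tst (s b) = 0")
      case True
      then have "s(b+1 := tst (s b)) = s" "s(b := iterate_until tst f (s b)) = s"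
        using Suc.prems by (auto simp: iterate_until_stop)
      then show ?thesis using True Suc.prems unfolding loop_def by (auto intro: run_Loop_done)
    next
      case False
      let ?s = "s(b := f (s b))"
      have 1: "run (clear (b+1)) (s(b+1 := tst (s b))) s"
        by (rule run_eq, rule run_clear) (use Suc.prems in \<open>auto simp: fun_eq_iff\<close>)
      have 2: "run (F b) s ?s" by (rule realisesD[OF F]) (use Suc.prems in auto)
      have 3: "run (test b) ?s (?s(b+1 := tst (?s b)))" by (rule test) (use Suc.prems in auto)
      have 4: "run (loop b) (?s(b+1 := tst (?s b))) (?s(b := iterate_until tst f (?s b)))"
        by (rule Suc.IH) (use Suc.prems in \<open>auto simp: funpow_Suc_right simp del: funpow.simps\<close>)
      have "iterate_until tst f (s b) = iterate_until tst f (f (s b))"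
        using False Suc.prems(2) by (intro iterate_until_unfold) blast+
      then have "?s(b := iterate_until tst f (?s b)) = s(b := iterate_until tst f (s b))"
        by simp
      moreover have "run (loop b) (s(b+1 := tst (s b))) (?s(b := iterate_until tst f (?s b)))"
        unfolding loop_def
        by (rule run_Loop_step[OF _ run_Seq[OF run_Seq[OF 1 2] 3] 4[unfolded loop_def]])
          (use False in simp)
      ultimately show ?thesis by (simp only:)
    qed
  qed
  show ?thesis
  proof (rule recursiveI[of "\<lambda>b. Seq (G b) (Seq (test b) (loop b))"])
    fix b and s :: "nat \<Rightarrow> nat" assume s: "\<And>y. y > b \<Longrightarrow> s y = 0"
    let ?s = "s(b := g (s b))"
    have "run (Seq (test b) (loop b)) ?s (?s(b := iterate_until tst f (?s b)))"
    proof (rule run_Seq[OF test])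
      obtain n where "tst ((f ^^ n) (g (s b))) = 0" using ex by blast
      then show "run (loop b) (?s(b+1 := tst (?s b))) (?s(b := iterate_until tst f (?s b)))"
        using s by (intro loop[where n = n]) auto
    qed (use s in auto)
    then show "run (Seq (G b) (Seq (test b) (loop b))) s (s(b := iterate_until tst f (g (s b))))"
      using s by (intro run_Seq[OF realisesD[OF G _ refl]]) auto
  qed
qed

subsection \<open>Closure properties\<close>

named_theorems rec_intros

lemma recursive_id [rec_intros]: "recursive (\<lambda>x. x)"
  using recursive_comp[OF recursive_pred0 recursive_Suc0] by simp

lemma recursive_Suc [rec_intros]: "recursive f \<Longrightarrow> recursive (\<lambda>x. Suc (f x))"
  by (rule recursive_comp[OF recursive_Suc0])

lemma recursive_pred: "recursive f \<Longrightarrow> recursive (\<lambda>x. f x - 1)"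
  by (rule recursive_comp[OF recursive_pred0])

lemma recursive_pfst [rec_intros]: "recursive f \<Longrightarrow> recursive (\<lambda>x. pfst (f x))"
  by (rule recursive_comp[OF recursive_pfst0])

lemma recursive_psnd [rec_intros]: "recursive f \<Longrightarrow> recursive (\<lambda>x. psnd (f x))"
  by (rule recursive_comp[OF recursive_psnd0])

lemmas [rec_intros] = recursive_pair

lemma recursive_const [rec_intros]: "recursive (\<lambda>x. c)"
  by (induction c) (auto intro: recursive_zero recursive_Suc)

lemma recursive2:
  assumes "recursive (\<lambda>z. F (pfst z) (psnd z))" "recursive a" "recursive b"
  shows "recursive (\<lambda>x. F (a x) (b x))"
  using recursive_comp[OF assms(1) recursive_pair[OF assms(2,3)]] by simp

text \<open>A loop with a state of four components: the number of rounds left, the argument, the number of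
  rounds done and the intermediate value.\<close>

lemma recursive_rec_nat [rec_intros]:
  assumes "recursive g" and h: "recursive (\<lambda>z. h (pfst z) (pfst (psnd z)) (psnd (psnd z)))"
    and "recursive N"
  shows "recursive (\<lambda>x. rec_nat (g x) (h x) (N x))"
proof -
  define step where "step z = pair (pfst z - 1) (pair (pfst (psnd z)) (pair (Suc (pfst (psnd (psnd z))))
    (h (pfst (psnd z)) (pfst (psnd (psnd z))) (psnd (psnd (psnd z))))))" for z
  define init where "init x = pair (N x) (pair x (pair 0 (g x)))" for x
  have step_n: "pfst ((step ^^ n) z) = pfst z - n" for n z
    by (induction n) (auto simp: step_def)
  have "recursive step" unfolding step_def
    using recursive_comp[OF h recursive_psnd0] by (intro rec_intros recursive_pred) simp
  moreover have "recursive init" unfolding init_def using assms(1,3) by (intro rec_intros)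
  ultimately have "recursive (\<lambda>x. iterate_until pfst step (init x))"
    by (intro recursive_iterate_until recursive_pfst0) (auto simp: step_n intro: exI[of _ "pfst _"])
  then have "recursive (\<lambda>x. psnd (psnd (psnd (iterate_until pfst step (init x)))))"
    by (intro rec_intros)
  moreover have "psnd (psnd (psnd (iterate_until pfst step (init x)))) = rec_nat (g x) (h x) (N x)" for x
  proof -
    have "(step ^^ n) (init x) = pair (N x - n) (pair x (pair n (rec_nat (g x) (h x) n)))" for n
      by (induction n) (auto simp: init_def step_def)
    moreover have "(LEAST n. pfst ((step ^^ n) (init x)) = 0) = N x"
      by (rule Least_equality) (auto simp: step_n init_def)
    ultimately show ?thesis by (simp add: iterate_until_def)
  qed
  ultimately show ?thesis by simp
qed

lemma recursive_add [rec_intros]: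
  assumes "recursive f" "recursive g" shows "recursive (\<lambda>x. f x + g x)"
proof -
  have "m + n = rec_nat m (\<lambda>_ a. Suc a) n" for m n by (induction n) auto
  then show ?thesis using assms by (simp only:) (intro rec_intros)
qed

lemma recursive_diff [rec_intros]:
  assumes "recursive f" "recursive g" shows "recursive (\<lambda>x. f x - g x)"
proof -
  have "m - n = rec_nat m (\<lambda>_ a. a - 1) n" for m n by (induction n) auto
  \<comment> \<open>The equation is used for this instance only, since its right-hand side contains a
    subtraction again.\<close>
  then have "(\<lambda>x. f x - g x) = (\<lambda>x. rec_nat (f x) (\<lambda>_ a. a - 1) (g x))" by blast
  then show ?thesis using assms by (simp only:) (intro rec_intros recursive_pred)
qed

lemma recursive_mult [rec_intros]:
  assumes "recursive f" "recursive g" shows "recursive (\<lambda>x. f x * g x)"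
proof -
  have "m * n = rec_nat 0 (\<lambda>_ a. a + m) n" for m n by (induction n) auto
  then show ?thesis using assms by (simp only:) (intro rec_intros recursive_comp[OF assms(1)])
qed

lemma recursive_of_bool_eq [rec_intros]:
  assumes "recursive f" "recursive g" shows "recursive (\<lambda>x. of_bool (f x = g x))"
proof -
  have "of_bool (m = n) = 1 - ((m - n) + (n - m))" for m n :: nat by auto
  then show ?thesis using assms by (simp only:) (intro rec_intros)
qed

lemma recursive_of_bool_less [rec_intros]:
  assumes "recursive f" "recursive g" shows "recursive (\<lambda>x. of_bool (f x < g x))"
proof -
  have "of_bool (m < n) = 1 - (1 - (n - m))" for m n :: nat by auto
  then show ?thesis using assms by (simp only:) (intro rec_intros)
qed

lemma recursive_if [rec_intros]:
  assumes "recursive (\<lambda>x. of_bool (P x))" "recursive f" "recursive g"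
  shows "recursive (\<lambda>x. if P x then f x else g x)"
proof -
  have "(if b then m else n) = of_bool b * m + (1 - of_bool b) * n" for b and m n :: nat by auto
  then show ?thesis using assms by (simp only:) (intro rec_intros)
qed

text \<open>For the transition functions of machines, which are finite tables.\<close>

lemma recursive_finite:
  assumes "finite A" shows "recursive (\<lambda>x. if x \<in> A then f x else d)"
  using assms
proof (induction A rule: finite_induct)
  case empty
  then show ?case by (simp add: recursive_const)
next
  case (insert y A)
  have "(\<lambda>x. if x \<in> insert y A then f x else d) = (\<lambda>x. if x = y then f y else if x \<in> A then f x else d)"
    by auto
  then show ?case
    by (simp only:) (rule recursive_if[OF recursive_of_bool_eq recursive_const insert.IH];
        intro rec_intros)
qed

section \<open>Streams of blocks\<close>

definition block :: "nat \<Rightarrow> 's::zero_neq_one list" where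
  "block n = 0 # replicate (Suc n) 1"

definition blocks :: "nat \<Rightarrow> nat stream \<Rightarrow> 's::zero_neq_one list" where
  "blocks k ns = concat (map block (stake k ns))"

lemma blocks_0 [simp]: "blocks 0 ns = []" by (simp add: blocks_def)

lemma blocks_Suc: "blocks (Suc k) ns = blocks k ns @ block (ns !! k)"
  unfolding blocks_def stake_Suc by simp

lemma encode_seq_blocks: "encode_seq ns = blocks k ns @- encode_seq (sdrop k ns)"
proof (induction k)
  case (Suc k)
  have "encode_seq (sdrop k ns) = block (ns !! k) @- encode_seq (sdrop (Suc k) ns)"
    by (subst encode_seq_unfold) (simp add: block_def)
  then show ?case using Suc by (simp add: blocks_Suc)
qed simp

lemma stake_encode_seq:
  "stake (length (blocks k ns :: 's::zero_neq_one list)) (encode_seq ns :: 's stream) = blocks k ns"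
  by (subst encode_seq_blocks[of ns k]) (simp add: stake_shift)

lemma length_blocks: "k \<le> length (blocks k ns)"
  by (induction k) (auto simp: blocks_Suc block_def)

text \<open>The last admissible position, \<open>j = ns !! k + 1\<close>, holds the final \<open>1\<close> of block \<open>k\<close>.\<close>

lemma encode_seq_snth:
  assumes "j \<le> Suc (ns !! k)"
  shows "(encode_seq ns :: 's::zero_neq_one stream) !! (length (blocks k ns :: 's list) + j) = (if j = 0 then 0 else 1)"
proof -
  have "(xs @- t) !! (length xs + j) = t !! j" for xs and t :: "'s stream"
    by (simp add: shift_snth)
  then have "(encode_seq ns :: 's stream) !! (length (blocks k ns :: 's list) + j)
      = (encode_seq (sdrop k ns) :: 's stream) !! j"
    by (subst encode_seq_blocks[of ns k])
  also have "\<dots> = (if j = 0 then 0 else 1)"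
    using assms by (subst encode_seq_unfold) (cases j, auto simp del: replicate.simps)
  finally show ?thesis .
qed

section \<open>Programs that produce streams of blocks\<close>

definition write_block :: "nat \<Rightarrow> cmd" where
  "write_block a = Seq (Seq (Out False) (Out True)) (Loop a (Seq (Dec a) (Out True)))"

lemma exec_write_block: 
  "exec p (write_block a) (s, i, w) (s(a := 0), i, w @ block (s a))"
proof -
  have loop: "exec p (Loop a (Seq (Dec a) (Out True))) (s, i, w) (s(a := 0), i, w @ replicate (s a) 1)"
    for s w
  proof (induction "s a" arbitrary: s w)
    case 0
    then have "s(a := 0) = s" by auto
    then show ?case using exec_Loop_done[of s a] 0 by (metis append_Nil2 replicate_0)
  next
    case (Suc k)
    have 1: "exec p (Seq (Dec a) (Out True)) (s, i, w) (s(a := s a - 1), i, w @ [of_bool True])"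
      by (rule exec_Seq[OF exec_Dec exec_Out])
    have 2: "exec p (Loop a (Seq (Dec a) (Out True))) (s(a := s a - 1), i, w @ [of_bool True])
       ((s(a := s a - 1))(a := 0), i, (w @ [of_bool True]) @ replicate ((s(a := s a - 1)) a) 1)"
      by (rule Suc(1)) (simp flip: Suc(2))
    have 3: "((s(a := s a - 1))(a := 0), i, (w @ [of_bool True]) @ replicate ((s(a := s a - 1)) a) 1)
      = (s(a := 0), i, w @ replicate (s a) 1)"
      by (simp flip: Suc(2))
    show ?case using exec_Loop_step[OF _ 1 2] Suc(2) unfolding 3 by simp
  qed
  have "exec p (write_block a) (s, i, w)
    (s(a := 0), i, ((w @ [of_bool False]) @ [of_bool True]) @ replicate (s a) 1)"
    unfolding write_block_def by (rule exec_Seq[OF exec_Seq[OF exec_Out exec_Out] loop])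
  then show ?thesis by (simp add: block_def)
qed

text \<open>The end of a run of ones is noticed only when the following \<open>0\<close> has been consumed.  Hence reading
  starts just behind the \<open>0\<close> that opens a block and ends just behind the \<open>0\<close> that opens the next one.\<close>

definition read_block :: "nat \<Rightarrow> nat \<Rightarrow> cmd" where
  "read_block v t = Seq (Read t) (Loop t (Seq (Seq (Dec t) (Inc v)) (Read t)))"

lemma exec_read_block:
  assumes "v \<noteq> t" "s t = 0" "\<And>j. j < n \<Longrightarrow> p !! (i + j) \<noteq> 0" "p !! (i + n) = 0"
  shows "exec p (read_block v t) (s, i, w) (s(v := s v + n), Suc (i + n), w)"
proof -
  have loop: "exec p (Loop t (Seq (Seq (Dec t) (Inc v)) (Read t)))
       (s(t := if n = 0 then 0 else 1), Suc i, w) (s(v := s v + n), Suc (i + n), w)"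
    if "s t = 0" "\<And>j. j < n \<Longrightarrow> p !! (i + j) \<noteq> 0" "p !! (i + n) = 0" for s i n
    using that
  proof (induction n arbitrary: s i)
    case 0
    then have "s(t := 0) = s" by auto
    then show ?case using 0 by (simp add: exec_Loop_done)
  next
    case (Suc n)
    let ?s = "s(v := Suc (s v))" and ?b = "if n = 0 then 0 else 1 :: nat"
    have b: "(if p !! Suc i = 0 then 0 else 1) = ?b"
      using Suc.prems(2)[of 1] Suc.prems(3) by (cases n) auto
    have 1: "exec p (Seq (Seq (Dec t) (Inc v)) (Read t)) (s(t := 1), Suc i, w) (?s(t := ?b), Suc (Suc i), w)"
    proof -
      have "(s(t := 1, t := (s(t := 1)) t - 1)) = s" using Suc.prems by auto
      then have "exec p (Dec t) (s(t := 1), Suc i, w) (s, Suc i, w)"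
        using exec_Dec[of p t "s(t := 1)"] by simp
      moreover have "exec p (Inc v) (s, Suc i, w) (?s, Suc i, w)" by (rule exec_Inc)
      moreover have "exec p (Read t) (?s, Suc i, w) (?s(t := ?b), Suc (Suc i), w)"
        using exec_Read[of p t ?s "Suc i" w] Suc.prems(1) assms(1) by (simp only: b) simp
      ultimately show ?thesis by (blast intro: exec_Seq)
    qed
    have 2: "exec p (Loop t (Seq (Seq (Dec t) (Inc v)) (Read t)))
       (?s(t := ?b), Suc (Suc i), w) (?s(v := ?s v + n), Suc (Suc i + n), w)"
      using Suc.prems(1,3) Suc.prems(2)[of "Suc _"] assms(1) by (intro Suc.IH) auto
    have 3: "exec p (Loop t (Seq (Seq (Dec t) (Inc v)) (Read t))) (s(t := 1), Suc i, w)
       (?s(v := ?s v + n), Suc (Suc i + n), w)"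
      by (rule exec_Loop_step[OF _ 1 2]) simp
    have 4: "?s(v := ?s v + n) = s(v := s v + Suc n)" "Suc (Suc i + n) = Suc (i + Suc n)"
      "(if Suc n = 0 then 0 else 1) = (1::nat)" by auto
    show ?case using 3 by (simp only: 4)
  qed
  have "(if p !! i = 0 then 0 else 1) = (if n = 0 then 0 else 1 :: nat)"
    using assms(3)[of 0] assms(4) by (cases n) auto
  then have "exec p (Read t) (s, i, w) (s(t := if n = 0 then 0 else 1), Suc i, w)"
    using exec_Read[of p t s i w] assms(2) by simp
  then show ?thesis unfolding read_block_def using loop[of s n i] assms by (blast intro: exec_Seq)
qed

text \<open>Register \<open>0\<close> is reserved for the flag that keeps the main loop running; register \<open>1\<close> counts
  the blocks written, and register \<open>2\<close> holds the current argument.\<close>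

lemma exec_emit:
  assumes "recursive (\<lambda>z. G (pfst z) (psnd z))"
  shows "\<exists>E. \<forall>(p :: 's::zero_neq_one stream) s i w. (\<forall>y\<ge>3. s y = 0) \<longrightarrow>
    exec p E (s, i, w) (s(1 := Suc (s 1)), i, w @ block (G (s 1) (s 2)))"
proof -
  obtain P where P: "realises P (\<lambda>z. G (pfst z) (psnd z))"
    using assms by (auto simp: recursive_def)
  define C where "C = Seq (Seq (Seq (copy 1 3 5) (copy 2 4 5))
     (Seq (transfer2 3 4 5) (Loop 4 (Seq (copy 4 5 6) (Dec 4))))) (P 5)"
  have C: "run C s (s(5 := G (s 1) (s 2)))" if s: "\<forall>y\<ge>3. s y = 0" for s
  proof -
    have 1: "run (copy 1 3 5) s (s(3 := s 1))"
      by (rule run_eq, rule run_copy) (use s in auto)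
    have 2: "run (copy 2 4 5) (s(3 := s 1)) (s(3 := s 1, 4 := s 2))"
      by (rule run_eq, rule run_copy) (use s in auto)
    have 3: "run (Seq (transfer2 3 4 5) (Loop 4 (Seq (copy 4 5 6) (Dec 4))))
       (s(3 := s 1, 4 := s 2)) (s(5 := pair (s 1) (s 2)))"
      by (rule run_eq, rule run_pair) (use s in \<open>auto simp: fun_eq_iff\<close>)
    have 4: "run (P 5) (s(5 := pair (s 1) (s 2))) (s(5 := G (s 1) (s 2)))"
      by (rule realisesD[OF P]) (use s in auto)
    show ?thesis unfolding C_def by (rule run_Seq[OF run_Seq[OF run_Seq[OF 1 2] 3] 4])
  qed
  show ?thesis
  proof (intro exI[of _ "Seq (Seq C (write_block 5)) (Inc 1)"] allI impI)
    fix p :: "'s stream" and s :: "nat \<Rightarrow> nat" and i w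
    assume s: "\<forall>y\<ge>3. s y = 0"
    have 1: "exec p C (s, i, w) (s(5 := G (s 1) (s 2)), i, w)" by (intro run_exec C s)
    have "(s(5 := G (s 1) (s 2)))(5 := 0) = s" using s by auto
    then have 2: "exec p (write_block 5) (s(5 := G (s 1) (s 2)), i, w) (s, i, w @ block (G (s 1) (s 2)))"
      using exec_write_block[of p 5 "s(5 := G (s 1) (s 2))" i w] by simp
    show "exec p (Seq (Seq C (write_block 5)) (Inc 1)) (s, i, w)
       (s(1 := Suc (s 1)), i, w @ block (G (s 1) (s 2)))"
      by (rule exec_Seq[OF exec_Seq[OF 1 2] exec_Inc])
  qed
qed

text \<open>A program that runs forever is described by the states after each round of its main loop.\<close>

lemma loop_computable:
  assumes "\<And>p r. F p = Some r \<Longrightarrow> \<exists>\<sigma> ms. r = encode_seq ms \<and>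
     exec p init (\<lambda>_. 0, 0, []) (\<sigma> 0) \<and>
     (\<forall>k. fst (\<sigma> k) 0 \<noteq> 0 \<and> exec p body (\<sigma> k) (\<sigma> (Suc k)) \<and> snd (snd (\<sigma> k)) = blocks k ms)"
  shows "tm_computable (F :: 's::{finite,zero_neq_one} stream \<rightharpoonup> 's stream)"
proof (rule program_computable[where c = "Seq init (Loop 0 body)"])
  fix p r n assume "F p = Some r"
  then obtain \<sigma> ms where r: "r = encode_seq ms" and init: "exec p init (\<lambda>_. 0, 0, []) (\<sigma> 0)"
    and nz: "\<And>k. fst (\<sigma> k) 0 \<noteq> 0" and body: "\<And>k. exec p body (\<sigma> k) (\<sigma> (Suc k))"
    and out: "\<And>k. snd (snd (\<sigma> k)) = blocks k ms"
    using assms by metis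
  have "program_step p ([Seq init (Loop 0 body)], \<lambda>_. 0, 0, []) = ([init, Loop 0 body], \<lambda>_. 0, 0, [])"
    by (simp add: program_step_def)
  then have start: "reaches p ([Seq init (Loop 0 body)], \<lambda>_. 0, 0, []) ([Loop 0 body], \<sigma> 0)"
    using execD[OF init, of "[Loop 0 body]"] by (metis reaches_step)
  have "reaches p ([Loop 0 body], \<sigma> 0) ([Loop 0 body], \<sigma> k)" for k
  proof (induction k)
    case (Suc k)
    obtain s i w where "\<sigma> k = (s, i, w)" by (metis prod_cases3)
    then show ?case using reaches_Loop[of s 0 p body i w "\<sigma> (Suc k)" "[]"] nz[of k] body[of k] Suc
      by (auto intro: reaches_trans)
  qed (rule reaches_refl)
  then have "reaches p ([Seq init (Loop 0 body)], \<lambda>_. 0, 0, []) ([Loop 0 body], \<sigma> n)"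
    using start reaches_trans by blast
  moreover have "snd (snd (\<sigma> n)) = stake (length (blocks n ms :: 's list)) r"
    unfolding out r stake_encode_seq ..
  ultimately show "\<exists>K \<sigma> m. n \<le> m \<and>
      reaches p ([Seq init (Loop 0 body)], \<lambda>_. 0, 0, []) (K, \<sigma>) \<and> snd (snd \<sigma>) = stake m r"
    using length_blocks by blast
qed

text \<open>In \<open>1\<^sup>n0\<^sup>\<omega>\<close> the first \<open>0\<close> ends a run of ones, so the program that reads blocks also reads names of
  numbers.\<close>

theorem recursive_sequence_computable:
  assumes "recursive (\<lambda>z. G (pfst z) (psnd z))"
    and F: "\<And>p r. F p = Some r \<Longrightarrow> \<exists>n. nat_name p n \<and> r = encode_seq (smap (\<lambda>i. G i n) nats)"
  shows "tm_computable (F :: 's::{finite,zero_neq_one} stream \<rightharpoonup> 's stream)"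
proof -
  obtain E where E: "\<And>(p :: 's stream) s i w. (\<forall>y\<ge>3. s y = 0) \<Longrightarrow>
    exec p E (s, i, w) (s(1 := Suc (s 1)), i, w @ block (G (s 1) (s 2)))"
    using exec_emit[OF assms(1), where 's = 's] by blast
  show ?thesis
  proof (rule loop_computable[where init = "Seq (read_block 2 3) (Inc 0)" and body = E])
    fix p r assume "F p = Some r"
    then obtain n where n: "nat_name p n" and r: "r = encode_seq (smap (\<lambda>i. G i n) nats)"
      using F by blast
    let ?ms = "smap (\<lambda>i. G i n) nats"
    define \<sigma> :: "nat \<Rightarrow> 's state" where
      "\<sigma> k = ((\<lambda>_. 0)(0 := 1, 1 := k, 2 := n), Suc n, blocks k ?ms)" for k
    have "exec p (read_block 2 3) (\<lambda>_. 0, 0, []) ((\<lambda>_. 0)(2 := 0 + n), Suc (0 + n), [])"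
      by (rule exec_read_block) (use n in \<open>auto simp: nat_name_def\<close>)
    moreover have "\<sigma> 0 = (((\<lambda>_. 0)(2 := n))(0 := Suc 0), Suc n, [])"
      by (auto simp: \<sigma>_def fun_eq_iff)
    then have "exec p (Inc 0) ((\<lambda>_. 0)(2 := 0 + n), Suc (0 + n), []) (\<sigma> 0)"
      using exec_Inc[of p 0 "(\<lambda>_. 0)(2 := n)" "Suc n" "[]"] by simp
    ultimately have "exec p (Seq (read_block 2 3) (Inc 0)) (\<lambda>_. 0, 0, []) (\<sigma> 0)"
      by (rule exec_Seq)
    moreover have "exec p E (\<sigma> k) (\<sigma> (Suc k))" for k
    proof -
      let ?s = "(\<lambda>_. 0)(0 := 1, 1 := k, 2 := n) :: nat \<Rightarrow> nat"
      have "\<sigma> (Suc k) = (?s(1 := Suc (?s 1)), Suc n, blocks k ?ms @ block (G (?s 1) (?s 2)))"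
        by (auto simp: \<sigma>_def blocks_Suc)
      then show ?thesis unfolding \<sigma>_def[of k] by (simp only:) (rule E, simp)
    qed
    ultimately show "\<exists>\<sigma> ms. r = encode_seq ms \<and>
     exec p (Seq (read_block 2 3) (Inc 0)) (\<lambda>_. 0, 0, []) (\<sigma> 0) \<and>
     (\<forall>k. fst (\<sigma> k) 0 \<noteq> 0 \<and> exec p E (\<sigma> k) (\<sigma> (Suc k)) \<and> snd (snd (\<sigma> k)) = blocks k ms)"
      by (intro exI[of _ \<sigma>] exI[of _ ?ms]) (auto simp: r \<sigma>_def)
  qed
qed

fun skip_blocks :: "nat \<Rightarrow> cmd" where
  "skip_blocks 0 = Read 2"
| "skip_blocks (Suc c) = Seq (skip_blocks c) (Seq (read_block 2 3) (clear 2))"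

text \<open>Skipping the first \<open>c\<close> blocks of a Cauchy name gives access to better approximations, as is needed
  for operators with a large norm.\<close>

theorem recursive_transducer_computable:
  assumes "recursive (\<lambda>z. G (pfst z) (psnd z))"
    and F: "\<And>p r. F p = Some r \<Longrightarrow>
      \<exists>ns. p = encode_seq ns \<and> r = encode_seq (smap (\<lambda>i. G i (ns !! (c + i))) nats)"
  shows "tm_computable (F :: 's::{finite,zero_neq_one} stream \<rightharpoonup> 's stream)"
proof -
  obtain E where E: "\<And>(p :: 's stream) s i w. (\<forall>y\<ge>3. s y = 0) \<Longrightarrow>
    exec p E (s, i, w) (s(1 := Suc (s 1)), i, w @ block (G (s 1) (s 2)))"
    using exec_emit[OF assms(1), where 's = 's] by blast
  define body where "body = Seq (Seq (Seq (read_block 2 3) (Dec 2)) E) (clear 2)"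
  show ?thesis
  proof (rule loop_computable[where init = "Seq (skip_blocks c) (Inc 0)" and body = body])
    fix p r assume "F p = Some r"
    then obtain ns where p: "p = encode_seq ns"
      and r: "r = encode_seq (smap (\<lambda>i. G i (ns !! (c + i))) nats)"
      using F by blast
    let ?ms = "smap (\<lambda>i. G i (ns !! (c + i))) nats"
    define pos where "pos k = Suc (length (blocks k ns :: 's list))" for k
    have pos_Suc: "pos (Suc k) = Suc (pos k + Suc (ns !! k))" for k
      by (simp add: pos_def blocks_Suc block_def)
    have read: "exec p (read_block 2 3) (s, pos k, w) (s(2 := s 2 + Suc (ns !! k)), pos (Suc k), w)"
      if "s 3 = 0" for s k w
      unfolding pos_Suc
    proof (rule exec_read_block)
      fix j assume "j < Suc (ns !! k)"
      then show "p !! (pos k + j) \<noteq> 0"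
        using encode_seq_snth[of "Suc j" ns k, where 's = 's] by (simp add: pos_def p)
    next
      show "p !! (pos k + Suc (ns !! k)) = 0"
        using encode_seq_snth[of 0 ns "Suc k", where 's = 's]
        by (simp add: pos_def p blocks_Suc block_def)
    qed (use that in auto)
    have skip: "exec p (skip_blocks c) (\<lambda>_. 0, 0, []) (\<lambda>_. 0, pos c, [])" for c
    proof (induction c)
      case 0
      have "p !! 0 = 0" using encode_seq_snth[of 0 ns 0, where 's = 's] by (simp add: p)
      then show ?case using exec_Read[of p 2 "\<lambda>_. 0" 0 "[]"] by (simp add: pos_def fun_upd_idem)
    next
      case (Suc c)
      let ?s = "(\<lambda>_. 0)(2 := 0 + Suc (ns !! c))"
      have "exec p (read_block 2 3) (\<lambda>_. 0, pos c, []) (?s, pos (Suc c), [])"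
        by (rule read) simp
      moreover have "exec p (clear 2) (?s, pos (Suc c), []) (\<lambda>_. 0, pos (Suc c), [])"
        using run_exec[OF run_clear, of p 2 ?s "pos (Suc c)" "[]"] by (simp add: fun_upd_idem)
      ultimately show ?case using Suc by (auto intro: exec_Seq)
    qed
    define \<sigma> :: "nat \<Rightarrow> 's state" where
      "\<sigma> k = ((\<lambda>_. 0)(0 := 1, 1 := k), pos (c + k), blocks k ?ms)" for k
    have "\<sigma> 0 = ((\<lambda>_. 0)(0 := Suc 0), pos c, [])" by (auto simp: \<sigma>_def)
    then have "exec p (Inc 0) (\<lambda>_. 0, pos c, []) (\<sigma> 0)"
      using exec_Inc[of p 0 "\<lambda>_. 0" "pos c" "[]"] by simp
    then have "exec p (Seq (skip_blocks c) (Inc 0)) (\<lambda>_. 0, 0, []) (\<sigma> 0)"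
      by (rule exec_Seq[OF skip])
    moreover have "exec p body (\<sigma> k) (\<sigma> (Suc k))" for k
    proof -
      let ?n = "ns !! (c + k)"
      define s :: "nat \<Rightarrow> nat" where "s = (\<lambda>_. 0)(0 := 1, 1 := k)"
      have s: "s 1 = k" "s 2 = 0" "\<And>y. y \<ge> 3 \<Longrightarrow> s y = 0" by (auto simp: s_def)
      have 1: "exec p (read_block 2 3) (s, pos (c + k), blocks k ?ms)
          (s(2 := Suc ?n), pos (c + Suc k), blocks k ?ms)"
        using read[of s "c + k"] s by simp
      have 2: "exec p (Dec 2) (s(2 := Suc ?n), pos (c + Suc k), blocks k ?ms)
          (s(2 := ?n), pos (c + Suc k), blocks k ?ms)"
        using exec_Dec[of p 2 "s(2 := Suc ?n)"] by simp
      have 3: "exec p E (s(2 := ?n), pos (c + Suc k), blocks k ?ms)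
          (s(2 := ?n, 1 := Suc k), pos (c + Suc k), blocks (Suc k) ?ms)"
        using E[of "s(2 := ?n)" p "pos (c + Suc k)" "blocks k ?ms"] s by (simp add: blocks_Suc)
      have "(s(2 := ?n, 1 := Suc k))(2 := 0) = (\<lambda>_. 0)(0 := 1, 1 := Suc k)"
        by (auto simp: s_def)
      then have 4: "exec p (clear 2) (s(2 := ?n, 1 := Suc k), pos (c + Suc k), blocks (Suc k) ?ms) (\<sigma> (Suc k))"
        using run_exec[OF run_clear, of p 2 "s(2 := ?n, 1 := Suc k)"] by (simp only: \<sigma>_def)
      show ?thesis unfolding body_def \<sigma>_def[of k] s_def[symmetric]
        by (rule exec_Seq[OF exec_Seq[OF exec_Seq[OF 1 2] 3] 4])
    qed
    ultimately show "\<exists>\<sigma> ms. r = encode_seq ms \<and>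
     exec p (Seq (skip_blocks c) (Inc 0)) (\<lambda>_. 0, 0, []) (\<sigma> 0) \<and>
     (\<forall>k. fst (\<sigma> k) 0 \<noteq> 0 \<and> exec p body (\<sigma> k) (\<sigma> (Suc k)) \<and> snd (snd (\<sigma> k)) = blocks k ms)"
      by (intro exI[of _ \<sigma>] exI[of _ ?ms]) (auto simp: r \<sigma>_def)
  qed
qed

section \<open>Simulating a Turing machine by a recursive function\<close>

subsection \<open>Coding configurations\<close>

fun list_code :: "nat list \<Rightarrow> nat" where
  "list_code [] = 0"
| "list_code (x # xs) = pair x (list_code xs)"

lemma list_code_inject: "length xs = length ys \<Longrightarrow> list_code xs = list_code ys \<longleftrightarrow> xs = ys"
  by (induction xs ys rule: list_induct2) auto

lemma pair_0_0 [simp]: "pair 0 0 = 0"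
  by (simp add: prod_encode_def)

lemma prod_decode_0 [simp]: "prod_decode 0 = (0, 0)"
  by (metis pair_0_0 prod_encode_inverse)

definition stack_nth :: "nat \<Rightarrow> nat \<Rightarrow> nat" where
  "stack_nth x n = pfst ((psnd ^^ n) x)"

lemma stack_nth_pair [simp]: "stack_nth (pair a x) n = (case n of 0 \<Rightarrow> a | Suc m \<Rightarrow> stack_nth x m)"
  by (cases n) (auto simp: stack_nth_def funpow_Suc_right simp del: funpow.simps(2))

lemma stack_nth_psnd: "stack_nth (psnd x) n = stack_nth x (Suc n)"
  by (simp add: stack_nth_def funpow_Suc_right del: funpow.simps(2))

lemma stack_nth_pfst: "pfst x = stack_nth x 0"
  by (simp add: stack_nth_def)

lemma stack_nth_0: "stack_nth 0 n = 0"
proof -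
  have "(psnd ^^ n) 0 = 0" by (induction n) auto
  then show ?thesis by (simp add: stack_nth_def)
qed

text \<open>A tape is coded by two stacks of symbols, the one to the left of the head and the one that starts
  at the head.  Since \<open>0\<close> is the code of the pair of \<open>0\<close> and \<open>0\<close>, it is also the code of an
  infinite stack of blanks, and stacks never underflow.\<close>

definition tape_rep :: "nat \<Rightarrow> (int \<Rightarrow> nat) \<times> int \<Rightarrow> bool" where
  "tape_rep T = (\<lambda>(t, h). \<forall>n. stack_nth (pfst T) n = t (h - 1 - int n) \<and> stack_nth (psnd T) n = t (h + int n))"

fun move_code :: "move \<Rightarrow> nat" where
  "move_code MoveLeft = 0" | "move_code Stay = 1" | "move_code MoveRight = 2"

definition act_code :: "nat \<times> move \<Rightarrow> nat" where
  "act_code = (\<lambda>(b, m). pair b (move_code m))"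

definition tape_upd :: "nat \<Rightarrow> nat \<Rightarrow> nat" where
  "tape_upd A T = (if psnd A = 0
     then pair (psnd (pfst T)) (pair (pfst (pfst T)) (pair (pfst A) (psnd (psnd T))))
     else if psnd A = 1 then pair (pfst T) (pair (pfst A) (psnd (psnd T)))
     else pair (pair (pfst A) (pfst T)) (psnd (psnd T)))"

lemma tape_upd:
  assumes "tape_rep T (t, h)"
  shows "tape_rep (tape_upd (act_code (b, m)) T) (t(h := b), shift_head m h)"
proof -
  have L: "stack_nth (pfst T) n = t (h - 1 - int n)" and R: "stack_nth (psnd T) n = t (h + int n)" for n
    using assms by (auto simp: tape_rep_def)
  have L0: "pfst (pfst T) = t (h - 1)"
    using L[of 0] by (simp add: stack_nth_def)
  have Ls: "stack_nth (psnd (pfst T)) n = t (h - 2 - int n)" for n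
    using L[of "Suc n"] by (simp add: stack_nth_psnd algebra_simps)
  have Rs: "stack_nth (psnd (psnd T)) n = t (h + 1 + int n)" for n
    using R[of "Suc n"] by (simp add: stack_nth_psnd algebra_simps)
  show ?thesis
    by (cases m) (auto simp: tape_rep_def tape_upd_def act_code_def L R L0 Ls Rs
      algebra_simps split: nat.split)
qed

fun scan :: "nat \<Rightarrow> nat \<Rightarrow> nat" where
  "scan 0 x = 0"
| "scan (Suc k) x = pair (pfst (psnd (pfst x))) (scan k (psnd x))"

fun apply_acts :: "nat \<Rightarrow> nat \<Rightarrow> nat \<Rightarrow> nat" where
  "apply_acts 0 a x = 0"
| "apply_acts (Suc k) a x = pair (tape_upd (pfst a) (pfst x)) (apply_acts k (psnd a) (psnd x))"

lemma scan_list_code: "scan (length Ts) (list_code Ts) = list_code (map (\<lambda>T. pfst (psnd T)) Ts)"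
  by (induction Ts) auto

lemma apply_acts_list_code:
  "length As = length Ts \<Longrightarrow> apply_acts (length Ts) (list_code As) (list_code Ts) = list_code (map2 tape_upd As Ts)"
  by (induction As Ts rule: list_induct2) auto

lemma recursive_scan: "recursive f \<Longrightarrow> recursive (\<lambda>x. scan k (f x))"
proof (induction k arbitrary: f)
  case (Suc k)
  show ?case unfolding scan.simps by (intro rec_intros Suc)
qed (simp add: recursive_const)

lemma recursive_apply_acts:
  "recursive f \<Longrightarrow> recursive g \<Longrightarrow> recursive (\<lambda>x. apply_acts k (f x) (g x))"
proof (induction k arbitrary: f g)
  case (Suc k)
  have "recursive (\<lambda>x. apply_acts k (psnd (f x)) (psnd (g x)))"
    using Suc.prems by (intro Suc.IH rec_intros)
  then show ?case
    unfolding apply_acts.simps tape_upd_def using Suc.prems by (intro rec_intros)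
qed (simp add: recursive_const)

subsection \<open>Observing one block of the output\<close>

text \<open>The accumulator pairs the number of blocks begun so far with the number of ones seen in
  block \<open>l\<close>.  The code of an output symbol is \<open>1\<close> for \<open>0\<close> and \<open>2\<close> for \<open>1\<close>; \<open>0\<close> stands for no output.\<close>

definition observe :: "nat \<Rightarrow> nat \<Rightarrow> nat \<Rightarrow> nat" where
  "observe l acc out = (if out = 0 then acc else if out = 1 then pair (Suc (pfst acc)) (psnd acc)
     else if pfst acc = Suc l then pair (pfst acc) (Suc (psnd acc)) else acc)"

lemma recursive_observe:
  assumes "recursive f" "recursive g" "recursive h"
  shows "recursive (\<lambda>x. observe (f x) (g x) (h x))"
  unfolding observe_def using assms by (intro rec_intros)

definition symbol_code :: "'s::zero_neq_one \<Rightarrow> nat" where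
  "symbol_code b = (if b = 0 then 1 else 2)"

definition observed :: "nat \<Rightarrow> 's::zero_neq_one list \<Rightarrow> nat" where
  "observed l w = foldl (observe l) 0 (map symbol_code w)"

lemma observed_append: "observed l (w @ [b]) = observe l (observed l w) (symbol_code b)"
  by (simp add: observed_def)

lemma observed_blocks:
  "observed l (blocks k ns :: 's::zero_neq_one list) = pair k (if l < k then Suc (ns !! l) else 0)"
proof (induction k)
  case (Suc k)
  have ones: "foldl (observe l) acc (replicate n 2)
      = pair (pfst acc) (psnd acc + (if pfst acc = Suc l then n else 0))" for n acc
    by (induction n arbitrary: acc) (auto simp: observe_def symbol_code_def)
  show ?case using Suc
    by (auto simp: observed_def blocks_Suc block_def ones observe_def symbol_code_def less_Suc_eq
        simp del: replicate.simps(2))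
qed (simp add: observed_def)

lemma observed_stable:
  assumes "Suc l < pfst (observed l w)"
  shows "psnd (observed l (w @ u)) = psnd (observed l w)"
proof -
  have "Suc l < pfst acc \<Longrightarrow> psnd (foldl (observe l) acc xs) = psnd acc" for acc xs
    by (induction xs arbitrary: acc) (auto simp: observe_def)
  then show ?thesis using assms by (simp add: observed_def)
qed

text \<open>Once the block after block \<open>l\<close> has begun, block \<open>l\<close> is complete and its ones have been counted.
  To see this, prolong the output to a sequence of complete blocks.\<close>

lemma observed_prefix:
  fixes w :: "'s::zero_neq_one list"
  assumes w: "w = stake n (encode_seq ns)" and l: "Suc l < pfst (observed l w)"
  shows "psnd (observed l w) = Suc (ns !! l)"
proof -
  define k where "k = max n (Suc l)"
  have "min n (length (blocks k ns :: 's list)) = n" using length_blocks[of k ns, where 'a = 's] by (simp add: k_def)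
  then have "w = take n (stake (length (blocks k ns :: 's list)) (encode_seq ns))"
    by (simp only: take_stake w)
  then have "w = take n (blocks k ns)" by (simp only: stake_encode_seq)
  then have "blocks k ns = w @ drop n (blocks k ns)" by simp
  then have "psnd (observed l w) = psnd (observed l (blocks k ns :: 's list))"
    using observed_stable[OF l] by metis
  then show ?thesis by (simp add: observed_blocks k_def)
qed

subsection \<open>The simulation\<close>

text \<open>The machine is simulated step by step on codes of configurations until block \<open>l + 1\<close> of its output
  begins; this happens because the output is infinite.  The input need not be stored, as its symbols can
  be computed from the parameter \<open>a\<close> and the position of the head.\<close>

theorem recursive_machine_output:
  fixes M :: "'s::{finite,zero_neq_one} machine"
  assumes wf: "wf_machine M"
    and p: "\<And>a i. p a !! i = of_bool (h a i)" "recursive (\<lambda>z. of_bool (h (pfst z) (psnd z)))"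
    and out: "\<And>a. transforms M (p a) (encode_seq (ms a))"
  shows "recursive (\<lambda>z. ms (pfst z) !! (psnd z))"
proof -
  define k where "k = num_tapes M"
  define Z where "Z = {..<num_states M} \<times> (UNIV :: bool set) \<times>
    {ws. set ws \<subseteq> {..<num_symbols M} \<and> length ws = k}"
  \<comment> \<open>The transition function is a finite table, indexed by codes of what the machine sees.\<close>
  define key where "key = (\<lambda>(q, v, ws). pair q (pair (of_bool v) (list_code ws)))"
  define out_code :: "'s option \<Rightarrow> nat" where
    "out_code x = (case x of None \<Rightarrow> 0 | Some b \<Rightarrow> symbol_code b)" for x
  define result where "result = (\<lambda>(q, v, ws). case trans M q (of_bool v) ws of (q', adv, acts, out) \<Rightarrow>
    pair q' (pair (of_bool adv) (pair (list_code (map act_code acts)) (out_code out))))"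
  define table where "table x = (if x \<in> key ` Z then result (inv_into Z key x) else 0)" for x
  have "finite Z" unfolding Z_def by (intro finite_SigmaI finite_lists_length_eq) auto
  then have "recursive table"
    unfolding table_def by (intro recursive_finite) auto
  have "inj_on key Z"
    by (auto simp: inj_on_def Z_def key_def list_code_inject split: if_splits)
  then have table: "table (key x) = result x" if "x \<in> Z" for x
    using that by (simp add: table_def)

  \<comment> \<open>A code consists of the pair of parameters, the state, the input position, the tapes
    and the accumulator.\<close>
  define R where "R z = table (pair (pfst (psnd z)) (pair (of_bool (h (pfst (pfst z)) (pfst (psnd (psnd z)))))
      (scan k (pfst (psnd (psnd (psnd z)))))))" for z
  define step_code where "step_code z = pair (pfst z) (pair (pfst (R z))
    (pair (pfst (psnd (psnd z)) + pfst (psnd (R z)))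
      (pair (apply_acts k (pfst (psnd (psnd (R z)))) (pfst (psnd (psnd (psnd z)))))
        (observe (psnd (pfst z)) (psnd (psnd (psnd (psnd z)))) (psnd (psnd (psnd (R z))))))))" for z
  have "recursive R"
    unfolding R_def by (intro rec_intros recursive_scan recursive_comp[OF \<open>recursive table\<close>]
        recursive2[where F = "\<lambda>a i. of_bool (h a i)", OF p(2)])
  then have rec_step: "recursive step_code"
    unfolding step_code_def by (intro rec_intros recursive_apply_acts recursive_observe)

  define coded where "coded a l z = (\<lambda>(q, i, ts, w :: 's list). \<exists>Ts. list_all2 tape_rep Ts ts \<and> length ts = k
     \<and> q < num_states M \<and> (\<forall>(t, h) \<in> set ts. \<forall>x. t x < num_symbols M) \<and>
     z = pair (pair a l) (pair q (pair i (pair (list_code Ts) (observed l w)))))" for a l z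
  have coded_init: "coded a l (pair (pair a l) 0) (initial M)" for a l
  proof -
    have "tape_rep 0 (\<lambda>_. 0, 0)" by (simp add: tape_rep_def stack_nth_0)
    moreover have "list_code (replicate n 0) = 0" for n by (induction n) auto
    ultimately show ?thesis using wf
      by (auto simp: coded_def initial_def k_def wf_machine_def observed_def list_all2_conv_all_nth
          intro!: exI[of _ "replicate k 0"])
  qed
  have coded_step: "coded a l (step_code z) (step M (p a) \<sigma>)" if \<sigma>_coded: "coded a l z \<sigma>" for a l z \<sigma>
  proof -
    obtain q i ts w where \<sigma>: "\<sigma> = (q, i, ts, w)" by (metis prod_cases4)
    obtain Ts where Ts: "list_all2 tape_rep Ts ts" "length ts = k" and q: "q < num_states M"
      and sym: "\<forall>(t, h) \<in> set ts. \<forall>x. t x < num_symbols M"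
      and z: "z = pair (pair a l) (pair q (pair i (pair (list_code Ts) (observed l w))))"
      using \<sigma>_coded unfolding coded_def \<sigma> prod.case by blast
    define ws where "ws = map (\<lambda>(t, h). t h) ts"
    have len: "length Ts = k" using Ts by (simp add: list_all2_lengthD)
    have "map (\<lambda>T. pfst (psnd T)) Ts = ws"
      unfolding ws_def using Ts(1)
      by (induction rule: list_all2_induct) (auto simp: tape_rep_def stack_nth_pfst)
    then have scan: "scan k (list_code Ts) = list_code ws" using scan_list_code[of Ts] len by simp
    have ws: "length ws = k" "set ws \<subseteq> {..<num_symbols M}"
      using sym by (auto simp: ws_def Ts)
    obtain q' adv acts ou where tr: "trans M q (of_bool (h a i)) ws = (q', adv, acts, ou)"
      by (metis prod_cases4)
    have acts: "q' < num_states M" "length acts = k" "fst ` set acts \<subseteq> {..<num_symbols M}"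
      using wf q ws tr unfolding wf_machine_def k_def
      by (metis (mono_tags, lifting) case_prod_conv)+
    have "table (pair q (pair (of_bool (h a i)) (list_code ws))) = result (q, h a i, ws)"
      using table[of "(q, h a i, ws)"] q ws by (simp add: key_def Z_def)
    then have R: "R z
        = pair q' (pair (of_bool adv) (pair (list_code (map act_code acts)) (out_code ou)))"
      by (simp add: R_def z scan result_def tr)
    let ?Ts = "map2 tape_upd (map act_code acts) Ts"
    let ?ts = "map2 (\<lambda>(b, m) (t, h). (t(h := b), shift_head m h)) acts ts"
    let ?w = "case ou of None \<Rightarrow> w | Some b \<Rightarrow> w @ [b]"
    have "apply_acts k (list_code (map act_code acts)) (list_code Ts) = list_code ?Ts"
      using apply_acts_list_code[of "map act_code acts" Ts] acts len by simp
    moreover have "observe l (observed l w) (out_code ou) = observed l ?w"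
      by (cases ou) (auto simp: out_code_def observed_append, simp add: observe_def)
    ultimately have "step_code z = pair (pair a l) (pair q' (pair (if adv then Suc i else i)
        (pair (list_code ?Ts) (observed l ?w))))"
      unfolding step_code_def R by (simp add: z)
    moreover have "list_all2 tape_rep ?Ts ?ts"
    proof (rule list_all2_all_nthI)
      fix n assume "n < length ?Ts"
      then have n: "n < k" using len acts(2) by simp
      obtain b m t h where *: "acts ! n = (b, m)" "ts ! n = (t, h)" by (metis surj_pair)
      have "tape_rep (Ts ! n) (t, h)" using list_all2_nthD2[OF Ts(1), of n] n Ts(2) * by simp
      then show "tape_rep (?Ts ! n) (?ts ! n)" using n len acts(2) Ts(2) * by (simp add: tape_upd)
    qed (use len acts(2) Ts(2) in simp)
    moreover have "\<forall>(t, h) \<in> set ?ts. \<forall>x. t x < num_symbols M"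
    proof
      fix y assume "y \<in> set ?ts"
      then obtain n where n: "n < k" "y = ?ts ! n"
        using acts(2) Ts(2) by (auto simp: in_set_conv_nth)
      obtain b m t h where *: "acts ! n = (b, m)" "ts ! n = (t, h)" by (metis surj_pair)
      have "(b, m) \<in> set acts" "(t, h) \<in> set ts"
        using * n acts(2) Ts(2) nth_mem by metis+
      then have "b < num_symbols M" "\<And>x. t x < num_symbols M" using sym acts(3) by force+
      moreover have "y = (t(h := b), shift_head m h)" using n acts(2) Ts(2) * by simp
      ultimately show "case y of (t, h) \<Rightarrow> \<forall>x. t x < num_symbols M" by simp
    qed
    moreover have "step M (p a) \<sigma> = (q', if adv then Suc i else i, ?ts, ?w)"
      by (simp add: \<sigma> step_def p tr ws_def[symmetric])
    ultimately show ?thesis unfolding coded_def using acts(1,2) Ts(2) by auto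
  qed
  have run: "psnd (psnd (psnd (psnd ((step_code ^^ t) (pair (pair a l) 0)))))
      = observed l (output_after M (p a) t)" for a l t
  proof -
    have "coded a l ((step_code ^^ t) (pair (pair a l) 0)) ((step M (p a) ^^ t) (initial M))"
      by (induction t) (auto simp: coded_init coded_step)
    then show ?thesis by (auto simp: output_after_def coded_def)
  qed

  define tst where "tst z = Suc (Suc (psnd (pfst z))) - pfst (psnd (psnd (psnd (psnd z))))" for z
  have "recursive tst" unfolding tst_def by (intro rec_intros)
  \<comment> \<open>The parameters are carried along unchanged, so that the test can refer to \<open>l\<close>.\<close>
  have params: "pfst ((step_code ^^ t) z) = pfst z" for t z
    by (induction t) (auto simp: step_code_def)
  have halt: "\<exists>t. tst ((step_code ^^ t) (pair z 0)) = 0" for z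
  proof -
    obtain a l where z: "z = pair a l" by (metis prod_decode_inverse prod.collapse)
    obtain t where t: "output_after M (p a) t = blocks (Suc (Suc l)) (ms a)"
      using out[of a] unfolding transforms_def by (metis stake_encode_seq)
    have "tst ((step_code ^^ t) (pair z 0)) = 0"
      unfolding tst_def run[of t a l, folded z] params unfolding t observed_blocks by (simp add: z)
    then show ?thesis by blast
  qed
  have "recursive (\<lambda>z. iterate_until tst step_code (pair z 0))"
    by (intro recursive_iterate_until \<open>recursive tst\<close> rec_step rec_intros halt)
  then have "recursive (\<lambda>z. psnd (psnd (psnd (psnd (psnd (iterate_until tst step_code (pair z 0)))))) - 1)"
    by (intro rec_intros)
  moreover have "psnd (psnd (psnd (psnd (psnd (iterate_until tst step_code (pair z 0)))))) - 1
      = ms (pfst z) !! psnd z" for z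
  proof -
    obtain a l where z: "z = pair a l" by (metis prod_decode_inverse prod.collapse)
    define t where "t = (LEAST t. tst ((step_code ^^ t) (pair z 0)) = 0)"
    have "tst ((step_code ^^ t) (pair z 0)) = 0"
      unfolding t_def by (rule LeastI_ex) (rule halt)
    then have "Suc l < pfst (observed l (output_after M (p a) t))"
      unfolding tst_def run[of t a l, folded z] params by (simp add: z)
    moreover obtain n where "output_after M (p a) t = stake n (encode_seq (ms a))"
      using transforms_prefix[OF out] by blast
    ultimately have "psnd (observed l (output_after M (p a) t)) = Suc (ms a !! l)"
      by (intro observed_prefix)
    then show ?thesis
      unfolding iterate_until_def t_def[symmetric] run[of t a l, folded z] by (simp add: z)
  qed
  ultimately show ?thesis by simp
qed

section \<open>Arithmetic on codes of scalars\<close>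

lemma rat_numbering_pair: "rat_numbering (pair (pair i j) d) = (real i - real j) / real (Suc d)"
  by (simp add: rat_numbering_def)

lemma rat_numbering_cases:
  obtains i j d where "n = pair (pair i j) d"
  by (metis prod_decode_inverse prod.collapse)

text \<open>A code of a rational contains two numbers, whose difference is the numerator, and the denominator minus
  one.  Fractions are not cancelled.\<close>

definition rat_add :: "nat \<Rightarrow> nat \<Rightarrow> nat" where
  "rat_add x y = pair (pair
     (pfst (pfst x) * Suc (psnd y) + pfst (pfst y) * Suc (psnd x))
     (psnd (pfst x) * Suc (psnd y) + psnd (pfst y) * Suc (psnd x)))
     (psnd x * psnd y + psnd x + psnd y)"

definition rat_mul :: "nat \<Rightarrow> nat \<Rightarrow> nat" where
  "rat_mul x y = pair (pair
     (pfst (pfst x) * pfst (pfst y) + psnd (pfst x) * psnd (pfst y))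
     (pfst (pfst x) * psnd (pfst y) + psnd (pfst x) * pfst (pfst y)))
     (psnd x * psnd y + psnd x + psnd y)"

definition rat_neg :: "nat \<Rightarrow> nat" where
  "rat_neg x = pair (pair (psnd (pfst x)) (pfst (pfst x))) (psnd x)"

lemma rat_add: "rat_numbering (rat_add x y) = rat_numbering x + rat_numbering y"
proof -
  obtain i j d where x: "x = pair (pair i j) d" by (rule rat_numbering_cases)
  obtain i' j' d' where y: "y = pair (pair i' j') d'" by (rule rat_numbering_cases)
  have d: "real (Suc (d * d' + d + d')) = real (Suc d) * real (Suc d')" by (simp add: algebra_simps)
  have "rat_numbering (rat_add x y) = (real (i * Suc d' + i' * Suc d) - real (j * Suc d' + j' * Suc d))
      / (real (Suc d) * real (Suc d'))"
    unfolding d[symmetric] by (simp add: x y rat_add_def rat_numbering_pair)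
  also have "\<dots> = rat_numbering x + rat_numbering y"
    unfolding x y rat_numbering_pair by (simp add: divide_simps) (simp add: algebra_simps)
  finally show ?thesis .
qed

lemma rat_mul: "rat_numbering (rat_mul x y) = rat_numbering x * rat_numbering y"
proof -
  obtain i j d where x: "x = pair (pair i j) d" by (rule rat_numbering_cases)
  obtain i' j' d' where y: "y = pair (pair i' j') d'" by (rule rat_numbering_cases)
  have d: "real (Suc (d * d' + d + d')) = real (Suc d) * real (Suc d')" by (simp add: algebra_simps)
  have "rat_numbering (rat_mul x y) = (real (i * i' + j * j') - real (i * j' + j * i'))
      / (real (Suc d) * real (Suc d'))"
    unfolding d[symmetric] by (simp add: x y rat_mul_def rat_numbering_pair)
  also have "\<dots> = rat_numbering x * rat_numbering y"
    unfolding x y rat_numbering_pair by (simp add: algebra_simps)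
  finally show ?thesis .
qed

lemma rat_neg: "rat_numbering (rat_neg x) = - rat_numbering x"
  by (rule rat_numbering_cases[of x]) (simp add: rat_neg_def rat_numbering_pair field_simps)

lemma rat_numbering_0: "rat_numbering 0 = 0"
  using rat_numbering_pair[of 0 0 0] by simp

lemma abs_rat_numbering_le: "\<bar>rat_numbering n\<bar> \<le> real n"
proof -
  obtain i j d where n: "n = pair (pair i j) d" by (rule rat_numbering_cases)
  have "\<bar>rat_numbering n\<bar> \<le> \<bar>real i - real j\<bar>"
    unfolding n rat_numbering_pair by (simp add: divide_le_eq algebra_simps)
  also have "\<dots> \<le> real (max i j)" by auto
  also have "max i j \<le> pair i j" using le_prod_encode_1 le_prod_encode_2 by simp
  also have "pair i j \<le> n" unfolding n by (rule le_prod_encode_1)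
  finally show ?thesis by simp
qed

lemma recursive_rat_add: "recursive f \<Longrightarrow> recursive g \<Longrightarrow> recursive (\<lambda>x. rat_add (f x) (g x))"
  unfolding rat_add_def by (intro rec_intros)

lemma recursive_rat_mul: "recursive f \<Longrightarrow> recursive g \<Longrightarrow> recursive (\<lambda>x. rat_mul (f x) (g x))"
  unfolding rat_mul_def by (intro rec_intros)

lemma recursive_rat_neg: "recursive f \<Longrightarrow> recursive (\<lambda>x. rat_neg (f x))"
  unfolding rat_neg_def by (intro rec_intros)

lemma to_complex_0: "to_complex (0 :: 'k::real_or_complex) = 0"
  using to_complex_of_real[of 0, where 'a = 'k] by simp

lemma to_complex_minus: "to_complex (- x :: 'k::real_or_complex) = - to_complex x"
  by (rule minus_unique[symmetric]) (simp add: to_complex_0 flip: to_complex_add)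

lemma to_complex_diff: "to_complex (x - y :: 'k::real_or_complex) = to_complex x - to_complex y"
  by (simp only: diff_conv_add_uminus to_complex_add to_complex_minus)

lemma to_complex_inject: "to_complex (x :: 'k::real_or_complex) = to_complex y \<longleftrightarrow> x = y"
proof
  assume "to_complex x = to_complex y"
  then have "norm (to_complex (x - y)) = 0" unfolding to_complex_diff by simp
  then show "x = y" by (simp add: norm_to_complex)
qed simp

lemma to_complex_scalar_numbering:
  assumes "range (to_complex :: 'k::real_or_complex \<Rightarrow> complex) = UNIV"
  shows "to_complex (scalar_numbering n :: 'k) = Complex (rat_numbering (pfst n)) (rat_numbering (psnd n))"
  using assms by (simp add: scalar_numbering_def f_inv_into_f split: prod.split)

lemma scalar_numbering_0: "scalar_numbering 0 = (0 :: 'k::real_or_complex)"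
proof (cases "range (to_complex :: 'k \<Rightarrow> complex) = UNIV")
  case True
  show ?thesis
    by (rule iffD1[OF to_complex_inject])
      (simp add: to_complex_scalar_numbering[OF True] to_complex_0 rat_numbering_0 complex_eq_iff)
qed (simp add: scalar_numbering_def rat_numbering_0)

text \<open>A code is at least as large as the numbers from which it is built, and these bound the scalar.  So the
  code itself serves as a computable bound.\<close>

lemma norm_scalar_numbering_le: "norm (scalar_numbering n :: 'k::real_or_complex) \<le> real n"
proof (cases "range (to_complex :: 'k \<Rightarrow> complex) = UNIV")
  case True
  have "norm (scalar_numbering n :: 'k) \<le> \<bar>rat_numbering (pfst n)\<bar> + \<bar>rat_numbering (psnd n)\<bar>"
    unfolding norm_to_complex[of "scalar_numbering n :: 'k", symmetric]
      to_complex_scalar_numbering[OF True]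
    using cmod_le[of "Complex (rat_numbering (pfst n)) (rat_numbering (psnd n))"] by simp
  also have "\<dots> \<le> real (pfst n) + real (psnd n)" by (intro add_mono abs_rat_numbering_le)
  also have "\<dots> \<le> real n"
  proof -
    have "m \<le> triangle m" for m by (induction m) auto
    then have "k + m \<le> pair k m" for k m
      by (simp add: prod_encode_def trans_le_add1)
    from this[of "pfst n" "psnd n"] show ?thesis by (simp flip: of_nat_add)
  qed
  finally show ?thesis .
qed (use abs_rat_numbering_le in \<open>auto simp: scalar_numbering_def\<close>)

text \<open>The numbering of scalars depends on whether the field is real or complex, hence so do the functions that
  compute with codes.\<close>

lemma scalar_arithmetic:
  obtains add mul :: "nat \<Rightarrow> nat \<Rightarrow> nat" and one :: nat where
    "\<And>f g. recursive f \<Longrightarrow> recursive g \<Longrightarrow> recursive (\<lambda>x. add (f x) (g x))"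
    "\<And>f g. recursive f \<Longrightarrow> recursive g \<Longrightarrow> recursive (\<lambda>x. mul (f x) (g x))"
    "\<And>x y. (scalar_numbering (add x y) :: 'k::real_or_complex) = scalar_numbering x + scalar_numbering y"
    "\<And>x y. (scalar_numbering (mul x y) :: 'k) = scalar_numbering x * scalar_numbering y"
    "(scalar_numbering one :: 'k) = 1"
proof (cases "range (to_complex :: 'k \<Rightarrow> complex) = UNIV")
  case True
  define add where "add x y = pair (rat_add (pfst x) (pfst y)) (rat_add (psnd x) (psnd y))" for x y
  define mul where "mul x y = pair
    (rat_add (rat_mul (pfst x) (pfst y)) (rat_neg (rat_mul (psnd x) (psnd y))))
    (rat_add (rat_mul (pfst x) (psnd y)) (rat_mul (psnd x) (pfst y)))" for x y
  show ?thesis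
  proof (rule that[of add mul "pair (pair (pair 1 0) 0) 0"])
    show "recursive (\<lambda>x. add (f x) (g x))" if "recursive f" "recursive g" for f g
      unfolding add_def using that by (intro rec_intros recursive_rat_add)
    show "recursive (\<lambda>x. mul (f x) (g x))" if "recursive f" "recursive g" for f g
      unfolding mul_def using that
      by (intro rec_intros recursive_rat_add recursive_rat_mul recursive_rat_neg)
    show "(scalar_numbering (add x y) :: 'k) = scalar_numbering x + scalar_numbering y" for x y
      by (rule iffD1[OF to_complex_inject], unfold to_complex_add to_complex_scalar_numbering[OF True])
        (simp add: add_def rat_add complex_eq_iff)
    show "(scalar_numbering (mul x y) :: 'k) = scalar_numbering x * scalar_numbering y" for x y
      by (rule iffD1[OF to_complex_inject], unfold to_complex_mult to_complex_scalar_numbering[OF True])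
        (simp add: mul_def rat_add rat_mul rat_neg complex_eq_iff)
    show "(scalar_numbering (pair (pair (pair 1 0) 0) 0) :: 'k) = 1"
      by (rule iffD1[OF to_complex_inject], unfold to_complex_one to_complex_scalar_numbering[OF True])
        (simp add: rat_numbering_pair rat_numbering_0 complex_eq_iff)
  qed
next
  case False
  then have S: "(scalar_numbering n :: 'k) = of_real (rat_numbering n)" for n
    by (simp add: scalar_numbering_def)
  show ?thesis
    by (rule that[of rat_add rat_mul "pair (pair 1 0) 0"])
      (auto simp: S rat_add rat_mul rat_numbering_pair recursive_rat_add recursive_rat_mul)
qed

section \<open>Codes of vectors\<close>

text \<open>The code of the coefficient of the basis vector \<open>x\<close> in the vector with code \<open>m\<close>.  The last entry of a tuple
  is not paired with anything, so it must be treated separately; beyond it, \<open>0\<close> is a code of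
  the scalar \<open>0\<close>.\<close>

definition coef :: "nat \<Rightarrow> nat \<Rightarrow> nat" where
  "coef m x = (if x < pfst m then pfst (rec_nat (psnd m) (\<lambda>_. psnd) x)
     else if x = pfst m then rec_nat (psnd m) (\<lambda>_. psnd) x else 0)"

lemma recursive_coef: "recursive f \<Longrightarrow> recursive g \<Longrightarrow> recursive (\<lambda>x. coef (f x) (g x))"
  unfolding coef_def by (intro rec_intros)

lemma tuple_decode_nth:
  "i \<le> k \<Longrightarrow> tuple_decode k t ! i =
    (if i < k then pfst (rec_nat t (\<lambda>_. psnd) i) else rec_nat t (\<lambda>_. psnd) i)"
proof (induction k arbitrary: i t)
  case (Suc k)
  show ?case
  proof (cases i)
    case (Suc j)
    have "rec_nat t (\<lambda>_. psnd) (Suc n) = rec_nat (psnd t) (\<lambda>_. psnd) n" for n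
      by (induction n) auto
    then show ?thesis using Suc.IH[of j "psnd t"] Suc.prems Suc by (auto split: prod.split)
  qed (auto split: prod.split)
qed auto

lemma span_numbering_coef:
  fixes smul :: "'k::real_or_complex \<Rightarrow> 'h::ab_group_add \<Rightarrow> 'h"
  assumes "vector_space smul" "pfst m \<le> K"
  shows "span_numbering smul e m = (\<Sum>i\<le>K. smul (scalar_numbering (coef m i)) (e i))"
proof -
  interpret vector_space smul by fact
  have "span_numbering smul e m = (\<Sum>i\<le>pfst m. smul (scalar_numbering (coef m i)) (e i))"
    unfolding span_numbering_def
    by (auto simp: coef_def tuple_decode_nth split: prod.split intro!: sum.cong)
  also have "\<dots> = (\<Sum>i\<le>K. smul (scalar_numbering (coef m i)) (e i))"
    using assms(2) by (intro sum.mono_neutral_left) (auto simp: coef_def scalar_numbering_0)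
  finally show ?thesis .
qed

text \<open>The tuple of the \<open>a i\<close> for \<open>i \<le> K\<close> is assembled from its last entry backwards.\<close>

definition vector_code :: "nat \<Rightarrow> (nat \<Rightarrow> nat) \<Rightarrow> nat" where
  "vector_code K a = pair K (rec_nat (a K) (\<lambda>j t. pair (a (K - Suc j)) t) K)"

lemma recursive_vector_code:
  assumes "recursive (\<lambda>z. a (pfst z) (psnd z))" "recursive K"
  shows "recursive (\<lambda>x. vector_code (K x) (a x))"
  unfolding vector_code_def using assms(2)
  by (intro rec_intros recursive2[where F = a, OF assms(1)] recursive_comp[OF assms(2)])

lemma span_numbering_vector_code:
  "span_numbering smul e (vector_code K a) = (\<Sum>i\<le>K. smul (scalar_numbering (a i)) (e i))"
proof -
  have "j \<le> K \<Longrightarrow> rec_nat (a K) (\<lambda>j t. pair (a (K - Suc j)) t) j = tuple_encode (map a [K - j..<Suc K])" for j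
  proof (induction j)
    case (Suc j)
    have 1: "[K - Suc j..<Suc K] = (K - Suc j) # [K - j..<Suc K]"
      using Suc.prems by (subst upt_conv_Cons) (auto simp: Suc_diff_Suc)
    have 2: "[K - j..<Suc K] = (K - j) # [Suc (K - j)..<Suc K]"
      by (rule upt_conv_Cons) simp
    show ?case using Suc unfolding 1 2 by simp
  qed simp
  from this[of K] have "vector_code K a = pair K (tuple_encode (map a [0..<Suc K]))"
    by (simp add: vector_code_def)
  then have "span_numbering smul e (vector_code K a) =
      (\<Sum>i\<le>K. smul (scalar_numbering (map a [0..<Suc K] ! i)) (e i))"
    by (simp only: span_numbering_encode length_map length_upt diff_zero)
  also have "\<dots> = (\<Sum>i\<le>K. smul (scalar_numbering (a i)) (e i))"
    by (intro sum.cong) (auto simp del: upt_Suc)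
  finally show ?thesis .
qed

lemma unit_code:
  obtains u where "recursive u"
    "\<And>(smul :: 'k::real_or_complex \<Rightarrow> 'h::ab_group_add \<Rightarrow> 'h) e n.
       vector_space smul \<Longrightarrow> span_numbering smul e (u n) = e n"
proof -
  obtain one where one: "(scalar_numbering one :: 'k) = 1" using scalar_arithmetic by metis
  define u where "u n = vector_code n (\<lambda>i. if i = n then one else 0)" for n
  show ?thesis
  proof (rule that[of u])
    show "recursive u" unfolding u_def by (intro recursive_vector_code rec_intros)
    fix smul :: "'k \<Rightarrow> 'h \<Rightarrow> 'h" and e and n :: nat
    assume "vector_space smul"
    then interpret vector_space smul .
    have "span_numbering smul e (u n) = (\<Sum>i\<le>n. if i = n then e i else 0)"
      unfolding u_def span_numbering_vector_code by (intro sum.cong) (auto simp: one scalar_numbering_0)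
    then show "span_numbering smul e (u n) = e n" by simp
  qed
qed

text \<open>Replacing the basis vectors by coded vectors turns a code of a combination of the former into
  one of the latter.\<close>

lemma substitution_code:
  fixes smul :: "'k::real_or_complex \<Rightarrow> 'h::ab_group_add \<Rightarrow> 'h"
  assumes smul: "vector_space smul" and phi: "recursive (\<lambda>z. \<phi> (pfst z) (psnd z))"
  obtains C where "recursive (\<lambda>z. C (pfst z) (psnd z))"
    "\<And>n l. span_numbering smul e (C n l) =
      (\<Sum>j\<le>pfst n. smul (scalar_numbering (coef n j)) (span_numbering smul e (\<phi> j l)))"
proof -
  obtain add mul one where am: "\<And>f g. recursive f \<Longrightarrow> recursive g \<Longrightarrow> recursive (\<lambda>x. add (f x) (g x))"
    "\<And>f g. recursive f \<Longrightarrow> recursive g \<Longrightarrow> recursive (\<lambda>x. mul (f x) (g x))"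
    and add: "\<And>x y. (scalar_numbering (add x y) :: 'k) = scalar_numbering x + scalar_numbering y"
    and mul: "\<And>x y. (scalar_numbering (mul x y) :: 'k) = scalar_numbering x * scalar_numbering y"
    and "(scalar_numbering one :: 'k) = 1"
    by (rule scalar_arithmetic[where 'k = 'k]) (rule that)
  note phi' = recursive2[where F = \<phi>, OF phi]
  \<comment> \<open>\<open>K n l\<close> bounds the indices of all coefficients involved, because the last index of a vector is at
    most its code.\<close>
  define K where "K n l = rec_nat 0 (\<lambda>j s. s + \<phi> j l) (Suc (pfst n))" for n l
  define a where "a n l i = rec_nat 0 (\<lambda>j s. add s (mul (coef n j) (coef (\<phi> j l) i))) (Suc (pfst n))" for n l i
  define C where "C n l = vector_code (K n l) (a n l)" for n l
  show ?thesis
  proof (rule that[of C])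
    show "recursive (\<lambda>z. C (pfst z) (psnd z))"
      unfolding C_def K_def a_def
      by (intro recursive_vector_code rec_intros am recursive_coef phi')
  next
    fix n l
    interpret vector_space smul by fact
    have a: "(scalar_numbering (a n l i) :: 'k)
      = (\<Sum>j\<le>pfst n. scalar_numbering (coef n j) * scalar_numbering (coef (\<phi> j l) i))" for i
    proof -
      have "(scalar_numbering (rec_nat 0 (\<lambda>j s. add s (mul (coef n j) (coef (\<phi> j l) i))) N) :: 'k)
        = (\<Sum>j<N. scalar_numbering (coef n j) * scalar_numbering (coef (\<phi> j l) i))" for N
        by (induction N) (auto simp: scalar_numbering_0 add mul)
      then show ?thesis by (simp only: a_def lessThan_Suc_atMost)
    qed
    have K: "pfst (\<phi> j l) \<le> K n l" if "j \<le> pfst n" for j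
    proof -
      have "rec_nat 0 (\<lambda>j s. s + \<phi> j l) N = (\<Sum>j<N. \<phi> j l)" for N by (induction N) auto
      then have "\<phi> j l \<le> K n l"
        unfolding K_def using that by (simp only:) (rule member_le_sum, auto)
      moreover have "pfst (\<phi> j l) \<le> \<phi> j l"
        by (metis le_prod_encode_1 prod_decode_inverse prod.collapse)
      ultimately show ?thesis by simp
    qed
    have "span_numbering smul e (C n l) = (\<Sum>i\<le>K n l. \<Sum>j\<le>pfst n.
       smul (scalar_numbering (coef n j)) (smul (scalar_numbering (coef (\<phi> j l) i)) (e i)))"
      unfolding C_def span_numbering_vector_code a by (simp add: scale_sum_left)
    also have "\<dots> = (\<Sum>j\<le>pfst n. smul (scalar_numbering (coef n j)) (span_numbering smul e (\<phi> j l)))"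
      by (subst sum.swap, intro sum.cong refl)
        (auto simp: span_numbering_coef[OF smul K] scale_sum_right)
    finally show "span_numbering smul e (C n l) =
      (\<Sum>j\<le>pfst n. smul (scalar_numbering (coef n j)) (span_numbering smul e (\<phi> j l)))" .
  qed
qed

lemma coef_le: "coef n j \<le> n"
proof -
  have p: "pfst x \<le> x" "psnd x \<le> x" for x
    using le_prod_encode_1[of "pfst x" "psnd x"] le_prod_encode_2[of "psnd x" "pfst x"] by auto
  have "rec_nat x (\<lambda>_. psnd) j \<le> x" for x by (induction j) (auto intro: le_trans p)
  from this[of "psnd n"] show ?thesis
    using p(1)[of "rec_nat (psnd n) (\<lambda>_. psnd) j"] p(2)[of n] by (auto simp: coef_def)
qed

section \<open>Uniform boundedness\<close>

text \<open>By the Baire category theorem one of the closed sets on which all seminorms are at most \<open>n\<close> contains a ball;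
  translating the ball to the origin costs a factor of two.\<close>

lemma uniform_boundedness:
  fixes p :: "'i \<Rightarrow> 'h::banach \<Rightarrow> real"
  assumes cont: "\<And>i. i \<in> I \<Longrightarrow> continuous_on UNIV (p i)"
    and add: "\<And>i x y. i \<in> I \<Longrightarrow> p i (x + y) \<le> p i x + p i y"
    and minus: "\<And>i x. i \<in> I \<Longrightarrow> p i (- x) = p i x"
    and scale: "\<And>i x r. i \<in> I \<Longrightarrow> p i (r *\<^sub>R x) = \<bar>r\<bar> * p i x"
    and bounded: "\<And>x. \<exists>b. \<forall>i\<in>I. p i x \<le> b"
  obtains C where "0 < C" "\<And>i x. i \<in> I \<Longrightarrow> p i x \<le> C * norm x"
proof -
  define F where "F n = {x. \<forall>i\<in>I. p i x \<le> real n}" for n :: nat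
  have closed: "closed (F n)" for n
  proof -
    have "F n = (\<Inter>i\<in>I. {x. p i x \<le> real n})" by (auto simp: F_def)
    moreover have "closed {x. p i x \<le> real n}" if "i \<in> I" for i
      using cont[OF that] by (intro closed_Collect_le continuous_on_const)
    ultimately show ?thesis by auto
  qed
  have "(\<Union>n. F n) = UNIV"
  proof (intro equalityI subsetI UNIV_I)
    fix x
    obtain b where b: "\<forall>i\<in>I. p i x \<le> b" using bounded by blast
    obtain n :: nat where "b \<le> real n" using real_arch_simple by blast
    then have "x \<in> F n" using b by (auto simp: F_def intro: order_trans)
    then show "x \<in> (\<Union>n. F n)" by blast
  qed
  moreover have "interior (\<Union>(range F)) = {}" if "\<And>n. interior (F n) = {}"
    using Met_TC.metric_Baire_category_alt[of "range F"] closed that complete_UNIV by auto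
  ultimately obtain n where "interior (F n) \<noteq> {}" by auto
  then obtain a e where e: "e > 0" "ball a e \<subseteq> F n"
    by (metis ex_in_conv mem_interior)
  have small: "p i y \<le> 2 * real n" if "i \<in> I" "norm y < e" for i y
  proof -
    have "a + y \<in> F n" "a \<in> F n" using e that by (auto simp: dist_norm subset_iff)
    then have "p i (a + y) \<le> real n" "p i (- a) \<le> real n" using that minus by (auto simp: F_def)
    moreover have "p i y \<le> p i (a + y) + p i (- a)" using add[OF that(1), of "a + y" "- a"] by simp
    ultimately show ?thesis by simp
  qed
  have "p i x \<le> (4 * real n / e + 1) * norm x" if i: "i \<in> I" for i x
  proof (cases "x = 0")
    case True
    have "p i (0 *\<^sub>R 0) = 0" by (subst scale[OF i]) simp
    then show ?thesis using True by simp
  next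
    case False
    define r where "r = e / (2 * norm x)"
    have r: "r > 0" using e False by (simp add: r_def)
    have "norm (r *\<^sub>R x) < e" using e False by (simp add: r_def)
    then have "r * p i x \<le> 2 * real n" using small[OF i, of "r *\<^sub>R x"] scale[OF i, of r x] r by simp
    then have "p i x \<le> 2 * real n / r" using r by (simp add: field_simps)
    also have "\<dots> = 4 * real n / e * norm x" by (simp add: r_def)
    also have "\<dots> \<le> (4 * real n / e + 1) * norm x" by (simp add: distrib_right)
    finally show ?thesis .
  qed
  moreover have "0 < 4 * real n / e + 1" using e by (simp add: add_nonneg_pos)
  ultimately show ?thesis using that by blast
qed

section \<open>A divergence test\<close>

text \<open>The Abel-Dini theorem.  With \<open>R\<close> the partial sums of the divergent series, the terms
  \<open>a\<^sub>k\<^sup>2 / R\<^sub>k\<^sub>+\<^sub>1\<^sup>2\<close> are dominated by the telescoping differences \<open>1 / R\<^sub>k - 1 / R\<^sub>k\<^sub>+\<^sub>1\<close>, whereas the sum of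
  \<open>a\<^sub>k\<^sup>2 / R\<^sub>k\<^sub>+\<^sub>1\<close> from \<open>m\<close> to \<open>n\<close> is at least \<open>1 - R\<^sub>m / R\<^sub>n\<close>, which comes close to \<open>1\<close>.  The summand \<open>1\<close> in \<open>R\<close>
  only keeps it positive.\<close>

lemma square_summable_test:
  fixes a :: "nat \<Rightarrow> real"
  assumes "\<not> summable (\<lambda>k. (a k)\<^sup>2)"
  defines "R n \<equiv> 1 + (\<Sum>i<n. (a i)\<^sup>2)"
  shows "summable (\<lambda>k. (a k / R (Suc k))\<^sup>2)" "\<not> summable (\<lambda>k. (a k)\<^sup>2 / R (Suc k))"
proof -
  have R_pos: "R n \<ge> 1" for n by (simp add: R_def sum_nonneg)
  have R_Suc: "R (Suc n) = R n + (a n)\<^sup>2" for n by (simp add: R_def)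
  have "(\<Sum>k<n. (a k / R (Suc k))\<^sup>2) \<le> 1 - 1 / R n" for n
  proof (induction n)
    case (Suc n)
    have "(a n / R (Suc n))\<^sup>2 \<le> (a n)\<^sup>2 / (R n * R (Suc n))"
      unfolding power_divide power2_eq_square[of "R (Suc n)"]
      using R_pos[of n] R_pos[of "Suc n"] by (intro divide_left_mono mult_right_mono) (auto simp: R_Suc)
    also have "\<dots> = 1 / R n - 1 / R (Suc n)"
      using R_pos[of n] R_pos[of "Suc n"] by (simp add: R_Suc field_simps)
    finally show ?case using Suc by simp
  qed (simp add: R_def)
  then have "(\<Sum>k<n. (a k / R (Suc k))\<^sup>2) \<le> 1" for n
    by (rule order_trans) (use R_pos[of n] in simp)
  from this[of "Suc _"] show "summable (\<lambda>k. (a k / R (Suc k))\<^sup>2)"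
    unfolding lessThan_Suc_atMost by (intro bounded_imp_summable[where B = 1]) auto
  show "\<not> summable (\<lambda>k. (a k)\<^sup>2 / R (Suc k))"
  proof
    assume "summable (\<lambda>k. (a k)\<^sup>2 / R (Suc k))"
    then obtain m where m: "\<And>n. norm (\<Sum>k=m..<n. (a k)\<^sup>2 / R (Suc k)) < 1/2"
      unfolding summable_Cauchy by (metis half_gt_zero_iff order_refl zero_less_one)
    have mono: "R k \<le> R n" if "k \<le> n" for k n
      unfolding R_def using that by (intro add_left_mono sum_mono2) auto
    have sum_R: "(\<Sum>k=m..<n. (a k)\<^sup>2) = R n - R m" if "m \<le> n" for n
      using that by (induction n rule: dec_induct) (auto simp: R_Suc)
    have bound: "R n \<le> 2 * R m" for n
    proof (cases "m \<le> n")
      case True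
      have "(R n - R m) / R n = (\<Sum>k=m..<n. (a k)\<^sup>2 / R n)"
        by (simp add: sum_R[OF True] flip: sum_divide_distrib)
      also have "\<dots> \<le> (\<Sum>k=m..<n. (a k)\<^sup>2 / R (Suc k))"
      proof (intro sum_mono divide_left_mono)
        fix k assume "k \<in> {m..<n}"
        then show "R (Suc k) \<le> R n" by (intro mono) simp
        show "0 < R n * R (Suc k)" using R_pos[of n] R_pos[of "Suc k"] by simp
      qed simp
      also have "\<dots> \<le> 1/2" using m[of n] by simp
      finally show ?thesis using R_pos[of n] by (simp add: field_simps)
    next
      case False
      then show ?thesis using mono[of n m] R_pos[of m] by simp
    qed
    have "(\<Sum>k<n. (a k)\<^sup>2) \<le> 2 * R m - 1" for n using bound[of n] by (simp add: R_def[of n])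
    from this[of "Suc _"] have "summable (\<lambda>k. (a k)\<^sup>2)"
      unfolding lessThan_Suc_atMost by (intro bounded_imp_summable[where B = "2 * R m - 1"]) auto
    then show False using assms(1) by blast
  qed
qed

section \<open>Hilbert spaces\<close>

context hilbert_space
begin

lemma norm_ip_commute: "norm (ip y x) = norm (ip x y)"
  using ip_commute[of y x] by (metis complex_mod_cnj norm_to_complex)

lemma ip_scaleR_left: "ip (r *\<^sub>R x) y = r *\<^sub>R ip x y"
  unfolding scale_of_real[symmetric] ip_scale_left by (simp add: scaleR_conv_of_real)

lemma ip_zero_left: "ip 0 y = 0"
  using ip_scaleR_left[of 0 0 y] by simp

lemma ip_minus_left: "ip (- x) y = - ip x y"
  using ip_scaleR_left[of "-1" x y] by simp

lemma ip_diff_left: "ip (x - y) z = ip x z - ip y z"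
  using ip_add_left[of x "- y" z] by (simp add: ip_minus_left)

lemma ip_sum_left: "ip (\<Sum>i\<in>A. g i) y = (\<Sum>i\<in>A. ip (g i) y)"
  by (induction A rule: infinite_finite_induct) (auto simp: ip_zero_left ip_add_left)

lemma norm_smul: "norm (smul a x) = norm a * norm x"
proof -
  have "norm (ip (smul a x) (smul a x)) = norm a * norm (ip (smul a x) x)"
    by (simp add: ip_scale_left norm_mult norm_ip_commute[of x "smul a x"])
  also have "\<dots> = (norm a)\<^sup>2 * norm (ip x x)"
    by (simp add: ip_scale_left norm_mult power2_eq_square)
  finally have "(norm (smul a x))\<^sup>2 = (norm a * norm x)\<^sup>2"
    by (simp add: ip_self power_mult_distrib norm_power)
  then show ?thesis by (simp add: power2_eq_iff_nonneg)
qed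

lemma norm_add_square:
  "(norm (x + y))\<^sup>2 = (norm x)\<^sup>2 + (norm y)\<^sup>2 + 2 * Re (to_complex (ip x y))"
proof -
  have right: "to_complex (ip x (y + z)) = to_complex (ip x y) + to_complex (ip x z)" for x y z
  proof -
    have "to_complex (ip x (y + z)) = cnj (to_complex (ip (y + z) x))" by (rule ip_commute)
    also have "\<dots> = cnj (to_complex (ip y x)) + cnj (to_complex (ip z x))"
      by (simp add: ip_add_left to_complex_add)
    finally show ?thesis by (simp only: ip_commute[of x y] ip_commute[of x z])
  qed
  have "to_complex (ip (x + y) (x + y)) = to_complex (ip x x) + to_complex (ip y y)
      + (to_complex (ip x y) + cnj (to_complex (ip x y)))"
    by (simp add: ip_add_left to_complex_add right ip_commute[of y x])
  then show ?thesis
    unfolding ip_self to_complex_of_real by (simp add: complex_eq_iff)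
qed

text \<open>Pythagoras for the component of \<open>x\<close> along \<open>y\<close> and its orthogonal remainder.\<close>

lemma Cauchy_Schwarz: "norm (ip x y) \<le> norm x * norm y"
proof (cases "y = 0")
  case True
  then show ?thesis using norm_ip_commute[of x 0] by (simp add: ip_zero_left)
next
  case False
  define a where "a = ip x y / of_real ((norm y)\<^sup>2)"
  have "ip (x - smul a y) y = 0"
    using False by (simp add: ip_diff_left ip_scale_left ip_self a_def)
  then have "norm (ip (smul a y) (x - smul a y)) = 0"
    using norm_ip_commute[of "x - smul a y" y] by (simp add: ip_scale_left)
  then have "norm (ip (x - smul a y) (smul a y)) = 0"
    using norm_ip_commute[of "x - smul a y" "smul a y"] by simp
  then have "(norm x)\<^sup>2 = (norm (x - smul a y))\<^sup>2 + (norm (smul a y))\<^sup>2"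
    using norm_add_square[of "x - smul a y" "smul a y"] by (simp add: to_complex_0)
  then have "norm (smul a y) \<le> norm x"
    by (simp add: power2_le_imp_le)
  moreover have "norm a = norm (ip x y) / (norm y)\<^sup>2"
    unfolding a_def norm_divide norm_of_real by simp
  ultimately show ?thesis
    using False by (simp add: norm_smul power2_eq_square field_simps)
qed

lemma bounded_linear_ip_left: "bounded_linear (\<lambda>x. ip x y)"
  by (rule bounded_linear_intro[where K = "norm y"])
    (auto simp: ip_add_left ip_scaleR_left Cauchy_Schwarz)

lemma seminorm_ip:
  "continuous_on UNIV (\<lambda>x. norm (ip x v))" "norm (ip (x + y) v) \<le> norm (ip x v) + norm (ip y v)"
  "norm (ip (- x) v) = norm (ip x v)" "norm (ip (r *\<^sub>R x) v) = \<bar>r\<bar> * norm (ip x v)"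
  by (intro continuous_on_norm linear_continuous_on bounded_linear_ip_left)
    (auto simp: ip_add_left ip_minus_left ip_scaleR_left norm_triangle_ineq)

subsection \<open>Synthesis for a frame\<close>

text \<open>Duality: test the combination \<open>y\<close> against itself, \<open>\<parallel>y\<parallel>\<^sup>2 = \<Sum> c\<^sub>k \<langle>f\<^sub>k, y\<rangle>\<close>, and apply the Cauchy-Schwarz
  inequality for sums and the Bessel inequality for \<open>y\<close>.\<close>

lemma norm_combination_le:
  assumes "0 \<le> B" and bessel: "\<And>x. (\<Sum>k\<in>F. (norm (ip x (f k)))\<^sup>2) \<le> B * (norm x)\<^sup>2"
  shows "norm (\<Sum>k\<in>F. smul (c k) (f k)) \<le> sqrt B * L2_set (\<lambda>k. norm (c k)) F"
proof -
  define y where "y = (\<Sum>k\<in>F. smul (c k) (f k))"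
  have "(norm y)\<^sup>2 = norm (ip y y)" by (simp add: ip_self norm_power)
  also have "\<dots> = norm (\<Sum>k\<in>F. c k * ip (f k) y)"
    by (subst (1) y_def) (simp add: ip_sum_left ip_scale_left)
  also have "\<dots> \<le> (\<Sum>k\<in>F. \<bar>norm (c k)\<bar> * \<bar>norm (ip y (f k))\<bar>)"
    by (rule order_trans[OF norm_sum]) (simp add: norm_mult norm_ip_commute[of y "f _"])
  also have "\<dots> \<le> L2_set (\<lambda>k. norm (c k)) F * L2_set (\<lambda>k. norm (ip y (f k))) F"
    by (rule L2_set_mult_ineq)
  also have "\<dots> \<le> L2_set (\<lambda>k. norm (c k)) F * (sqrt B * norm y)"
  proof (intro mult_left_mono)
    show "L2_set (\<lambda>k. norm (ip y (f k))) F \<le> sqrt B * norm y"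
      using real_sqrt_le_mono[OF bessel[of y]] by (simp add: L2_set_def real_sqrt_mult)
  qed simp
  finally have *: "norm y * norm y \<le> (sqrt B * L2_set (\<lambda>k. norm (c k)) F) * norm y"
    by (simp add: power2_eq_square mult_ac)
  show ?thesis
  proof (cases "y = 0")
    case True
    then show ?thesis using assms(1) by (simp flip: y_def)
  next
    case False
    then show ?thesis using * unfolding y_def by (simp add: mult_le_cancel_right)
  qed
qed

end

section \<open>Square-summable sequences\<close>

lemma summable_coord: "summable (\<lambda>i. (norm (coord c i))\<^sup>2)"
  using coord[of c] by simp

lemma L2_set_coord_le: "finite F \<Longrightarrow> L2_set (\<lambda>i. norm (coord c i)) F \<le> norm c"
  unfolding L2_set_def norm_ell2.rep_eq
  by (intro real_sqrt_le_mono sum_le_suminf summable_coord) auto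

lemma vector_space_ell2: "vector_space ell2_scale"
  by unfold_locales (transfer, simp add: algebra_simps)+

lemma bounded_linear_Re_to_complex: "bounded_linear (\<lambda>a :: 'k::real_or_complex. Re (to_complex a))"
  by (rule bounded_linear_intro[where K = 1])
    (auto simp: to_complex_add to_complex_scaleR abs_Re_le_cmod simp flip: norm_to_complex[where 'a = 'k])

section \<open>Frames and synthesis\<close>

context hilbert_space
begin

lemma bounded_linear_smul: "bounded_linear (smul a)"
proof (rule bounded_linear_intro[where K = "norm a"])
  show "smul a (r *\<^sub>R x) = r *\<^sub>R smul a x" for r x
    unfolding scale_of_real[symmetric] by (rule scale_left_commute)
qed (auto simp: scale_right_distrib norm_smul mult.commute)

lemma summable_synthesis:
  assumes "0 \<le> B" and bessel: "\<And>F x. finite F \<Longrightarrow> (\<Sum>k\<in>F. (norm (ip x (f k)))\<^sup>2) \<le> B * (norm x)\<^sup>2"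
  shows "summable (\<lambda>k. smul (coord c k) (f k))"
  unfolding summable_Cauchy
proof (intro allI impI)
  fix e :: real assume e: "e > 0"
  define d where "d = e / (sqrt B + 1)"
  have sB: "sqrt B \<ge> 0" using assms(1) by simp
  then have d: "d > 0" using e by (simp add: d_def add_nonneg_pos)
  then obtain N where N: "\<And>m n. m \<ge> N \<Longrightarrow> norm (\<Sum>k=m..<n. (norm (coord c k))\<^sup>2) < d\<^sup>2"
    using summable_coord[of c] unfolding summable_Cauchy by (meson zero_less_power)
  have "norm (\<Sum>k=m..<n. smul (coord c k) (f k)) < e" if "m \<ge> N" for m n
  proof -
    have "L2_set (\<lambda>k. norm (coord c k)) {m..<n} < d"
      unfolding L2_set_def using N[OF that, of n] d by (intro real_less_lsqrt) (auto intro: sum_nonneg)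
    then have "sqrt B * L2_set (\<lambda>k. norm (coord c k)) {m..<n} \<le> sqrt B * d"
      using sB by (intro mult_left_mono) auto
    also have "\<dots> < (sqrt B + 1) * d" using d by simp
    also have "sqrt B + 1 \<noteq> 0" using sB by linarith
    then have "(sqrt B + 1) * d = e" by (simp add: d_def)
    finally show ?thesis
      using norm_combination_le[of B f "{m..<n}" "coord c"] assms by force
  qed
  then show "\<exists>N. \<forall>m\<ge>N. \<forall>n. norm (\<Sum>k=m..<n. smul (coord c k) (f k)) < e" by blast
qed

lemma norm_synthesis_le:
  assumes "0 \<le> B" and bessel: "\<And>F x. finite F \<Longrightarrow> (\<Sum>k\<in>F. (norm (ip x (f k)))\<^sup>2) \<le> B * (norm x)\<^sup>2"
  shows "norm (synthesis smul f c) \<le> sqrt B * norm c"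
  unfolding synthesis_def
proof (rule LIMSEQ_le_const2[OF tendsto_norm[OF summable_LIMSEQ[OF summable_synthesis[OF assms]]]])
  have "norm (\<Sum>k<n. smul (coord c k) (f k)) \<le> sqrt B * norm c" for n
    using norm_combination_le[of B f "{..<n}" "coord c"] assms L2_set_coord_le[of "{..<n}" c]
    by (intro order_trans[OF norm_combination_le mult_left_mono]) auto
  then show "\<exists>N. \<forall>n\<ge>N. norm (\<Sum>k<n. smul (coord c k) (f k)) \<le> sqrt B * norm c" by blast
qed

lemma linear_synthesis:
  assumes "\<And>c :: 'k ell2. summable (\<lambda>k. smul (coord c k) (f k))"
  shows "Vector_Spaces.linear ell2_scale smul (synthesis smul f)"
  unfolding Vector_Spaces.linear_iff
proof (intro conjI allI)
  show "vector_space ell2_scale" by (rule vector_space_ell2)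
  show "vector_space smul" by (rule vector_space_axioms)
  show "synthesis smul f (c + d) = synthesis smul f c + synthesis smul f d" for c d
    unfolding synthesis_def plus_ell2.rep_eq scale_left_distrib
    by (intro suminf_add[symmetric] assms)
  show "synthesis smul f (ell2_scale a c) = smul a (synthesis smul f c)" for a c
    unfolding synthesis_def ell2_scale.rep_eq bounded_linear.suminf[OF bounded_linear_smul assms]
    by simp
qed

lemma synthesis_unit: "synthesis smul f (ell2_unit n) = f n"
proof -
  have "synthesis smul f (ell2_unit n) = (\<Sum>k. if k = n then f k else 0)"
    unfolding synthesis_def ell2_unit.rep_eq by (intro suminf_cong) auto
  also have "\<dots> = f n" using sums_single[of n f] by (rule sums_unique[symmetric])
  finally show ?thesis .
qed

lemma ip_synthesis:
  assumes "summable (\<lambda>k. smul (coord c k) (f k))"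
  shows "summable (\<lambda>k. coord c k * ip (f k) v)" "ip (synthesis smul f c) v = (\<Sum>k. coord c k * ip (f k) v)"
  using bounded_linear.summable[OF bounded_linear_ip_left assms, of v]
    bounded_linear.suminf[OF bounded_linear_ip_left assms, of v]
  by (simp_all add: synthesis_def ip_scale_left)

lemma Re_ip_mult: "Re (to_complex (ip x y * ip y x)) = (norm (ip x y))\<^sup>2"
  unfolding to_complex_mult ip_commute[of y x] complex_norm_square[symmetric] norm_to_complex by simp

lemma frame_bessel:
  assumes "frame ip f"
  obtains A B where "0 < A" "0 < B" "\<And>x. summable (\<lambda>k. (norm (ip x (f k)))\<^sup>2)"
    "\<And>x. A * (norm x)\<^sup>2 \<le> (\<Sum>k. (norm (ip x (f k)))\<^sup>2)"
    "\<And>x. (\<Sum>k. (norm (ip x (f k)))\<^sup>2) \<le> B * (norm x)\<^sup>2"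
    "\<And>F x. finite F \<Longrightarrow> (\<Sum>k\<in>F. (norm (ip x (f k)))\<^sup>2) \<le> B * (norm x)\<^sup>2"
proof -
  obtain A B where *: "0 < A" "0 < B" "\<And>x. summable (\<lambda>k. (norm (ip x (f k)))\<^sup>2)"
    "\<And>x. A * (norm x)\<^sup>2 \<le> (\<Sum>k. (norm (ip x (f k)))\<^sup>2)"
    "\<And>x. (\<Sum>k. (norm (ip x (f k)))\<^sup>2) \<le> B * (norm x)\<^sup>2"
    using assms unfolding frame_def by blast
  have "(\<Sum>k\<in>F. (norm (ip x (f k)))\<^sup>2) \<le> B * (norm x)\<^sup>2" if "finite F" for F x
    using sum_le_suminf[OF *(3) that, of x] *(5)[of x] by (simp add: order_trans)
  then show ?thesis using * that by blast
qed

lemma frame_summable: "frame ip f \<Longrightarrow> summable (\<lambda>k. smul (coord c k) (f k))"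
  by (rule frame_bessel) (auto intro: summable_synthesis less_imp_le)

lemma frame_synthesis_bounded:
  assumes "frame ip f"
  obtains C where "\<And>c. norm (synthesis smul f c) \<le> C * norm c"
  using assms by (rule frame_bessel) (metis norm_synthesis_le less_imp_le)

text \<open>For the frame operator \<open>S\<close> one has \<open>\<parallel>x - t S x\<parallel>\<^sup>2 \<le> (1 - 2 t A + t\<^sup>2 B\<^sup>2) \<parallel>x\<parallel>\<^sup>2\<close>.  The choice \<open>t = A / B\<^sup>2\<close>
  minimises the factor to \<open>1 - A\<^sup>2 / B\<^sup>2 < 1\<close>.  A fixed point of \<open>x \<mapsto> x - t (S x - y)\<close>
  solves \<open>S x = y\<close>.\<close>

lemma frame_surj:
  assumes "frame ip f"
  shows "surj (synthesis smul f)"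
proof -
  obtain A B where A: "0 < A" and B: "0 < B" and summ: "\<And>x. summable (\<lambda>k. (norm (ip x (f k)))\<^sup>2)"
    and lower: "\<And>x. A * (norm x)\<^sup>2 \<le> (\<Sum>k. (norm (ip x (f k)))\<^sup>2)"
    and upper: "\<And>x. (\<Sum>k. (norm (ip x (f k)))\<^sup>2) \<le> B * (norm x)\<^sup>2"
    and bessel: "\<And>F x. finite F \<Longrightarrow> (\<Sum>k\<in>F. (norm (ip x (f k)))\<^sup>2) \<le> B * (norm x)\<^sup>2"
    using assms by (rule frame_bessel) (rule that)
  define analysis where "analysis x = Abs_ell2 (\<lambda>k. ip x (f k))" for x
  define S where "S x = synthesis smul f (analysis x)" for x
  have coord_analysis: "coord (analysis x) = (\<lambda>k. ip x (f k))" for x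
    unfolding analysis_def using summ by (simp add: Abs_ell2_inverse)
  have lin: "Vector_Spaces.linear ell2_scale smul (synthesis smul f)"
    by (intro linear_synthesis frame_summable assms)
  have S_diff: "S x - S y = S (x - y)" for x y
  proof -
    have "analysis (x - y) = analysis x - analysis y"
      unfolding coord_inject[symmetric] minus_ell2.rep_eq coord_analysis by (simp add: ip_diff_left)
    then show ?thesis
      unfolding S_def by (simp add: module_hom.diff[OF lin[unfolded Vector_Spaces.linear_def, THEN conjunct2, THEN conjunct2]])
  qed
  have S_norm: "norm (S x) \<le> B * norm x" for x
  proof -
    have "norm (analysis x) \<le> sqrt (B * (norm x)\<^sup>2)"
      unfolding norm_ell2.rep_eq coord_analysis by (rule real_sqrt_le_mono[OF upper])
    then have "norm (S x) \<le> sqrt B * (sqrt B * norm x)"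
      unfolding S_def using B
      by (intro order_trans[OF norm_synthesis_le[OF _ bessel] mult_left_mono]) (auto simp: real_sqrt_mult)
    then show ?thesis using B by (simp flip: mult.assoc)
  qed
  have S_lower: "A * (norm x)\<^sup>2 \<le> Re (to_complex (ip (S x) x))" for x
  proof -
    note ips = ip_synthesis[OF frame_summable[OF assms, of "analysis x"], of x]
    have "Re (to_complex (ip (S x) x)) = (\<Sum>k. Re (to_complex (ip x (f k) * ip (f k) x)))"
      unfolding S_def ips(2) using bounded_linear.suminf[OF bounded_linear_Re_to_complex ips(1)]
      by (simp add: coord_analysis)
    then show ?thesis using lower[of x] by (simp add: Re_ip_mult)
  qed
  define t where "t = A / B\<^sup>2"
  \<comment> \<open>On the zero space \<open>A\<close> may exceed \<open>B\<close>; the maximum covers this case.\<close>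
  define c where "c = sqrt (max 0 (1 - A\<^sup>2 / B\<^sup>2))"
  have t: "t > 0" using A B by (simp add: t_def)
  have c: "0 \<le> c" "c < 1" using A B by (auto simp: c_def)
  have contract: "norm (x - t *\<^sub>R S x) \<le> c * norm x" for x
  proof -
    have "(norm (- (t *\<^sub>R S x) + x))\<^sup>2 = t\<^sup>2 * (norm (S x))\<^sup>2 + (norm x)\<^sup>2 - 2 * t * Re (to_complex (ip (S x) x))"
      unfolding norm_add_square
      by (simp add: ip_minus_left ip_scaleR_left to_complex_minus to_complex_scaleR power_mult_distrib)
    also have "\<dots> \<le> t\<^sup>2 * (B * norm x)\<^sup>2 + (norm x)\<^sup>2 - 2 * t * (A * (norm x)\<^sup>2)"
      using t S_norm[of x] S_lower[of x] by (intro diff_mono add_mono mult_left_mono power_mono) auto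
    also have "\<dots> = (1 - A\<^sup>2 / B\<^sup>2) * (norm x)\<^sup>2"
      using B by (simp add: t_def power2_eq_square field_simps)
    also have "\<dots> \<le> (c * norm x)\<^sup>2"
      unfolding power_mult_distrib c_def by (intro mult_right_mono) auto
    finally have "norm (- (t *\<^sub>R S x) + x) \<le> c * norm x"
      by (rule power2_le_imp_le) (simp add: c(1))
    then show ?thesis by simp
  qed
  have "\<exists>x. S x = y" for y
  proof -
    have "dist (x - t *\<^sub>R (S x - y)) (z - t *\<^sub>R (S z - y)) \<le> c * dist x z" for x z
    proof -
      have eq: "(x - t *\<^sub>R (S x - y)) - (z - t *\<^sub>R (S z - y)) = (x - z) - t *\<^sub>R (S x - S z)"
        by (simp add: algebra_simps)
      show ?thesis unfolding dist_norm eq S_diff by (rule contract)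
    qed
    then have "\<exists>!x. x - t *\<^sub>R (S x - y) = x" by (intro banach_fix_type[OF c]) blast
    then show ?thesis using t by auto
  qed
  then show ?thesis unfolding S_def surj_def by metis
qed

text \<open>Landau's theorem: if the sequence of the numbers \<open>\<langle>x, f\<^sub>k\<rangle>\<close> were not square summable, the divergence test would
  provide square-summable multiples \<open>c\<^sub>k\<close> of them for which \<open>\<langle>\<Sum> c\<^sub>k f\<^sub>k, x\<rangle>\<close> diverges.\<close>

lemma synthesis_analysis_summable:
  assumes "\<And>c :: 'k ell2. summable (\<lambda>k. smul (coord c k) (f k))"
  shows "summable (\<lambda>k. (norm (ip x (f k)))\<^sup>2)"
proof (rule ccontr)
  define R where "R n = 1 + (\<Sum>i<n. (norm (ip x (f i)))\<^sup>2)" for n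
  assume "\<not> summable (\<lambda>k. (norm (ip x (f k)))\<^sup>2)"
  note test = square_summable_test[OF this, folded R_def]
  have R: "R n \<ge> 1" for n by (simp add: R_def sum_nonneg)
  define c where "c = Abs_ell2 (\<lambda>k. inverse (R (Suc k)) *\<^sub>R ip x (f k))"
  have "norm (inverse (R (Suc k)) *\<^sub>R ip x (f k)) = norm (ip x (f k)) / R (Suc k)" for k
    using R[of "Suc k"] by (simp add: divide_inverse mult.commute)
  then have c: "coord c = (\<lambda>k. inverse (R (Suc k)) *\<^sub>R ip x (f k))"
    unfolding c_def using test(1) by (simp add: Abs_ell2_inverse)
  have "summable (\<lambda>k. Re (to_complex (coord c k * ip (f k) x)))"
    by (rule bounded_linear.summable[OF bounded_linear_Re_to_complex ip_synthesis(1)[OF assms]])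
  moreover have "Re (to_complex (coord c k * ip (f k) x)) = (norm (ip x (f k)))\<^sup>2 / R (Suc k)" for k
    unfolding c mult_scaleR_left to_complex_scaleR using Re_ip_mult[of x "f k"]
    by (simp add: divide_inverse mult.commute)
  ultimately show False using test(2) by simp
qed

text \<open>Two applications of uniform boundedness.  The finite parts of analysis are pointwise bounded
  because the coefficients are square summable, whence the upper inequality.  For the lower one let \<open>V\<close> be
  the set of all \<open>v\<close> with \<open>\<Sum> |\<langle>v, f\<^sub>k\<rangle>|\<^sup>2 \<le> 1\<close>.  As \<open>|\<langle>T c, v\<rangle>| \<le> \<parallel>c\<parallel>\<close> for \<open>v \<in> V\<close> and synthesis \<open>T\<close> is onto, the
  functionals \<open>\<langle>\<cdot>, v\<rangle>\<close> are pointwise, hence uniformly bounded; so \<open>V\<close> is bounded, and scaling gives the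
  inequality.\<close>

lemma surj_synthesis_frame:
  assumes summ: "\<And>c :: 'k ell2. summable (\<lambda>k. smul (coord c k) (f k))"
    and surj: "surj (synthesis smul f)"
  shows "frame ip f"
proof -
  note an = synthesis_analysis_summable[OF summ]
  define q where "q x = (\<Sum>k. (norm (ip x (f k)))\<^sup>2)" for x
  have q_nonneg: "q x \<ge> 0" for x unfolding q_def by (intro suminf_nonneg an) simp
  have partial: "L2_set (\<lambda>k. norm (ip x (f k))) {..<n} \<le> sqrt (q x)" for x n
    unfolding L2_set_def q_def by (intro real_sqrt_le_mono sum_le_suminf an) auto
  obtain C where C: "0 < C" "\<And>n x. L2_set (\<lambda>k. norm (ip x (f k))) {..<n} \<le> C * norm x"
  proof (rule uniform_boundedness[of UNIV "\<lambda>n x. L2_set (\<lambda>k. norm (ip x (f k))) {..<n}"])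
    fix n x y and r :: real
    show "continuous_on UNIV (\<lambda>x. L2_set (\<lambda>k. norm (ip x (f k))) {..<n})"
      unfolding L2_set_def by (intro continuous_intros seminorm_ip(1))
    show "L2_set (\<lambda>k. norm (ip (x + y) (f k))) {..<n}
        \<le> L2_set (\<lambda>k. norm (ip x (f k))) {..<n} + L2_set (\<lambda>k. norm (ip y (f k))) {..<n}"
      by (rule order_trans[OF L2_set_mono L2_set_triangle_ineq]) (auto simp: seminorm_ip(2))
    show "L2_set (\<lambda>k. norm (ip (r *\<^sub>R x) (f k))) {..<n} = \<bar>r\<bar> * L2_set (\<lambda>k. norm (ip x (f k))) {..<n}"
      by (simp add: seminorm_ip(4) L2_set_right_distrib)
  qed (use partial seminorm_ip(3) that in auto)
  have upper: "q x \<le> C\<^sup>2 * (norm x)\<^sup>2" for x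
    unfolding q_def
  proof (rule suminf_le_const[OF an])
    fix n
    have "(L2_set (\<lambda>k. norm (ip x (f k))) {..<n})\<^sup>2 \<le> (C * norm x)\<^sup>2"
      by (intro power_mono C L2_set_nonneg)
    then show "(\<Sum>k<n. (norm (ip x (f k)))\<^sup>2) \<le> C\<^sup>2 * (norm x)\<^sup>2"
      by (simp add: L2_set_def sum_nonneg power_mult_distrib)
  qed

  define V where "V = {v. q v \<le> 1}"
  have V_le: "norm (ip (synthesis smul f c) v) \<le> norm c" if "v \<in> V" for c v
    unfolding ip_synthesis(2)[OF summ]
  proof (rule LIMSEQ_le_const2[OF tendsto_norm[OF summable_LIMSEQ[OF ip_synthesis(1)[OF summ]]]])
    have "norm (\<Sum>k<n. coord c k * ip (f k) v) \<le> norm c" for n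
    proof -
      have "norm (\<Sum>k<n. coord c k * ip (f k) v) \<le> (\<Sum>k<n. \<bar>norm (coord c k)\<bar> * \<bar>norm (ip v (f k))\<bar>)"
        by (rule order_trans[OF norm_sum]) (simp add: norm_mult norm_ip_commute[of v "f _"])
      also have "\<dots> \<le> L2_set (\<lambda>k. norm (coord c k)) {..<n} * L2_set (\<lambda>k. norm (ip v (f k))) {..<n}"
        by (rule L2_set_mult_ineq)
      also have "\<dots> \<le> norm c * 1"
      proof (intro mult_mono L2_set_coord_le)
        have "sqrt (q v) \<le> 1" using that by (simp add: V_def)
        then show "L2_set (\<lambda>k. norm (ip v (f k))) {..<n} \<le> 1" using partial[of v n] by linarith
      qed auto
      finally show ?thesis by simp
    qed
    then show "\<exists>N. \<forall>n\<ge>N. norm (\<Sum>k<n. coord c k * ip (f k) v) \<le> norm c" by blast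
  qed
  obtain D where D: "0 < D" "\<And>v x. v \<in> V \<Longrightarrow> norm (ip x v) \<le> D * norm x"
  proof (rule uniform_boundedness[of V "\<lambda>v x. norm (ip x v)"])
    fix x
    obtain c where "x = synthesis smul f c" using surj by (metis surjD)
    then show "\<exists>b. \<forall>v\<in>V. norm (ip x v) \<le> b" using V_le by blast
  qed (use seminorm_ip that in auto)
  have V_norm: "norm v \<le> D" if "v \<in> V" for v
  proof -
    have "norm v * norm v \<le> D * norm v"
      using D(2)[OF that, of v] unfolding ip_self norm_of_real by (simp add: power2_eq_square)
    then show ?thesis using D(1) by (cases "v = 0") (auto simp: mult_le_cancel_right)
  qed
  have q_scale: "q (r *\<^sub>R x) = r\<^sup>2 * q x" for r x
    unfolding q_def by (simp add: seminorm_ip(4) power_mult_distrib suminf_mult an)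
  have lower: "(norm x)\<^sup>2 \<le> D\<^sup>2 * q x" for x
  proof (cases "q x = 0")
    case True
    have "norm x = 0"
    proof (rule ccontr)
      assume x: "norm x \<noteq> 0"
      define r where "r = (D + 1) / norm x"
      have "r *\<^sub>R x \<in> V" by (simp add: V_def q_scale True)
      then have "norm (r *\<^sub>R x) \<le> D" by (rule V_norm)
      then show False using x D(1) by (simp add: r_def)
    qed
    then show ?thesis using True by simp
  next
    case False
    define r where "r = 1 / sqrt (q x)"
    have "q x > 0" using False q_nonneg[of x] by simp
    then have "r *\<^sub>R x \<in> V" by (simp add: V_def q_scale r_def power_divide)
    then have "norm (r *\<^sub>R x) \<le> D" by (rule V_norm)
    then have "norm x \<le> D * sqrt (q x)" using \<open>q x > 0\<close> by (simp add: r_def field_simps)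
    then have "(norm x)\<^sup>2 \<le> (D * sqrt (q x))\<^sup>2" by (intro power_mono) auto
    then show ?thesis using \<open>q x > 0\<close> by (simp add: power_mult_distrib)
  qed
  have "1 / D\<^sup>2 * (norm x)\<^sup>2 \<le> q x" for x
    using lower[of x] D(1) by (simp add: field_simps)
  then show ?thesis
    unfolding frame_def using C(1) D(1) upper an
    by (intro exI[of _ "1 / D\<^sup>2"] conjI exI[of _ "C\<^sup>2"]) (auto simp: q_def)
qed

end

section \<open>Names and machines\<close>

lemma computable_machine:
  assumes "computable \<delta> \<delta>' f"
  obtains M where "wf_machine M"
    "\<And>p x y. \<delta> p = Some x \<Longrightarrow> f x = Some y \<Longrightarrow> \<exists>r. transforms M p r \<and> \<delta>' r = Some y"
proof -
  obtain F where F: "tm_computable F" "\<And>p. p \<in> dom (f \<circ>\<^sub>m \<delta>) \<Longrightarrow> (\<delta>' \<circ>\<^sub>m F) p = (f \<circ>\<^sub>m \<delta>) p"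
    using assms unfolding computable_def by blast
  obtain M where M: "wf_machine M" "\<And>p r. F p = Some r \<Longrightarrow> transforms M p r"
    using F(1) unfolding tm_computable_def by blast
  have "\<exists>r. transforms M p r \<and> \<delta>' r = Some y" if "\<delta> p = Some x" "f x = Some y" for p x y
    using F(2)[of p] M(2)[of p] that by (cases "F p") (auto simp: map_comp_def dom_def)
  then show ?thesis using M(1) that by blast
qed

lemma computableI:
  assumes "tm_computable F"
    and "\<And>p x y. \<delta> p = Some x \<Longrightarrow> f x = Some y \<Longrightarrow> \<exists>r. F p = Some r \<and> \<delta>' r = Some y"
  shows "computable \<delta> \<delta>' f"
  unfolding computable_def
proof (intro exI[of _ F] conjI ballI assms(1))
  fix p assume "p \<in> dom (f \<circ>\<^sub>m \<delta>)"
  then obtain x y where "\<delta> p = Some x" "f x = Some y" by (auto simp: map_comp_def split: option.splits)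
  then show "(\<delta>' \<circ>\<^sub>m F) p = (f \<circ>\<^sub>m \<delta>) p" using assms(2)[of p x y] by auto
qed

lemma cauchy_name_dist:
  assumes "cauchy_name \<alpha> (encode_seq ns :: 's::zero_neq_one stream) x"
  shows "dist (\<alpha> (ns !! i)) x \<le> (1/2) ^ i"
proof -
  have *: "\<And>j. i < j \<Longrightarrow> dist (\<alpha> (ns !! i)) (\<alpha> (ns !! j)) < (1/2) ^ i" "(\<lambda>i. \<alpha> (ns !! i)) \<longlonglongrightarrow> x"
    using assms unfolding cauchy_name_def encode_seq_inject by auto
  have "(\<lambda>j. dist (\<alpha> (ns !! i)) (\<alpha> (ns !! j))) \<longlonglongrightarrow> dist (\<alpha> (ns !! i)) x"
    by (intro tendsto_intros *)
  then show ?thesis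
    by (rule LIMSEQ_le_const2) (meson *(1) Suc_le_lessD less_imp_le)
qed

text \<open>A name requires the strict bound \<open>2\<^sup>-\<^sup>i\<close> for the distance between two approximations; with the error
  \<open>2\<^sup>-\<^sup>i\<^sup>-\<^sup>2\<close> for each of them it is met with room to spare.\<close>

lemma cauchy_nameI:
  assumes "\<And>i. dist (\<alpha> (ns !! i)) x \<le> (1/2) ^ (i + 2)"
  shows "cauchy_name \<alpha> (encode_seq ns) x"
  unfolding cauchy_name_def
proof (intro exI[of _ ns] conjI allI impI refl)
  fix i j :: nat assume "i < j"
  have "dist (\<alpha> (ns !! i)) (\<alpha> (ns !! j)) \<le> (1/2) ^ (i + 2) + (1/2) ^ (j + 2)"
    using assms[of i] assms[of j] dist_triangle2[of "\<alpha> (ns !! i)" "\<alpha> (ns !! j)" x] by linarith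
  also have "(1/2 :: real) ^ (j + 2) \<le> (1/2) ^ (i + 2)"
    using \<open>i < j\<close> by (intro power_decreasing) auto
  also have "(1/2 :: real) ^ (i + 2) + (1/2) ^ (i + 2) < (1/2) ^ i" by simp
  finally show "dist (\<alpha> (ns !! i)) (\<alpha> (ns !! j)) < (1/2) ^ i" by simp
next
  have "(\<lambda>i. (1/2 :: real) ^ (i + 2)) \<longlonglongrightarrow> 0"
    by (intro LIMSEQ_ignore_initial_segment LIMSEQ_realpow_zero) auto
  then have "(\<lambda>i. dist (\<alpha> (ns !! i)) x) \<longlonglongrightarrow> 0"
  proof (rule Lim_null_comparison[rotated], intro always_eventually allI)
    show "norm (dist (\<alpha> (ns !! i)) x) \<le> (1/2) ^ (i + 2)" for i
      using assms[of i] by (simp only: real_norm_def abs_of_nonneg zero_le_dist)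
  qed
  then show "(\<lambda>i. \<alpha> (ns !! i)) \<longlonglongrightarrow> x" by (rule tendsto_dist_iff[THEN iffD2])
qed

lemma snth_sconst: "sconst c !! k = c"
  using snth_sset[of "sconst c" k] by (simp only: sset_sconst singleton_iff)

lemma encode_seq_sconst_snth:
  "(encode_seq (sconst c) :: 's::zero_neq_one stream) !! i = of_bool (i mod (c + 2) \<noteq> 0)"
proof -
  have len: "length (blocks k (sconst c) :: 's list) = k * (c + 2)" for k
    by (induction k) (simp, simp only: blocks_Suc snth_sconst length_append, simp add: block_def)
  have "i mod (c + 2) < c + 2" by simp
  then have "i mod (c + 2) \<le> Suc (sconst c !! (i div (c + 2)))" unfolding snth_sconst by simp
  from encode_seq_snth[OF this, where 's = 's] show ?thesis
    unfolding len div_mult_mod_eq by (cases "i mod (c + 2) = 0") simp_all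
qed

lemma recursive_mod:
  assumes "recursive f" "recursive g" shows "recursive (\<lambda>x. f x mod Suc (g x))"
proof -
  have "m mod Suc n = rec_nat 0 (\<lambda>_ r. if r = n then 0 else Suc r) m" for m n
    by (induction m) (auto simp: mod_Suc)
  then show ?thesis using assms
    by (simp only:) (intro rec_intros recursive_comp[OF assms(2)])
qed

lemma recursive_of_bool_not: "recursive (\<lambda>x. of_bool (P x)) \<Longrightarrow> recursive (\<lambda>x. of_bool (\<not> P x))"
proof -
  have "of_bool (\<not> b) = (1 :: nat) - of_bool b" for b by simp
  then show "recursive (\<lambda>x. of_bool (P x)) \<Longrightarrow> recursive (\<lambda>x. of_bool (\<not> P x))"
    by (simp only:) (intro rec_intros)
qed

section \<open>From computable synthesis to a computable sequence\<close>

text \<open>The unit vector \<open>n\<close> is itself coded, by a number \<open>u n\<close>, so the stream that repeats the block for \<open>u n\<close>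
  forever is a name of it.  Feeding this periodic stream to the machine for \<open>T\<close> yields a name of the
  image, which a second machine can produce from \<open>n\<close> by simulating the first.\<close>

lemma computable_synthesis_sequence:
  fixes smul :: "'k::real_or_complex \<Rightarrow> 'h::banach \<Rightarrow> 'h"
  assumes T: "computable_operator TYPE('s::{finite,zero_neq_one}) ell2_scale ell2_unit smul e T"
  shows "computable (nat_rep :: 's stream \<rightharpoonup> nat) (cauchy_rep (span_numbering smul e))
     (\<lambda>n. Some (T (ell2_unit n)))"
proof -
  define \<alpha> where "\<alpha> = span_numbering (ell2_scale :: 'k \<Rightarrow> _) ell2_unit"
  have "computable (cauchy_rep \<alpha> :: 's stream \<rightharpoonup> 'k ell2) (cauchy_rep (span_numbering smul e)) (Some \<circ> T)"
    using T unfolding computable_operator_def \<alpha>_def by blast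
  then obtain M :: "'s machine" where M: "wf_machine M"
    "\<And>p c y. cauchy_rep \<alpha> p = Some c \<Longrightarrow> (Some \<circ> T) c = Some y \<Longrightarrow>
      \<exists>r. transforms M p r \<and> cauchy_rep (span_numbering smul e) r = Some y"
    by (rule computable_machine) (rule that)
  obtain u where u: "recursive u" "\<And>n. \<alpha> (u n) = ell2_unit n"
    using unit_code vector_space_ell2 unfolding \<alpha>_def by metis
  define p :: "nat \<Rightarrow> 's stream" where "p n = encode_seq (sconst (u n))" for n
  have "cauchy_name \<alpha> (p n) (ell2_unit n)" for n
    unfolding p_def by (rule cauchy_nameI) (simp only: snth_sconst u, simp)
  then have "\<exists>r. transforms M (p n) r \<and> cauchy_name (span_numbering smul e) r (T (ell2_unit n))" for n
    using M(2)[of "p n" "ell2_unit n"] by (simp add: cauchy_rep_eq_Some)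
  then have "\<exists>ms. transforms M (p n) (encode_seq ms) \<and>
      cauchy_name (span_numbering smul e) (encode_seq ms :: 's stream) (T (ell2_unit n))" for n
    by (metis cauchy_name_def)
  then obtain ms where ms: "\<And>n. transforms M (p n) (encode_seq (ms n))"
    "\<And>n. cauchy_name (span_numbering smul e) (encode_seq (ms n) :: 's stream) (T (ell2_unit n))"
    by metis
  have "recursive (\<lambda>z. ms (pfst z) !! psnd z)"
  proof (rule recursive_machine_output[OF M(1)])
    show "p a !! i = of_bool (i mod Suc (u a + 1) \<noteq> 0)" for a i
      unfolding p_def by (simp add: encode_seq_sconst_snth)
    show "recursive (\<lambda>z. of_bool (psnd z mod Suc (u (pfst z) + 1) \<noteq> 0))"
      by (intro recursive_of_bool_not recursive_of_bool_eq recursive_mod rec_intros recursive_comp[OF u(1)])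
  qed (rule ms(1))
  then have rec: "recursive (\<lambda>z. ms (psnd z) !! pfst z)"
    by (rule recursive2[where F = "\<lambda>n i. ms n !! i"]) (intro rec_intros)+
  define F :: "'s stream \<rightharpoonup> 's stream" where
    "F q = (case nat_rep q of None \<Rightarrow> None | Some n \<Rightarrow> Some (encode_seq (ms n)))" for q
  have ms_eq: "smap (\<lambda>i. ms n !! i) nats = ms n" for n by (rule stream_smap_nats[symmetric])
  show ?thesis
  proof (rule computableI)
    show "tm_computable F"
      by (rule recursive_sequence_computable[where G = "\<lambda>i n. ms n !! i", OF rec])
        (auto simp: F_def ms_eq nat_rep_eq_Some split: option.splits)
    show "\<exists>r. F q = Some r \<and> cauchy_rep (span_numbering smul e) r = Some y"
      if "nat_rep q = Some n" "Some (T (ell2_unit n)) = Some y" for q n y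
      using that ms(2)[of n] by (auto simp: F_def cauchy_rep_eq_Some)
  qed
qed

section \<open>From a computable sequence to computable synthesis\<close>

text \<open>Let \<open>n\<close> be the code of a finite rational combination \<open>\<Sum> q\<^sub>j u\<^sub>j\<close> of unit vectors.  Its image
  \<open>\<Sum> q\<^sub>j T u\<^sub>j\<close> is approximated by replacing each \<open>T u\<^sub>j\<close> by its approximation with error \<open>2\<^sup>-\<^sup>l\<close>.  There are
  at most \<open>n + 1\<close> terms with \<open>|q\<^sub>j| \<le> n\<close>, and \<open>(n + 1) n \<le> 4\<^sup>n\<close>, so \<open>l = i + 3 + 2 n\<close> makes the total error
  at most \<open>2\<^sup>-\<^sup>i\<^sup>-\<^sup>3\<close>.  The same error is allowed for replacing the argument by such a combination; this is achieved
  by entering its name \<open>s\<close> blocks later, where \<open>B 2\<^sup>-\<^sup>s \<le> 1/8\<close>.\<close>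

lemma computable_bounded_operator:
  fixes smul :: "'k::real_or_complex \<Rightarrow> 'h::banach \<Rightarrow> 'h" and T :: "'k ell2 \<Rightarrow> 'h"
  assumes hilbert: "hilbert_space smul ip"
    and lin: "Vector_Spaces.linear ell2_scale smul T"
    and bound: "\<And>c. norm (T c) \<le> B * norm c"
    and seq: "computable (nat_rep :: 's::{finite,zero_neq_one} stream \<rightharpoonup> nat)
      (cauchy_rep (span_numbering smul e)) (\<lambda>n. Some (T (ell2_unit n)))"
  shows "computable_operator TYPE('s) ell2_scale ell2_unit smul e T"
proof -
  interpret hilbert_space smul ip by (rule hilbert)
  interpret T: Vector_Spaces.linear ell2_scale smul T by (rule lin)
  define \<alpha> where "\<alpha> = span_numbering (ell2_scale :: 'k \<Rightarrow> _) ell2_unit"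
  define \<beta> where "\<beta> = span_numbering smul e"
  obtain M :: "'s machine" where M: "wf_machine M"
    "\<And>q n y. nat_rep q = Some n \<Longrightarrow> Some (T (ell2_unit n)) = Some y \<Longrightarrow>
      \<exists>r. transforms M q r \<and> cauchy_rep \<beta> r = Some y"
    using seq[folded \<beta>_def] by (rule computable_machine) (rule that)
  define q :: "nat \<Rightarrow> 's stream" where "q n = replicate n 1 @- sconst 0" for n
  have "nat_rep (q n) = Some n" for n by (simp add: nat_rep_eq_Some nat_name_def q_def)
  then have "\<exists>r. transforms M (q n) r \<and> cauchy_name \<beta> r (T (ell2_unit n))" for n
    using M(2)[of "q n" n] by (simp add: cauchy_rep_eq_Some)
  then have "\<exists>ms. transforms M (q n) (encode_seq ms) \<and>
      cauchy_name \<beta> (encode_seq ms :: 's stream) (T (ell2_unit n))" for n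
    by (metis cauchy_name_def)
  then obtain ms where ms: "\<And>n. transforms M (q n) (encode_seq (ms n))"
    "\<And>n. cauchy_name \<beta> (encode_seq (ms n) :: 's stream) (T (ell2_unit n))"
    by metis
  have "recursive (\<lambda>z. ms (pfst z) !! psnd z)"
  proof (rule recursive_machine_output[OF M(1)])
    show "q a !! i = of_bool (i < a)" for a i by (simp add: q_def shift_snth)
    show "recursive (\<lambda>z. of_bool (psnd z < pfst z))" by (intro rec_intros)
  qed (rule ms(1))
  then obtain C where C: "recursive (\<lambda>z. C (pfst z) (psnd z))" and
    C_eq: "\<And>n l. \<beta> (C n l) = (\<Sum>j\<le>pfst n. smul (scalar_numbering (coef n j)) (\<beta> (ms j !! l)))"
    by (rule substitution_code[OF vector_space_axioms, where e = e, folded \<beta>_def]) (rule that)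

  have C_close: "dist (\<beta> (C n (i + 3 + 2 * n))) (T (\<alpha> n)) \<le> (1/2) ^ (i + 3)" for n i
  proof -
    define l where "l = i + 3 + 2 * n"
    let ?q = "\<lambda>j. scalar_numbering (coef n j) :: 'k"
    have "\<alpha> n = (\<Sum>j\<le>pfst n. ell2_scale (?q j) (ell2_unit j))"
      unfolding \<alpha>_def by (rule span_numbering_coef[OF vector_space_ell2 order_refl])
    then have "T (\<alpha> n) = (\<Sum>j\<le>pfst n. smul (?q j) (T (ell2_unit j)))"
      by (simp add: T.sum T.scale)
    then have "\<beta> (C n l) - T (\<alpha> n) = (\<Sum>j\<le>pfst n. smul (?q j) (\<beta> (ms j !! l) - T (ell2_unit j)))"
      by (simp add: C_eq scale_right_diff_distrib sum_subtractf)
    also have "norm \<dots> \<le> (\<Sum>j\<le>pfst n. real n * (1/2) ^ l)"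
    proof (rule sum_norm_le)
      fix j
      have "norm (?q j) \<le> real n"
        using norm_scalar_numbering_le[of "coef n j", where 'k = 'k] coef_le[of n j] by linarith
      then show "norm (smul (?q j) (\<beta> (ms j !! l) - T (ell2_unit j))) \<le> real n * (1/2) ^ l"
        using cauchy_name_dist[OF ms(2)[of j], of l] unfolding norm_smul dist_norm
        by (intro mult_mono) auto
    qed
    also have "\<dots> = real (Suc (pfst n) * n) * (1/2) ^ l" by (simp add: algebra_simps)
    also have "\<dots> \<le> 2 ^ (2 * n) * (1/2) ^ l"
    proof (intro mult_right_mono)
      have "pfst n \<le> n" using le_prod_encode_1[of "pfst n" "psnd n"] by simp
      then have "Suc (pfst n) \<le> 2 ^ n" "n \<le> 2 ^ n" using less_exp[of n] by linarith+
      then have "Suc (pfst n) * n \<le> 2 ^ n * 2 ^ n" by (intro mult_mono) auto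
      then have "Suc (pfst n) * n \<le> 2 ^ (2 * n)" by (simp add: mult_2 power_add)
      then show "real (Suc (pfst n) * n) \<le> 2 ^ (2 * n)"
        by (metis of_nat_le_iff of_nat_numeral of_nat_power)
    qed simp
    also have "\<dots> = (1/2) ^ (i + 3)" by (simp add: l_def power_add power_divide)
    finally show ?thesis by (simp add: dist_norm l_def)
  qed

  obtain s :: nat where s: "B * (1/2) ^ s \<le> 1/8"
  proof -
    obtain s where "(1/2 :: real) ^ s < 1 / (8 * (\<bar>B\<bar> + 1))"
      using real_arch_pow_inv[of "1 / (8 * (\<bar>B\<bar> + 1))" "1/2"] by (auto simp: add_nonneg_pos)
    then have "(\<bar>B\<bar> + 1) * (1/2) ^ s \<le> 1/8" by (simp add: field_simps add_nonneg_pos)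
    moreover have "B * (1/2) ^ s \<le> (\<bar>B\<bar> + 1) * (1/2) ^ s" by (intro mult_right_mono) auto
    ultimately have "B * (1/2) ^ s \<le> 1/8" by linarith
    then show ?thesis by (rule that)
  qed
  define G where "G i n = C n (i + 3 + 2 * n)" for i n
  have G: "recursive (\<lambda>z. G (pfst z) (psnd z))"
    unfolding G_def by (intro recursive2[where F = C, OF C] rec_intros)
  define F :: "'s stream \<rightharpoonup> 's stream" where
    "F p = (if \<exists>ns. p = encode_seq ns
      then Some (encode_seq (smap (\<lambda>i. G i ((THE ns. p = encode_seq ns) !! (s + i))) nats)) else None)" for p
  have the: "(THE ns. (encode_seq ns' :: 's stream) = encode_seq ns) = ns'" for ns'
    by (simp add: encode_seq_inject)
  have "computable (cauchy_rep \<alpha> :: 's stream \<rightharpoonup> 'k ell2) (cauchy_rep \<beta>) (Some \<circ> T)"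
  proof (rule computableI)
    show "tm_computable F"
      by (rule recursive_transducer_computable[where c = s, OF G])
        (auto simp: F_def the encode_seq_inject split: if_splits)
    fix p :: "'s stream" and c y assume "cauchy_rep \<alpha> p = Some c" and y: "(Some \<circ> T) c = Some y"
    then obtain ns where p: "p = encode_seq ns" and c: "cauchy_name \<alpha> (encode_seq ns :: 's stream) c"
      unfolding cauchy_rep_eq_Some by (metis cauchy_name_def)
    let ?ms = "smap (\<lambda>i. G i (ns !! (s + i))) nats"
    have "cauchy_name \<beta> (encode_seq ?ms :: 's stream) (T c)"
    proof (rule cauchy_nameI)
      fix i
      let ?n = "ns !! (s + i)"
      have "dist (T (\<alpha> ?n)) (T c) = norm (T (\<alpha> ?n - c))" by (simp add: dist_norm T.diff)
      also have "\<dots> \<le> B * norm (\<alpha> ?n - c)" by (rule bound)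
      also have "\<dots> \<le> (1/2) ^ (i + 3)"
      proof (cases "B \<ge> 0")
        case True
        have "B * norm (\<alpha> ?n - c) \<le> B * (1/2) ^ (s + i)"
          using True cauchy_name_dist[OF c, of "s + i"] by (intro mult_left_mono) (auto simp: dist_norm)
        also have "\<dots> = (B * (1/2) ^ s) * (1/2) ^ i" by (simp add: power_add)
        also have "\<dots> \<le> 1/8 * (1/2) ^ i" by (intro mult_right_mono s) simp
        also have "\<dots> = (1/2) ^ (i + 3)" by (simp add: power_add power3_eq_cube)
        finally show ?thesis .
      next
        case False
        then have "B * norm (\<alpha> ?n - c) \<le> 0" by (simp add: mult_nonpos_nonneg)
        then show ?thesis by (rule order_trans) simp
      qed
      finally have "dist (T (\<alpha> ?n)) (T c) \<le> (1/2) ^ (i + 3)" .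
      moreover have "dist (\<beta> (?ms !! i)) (T (\<alpha> ?n)) \<le> (1/2) ^ (i + 3)"
        using C_close[of ?n i] by (simp add: G_def)
      ultimately have "dist (\<beta> (?ms !! i)) (T c) \<le> (1/2) ^ (i + 3) + (1/2) ^ (i + 3)"
        using dist_triangle[of "\<beta> (?ms !! i)" "T c" "T (\<alpha> ?n)"] by linarith
      then show "dist (\<beta> (?ms !! i)) (T c) \<le> (1/2) ^ (i + 2)"
        by (simp add: power_add power2_eq_square power3_eq_cube)
    qed
    then show "\<exists>r. F p = Some r \<and> cauchy_rep \<beta> r = Some y"
      using y by (auto simp: F_def p the encode_seq_inject cauchy_rep_eq_Some)
  qed
  then show ?thesis
    unfolding computable_operator_def \<alpha>_def \<beta>_def using lin by blast
qed

section \<open>Computable frames\<close>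

theorem theorem3p5:
  fixes smul :: "'k::real_or_complex \<Rightarrow> 'h::banach \<Rightarrow> 'h"
    and ip :: "'h \<Rightarrow> 'h \<Rightarrow> 'k"
    and e f :: "nat \<Rightarrow> 'h"
  assumes "computable_hilbert_space TYPE('s::{finite,zero_neq_one}) smul ip e"
  shows "computable_frame TYPE('s) smul ip e f \<longleftrightarrow>
    (\<forall>c :: 'k ell2. summable (\<lambda>k. smul (coord c k) (f k))) \<and>
    computable_operator TYPE('s) ell2_scale ell2_unit smul e (synthesis smul f) \<and>
    surj (synthesis smul f)"
proof -
  interpret hilbert_space smul ip
    using assms unfolding computable_hilbert_space_def by blast
  have f: "(Some \<circ> f) = (\<lambda>n. Some (synthesis smul f (ell2_unit n)))"
    by (simp add: synthesis_unit fun_eq_iff)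
  show ?thesis
  proof (intro iffI conjI allI)
    assume frame: "computable_frame TYPE('s) smul ip e f"
    then have "frame ip f" by (simp add: computable_frame_def)
    show summable: "summable (\<lambda>k. smul (coord c k) (f k))" for c :: "'k ell2"
      by (rule frame_summable) fact
    obtain B where "\<And>c. norm (synthesis smul f c) \<le> B * norm c"
      using \<open>frame ip f\<close> by (rule frame_synthesis_bounded) (rule that)
    then show "computable_operator TYPE('s) ell2_scale ell2_unit smul e (synthesis smul f)"
      using frame summable unfolding computable_frame_def f
      by (intro computable_bounded_operator[OF hilbert_space_axioms linear_synthesis]) auto
    show "surj (synthesis smul f)" by (rule frame_surj) fact
  next
    assume *: "(\<forall>c :: 'k ell2. summable (\<lambda>k. smul (coord c k) (f k))) \<and>
      computable_operator TYPE('s) ell2_scale ell2_unit smul e (synthesis smul f) \<and>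
      surj (synthesis smul f)"
    then have "frame ip f" by (intro surj_synthesis_frame) auto
    then show "computable_frame TYPE('s) smul ip e f"
      unfolding computable_frame_def f using * by (intro conjI computable_synthesis_sequence) auto
  qed
qed

end
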